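(* Let $N\hookrightarrow M$ be a Frobenius extension of rings of depth $n$, where $n=2^m+1$ for a positive integer $m$, and let $N=M_{-1}\hookrightarrow M=M_0\hookrightarrow M_1\hookrightarrow M_2\hookrightarrow\cdots$ be its Jones tower. Then the composite $N\hookrightarrow M_{n-2}$ is a depth two Frobenius extension.
   Context: Rings are unital. A ring extension $N\to M$ is a Frobenius extension if there are an $N$-$N$-bimodule map $E:M\to N$ and finitely many $x_i,y_i\in M$ with $\sum_iE(ax_i)y_i=a=\sum_ix_iE(y_ia)$ for all $a\in M$. The Jones tower of $N\hookrightarrow M$ is given by $M_{-1}=N$, $M_0=M$, and $M_{i+1}=\operatorname{End}(M_i)_{M_{i-1}}$ (right $M_{i-1}$-linear endomorphisms of $M_i$) for $i\ge0$, with $M_i\to M_{i+1}$ the left regular map $x\mapsto\lambda_x$. A tower of rings $A\,|\,B\,|\,C$ (ring homomorphisms $C\to B\to A$) is right (respectively left) depth three if, as $A$-$C$-bimodules (respectively $C$-$A$-bimodules), $A\otimes_BA$ is isomorphic to a direct summand of $A^k$ for some positive integer $k$. The Frobenius extension $N\hookrightarrow M$ is of depth $n>1$ if the tower $M_{n-2}\,|\,M_{n-3}\,|\,M_{-1}$ is right or left depth three. A ring extension $A\,|\,C$ is depth two if $A\otimes_CA$ is isomorphic to a direct summand of some $A^k$ both as $A$-$C$-bimodules and as $C$-$A$-bimodules. *)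

theory Defs
  imports "HOL-Algebra.Algebra"
begin

section \<open>Bimodules\<close>

text \<open>As for the library record \<^type>\<open>module\<close>, the additive structure of a bimodule is that of an
  underlying \<^type>\<open>ring\<close> record, whose multiplicative fields are never used. The acting rings are
  not part of the record and are passed separately.\<close>

record ('a, 'c, 'p) bimodule = "'p ring" +
  lsmult :: "'a \<Rightarrow> 'p \<Rightarrow> 'p"
  rsmult :: "'p \<Rightarrow> 'c \<Rightarrow> 'p"

definition bimod_hom ::
  "'a ring \<Rightarrow> 'c ring \<Rightarrow> ('a, 'c, 'p) bimodule \<Rightarrow> ('a, 'c, 'q) bimodule \<Rightarrow> ('p \<Rightarrow> 'q) set" where
  "bimod_hom A C P Q =
     {\<phi>. \<phi> \<in> carrier P \<rightarrow> carrier Q \<and>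
         (\<forall>p\<in>carrier P. \<forall>p'\<in>carrier P. \<phi> (p \<oplus>\<^bsub>P\<^esub> p') = \<phi> p \<oplus>\<^bsub>Q\<^esub> \<phi> p') \<and>
         (\<forall>a\<in>carrier A. \<forall>p\<in>carrier P. \<phi> (lsmult P a p) = lsmult Q a (\<phi> p)) \<and>
         (\<forall>p\<in>carrier P. \<forall>c\<in>carrier C. \<phi> (rsmult P p c) = rsmult Q (\<phi> p) c)}"

definition bimod_iso ::
  "'a ring \<Rightarrow> 'c ring \<Rightarrow> ('a, 'c, 'p) bimodule \<Rightarrow> ('a, 'c, 'q) bimodule \<Rightarrow> ('p \<Rightarrow> 'q) set" where
  "bimod_iso A C P Q = {\<phi> \<in> bimod_hom A C P Q. bij_betw \<phi> (carrier P) (carrier Q)}"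

definition subbimodule :: "'a ring \<Rightarrow> 'c ring \<Rightarrow> 'p set \<Rightarrow> ('a, 'c, 'p) bimodule \<Rightarrow> bool" where
  "subbimodule A C U Q \<longleftrightarrow> additive_subgroup U Q \<and>
     (\<forall>a\<in>carrier A. \<forall>u\<in>U. lsmult Q a u \<in> U) \<and>
     (\<forall>u\<in>U. \<forall>c\<in>carrier C. rsmult Q u c \<in> U)"

definition iso_to_direct_summand ::
  "'a ring \<Rightarrow> 'c ring \<Rightarrow> ('a, 'c, 'p) bimodule \<Rightarrow> ('a, 'c, 'q) bimodule \<Rightarrow> bool" where
  "iso_to_direct_summand A C P Q \<longleftrightarrow>
     (\<exists>U V. subbimodule A C U Q \<and> subbimodule A C V Q \<and>
            U <+>\<^bsub>Q\<^esub> V = carrier Q \<and> U \<inter> V = {\<zero>\<^bsub>Q\<^esub>} \<and>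
            bimod_iso A C P (Q\<lparr>carrier := U\<rparr>) \<noteq> {})"

text \<open>The ring \<open>R\<close> as a bimodule over rings mapping to it by \<open>u\<close> (acting from the left) and
  \<open>v\<close> (acting from the right).\<close>

definition ring_bimod :: "'r ring \<Rightarrow> ('a \<Rightarrow> 'r) \<Rightarrow> ('c \<Rightarrow> 'r) \<Rightarrow> ('a, 'c, 'r) bimodule" where
  "ring_bimod R u v =
     \<lparr>carrier = carrier R, monoid.mult = undefined, one = undefined,
      ring.zero = \<zero>\<^bsub>R\<^esub>, ring.add = (\<lambda>x y. x \<oplus>\<^bsub>R\<^esub> y),
      lsmult = (\<lambda>a x. u a \<otimes>\<^bsub>R\<^esub> x), rsmult = (\<lambda>x c. x \<otimes>\<^bsub>R\<^esub> v c)\<rparr>"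

definition bimod_power :: "('a, 'c, 'p) bimodule \<Rightarrow> nat \<Rightarrow> ('a, 'c, nat \<Rightarrow> 'p) bimodule" where
  "bimod_power P k =
     \<lparr>carrier = {..<k} \<rightarrow>\<^sub>E carrier P, monoid.mult = undefined, one = undefined,
      ring.zero = (\<lambda>i\<in>{..<k}. \<zero>\<^bsub>P\<^esub>), ring.add = (\<lambda>f g. \<lambda>i\<in>{..<k}. f i \<oplus>\<^bsub>P\<^esub> g i),
      lsmult = (\<lambda>a f. \<lambda>i\<in>{..<k}. lsmult P a (f i)),
      rsmult = (\<lambda>f c. \<lambda>i\<in>{..<k}. rsmult P (f i) c)\<rparr>"


section \<open>Tensor products\<close>

text \<open>The usual construction of \<open>P \<otimes>\<^sub>B Q\<close>: the free abelian group on
  \<open>carrier P \<times> carrier Q\<close> modulo the subgroup generated by the bilinearity and balancing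
  relations.\<close>

definition tensor_relations ::
  "'b ring \<Rightarrow> ('a, 'b, 'p) bimodule \<Rightarrow> ('b, 'c, 'q) bimodule \<Rightarrow> ('p \<times> 'q \<Rightarrow>\<^sub>0 int) set" where
  "tensor_relations B P Q =
     {frag_of (p \<oplus>\<^bsub>P\<^esub> p', q) - frag_of (p, q) - frag_of (p', q) | p p' q.
        p \<in> carrier P \<and> p' \<in> carrier P \<and> q \<in> carrier Q} \<union>
     {frag_of (p, q \<oplus>\<^bsub>Q\<^esub> q') - frag_of (p, q) - frag_of (p, q') | p q q'.
        p \<in> carrier P \<and> q \<in> carrier Q \<and> q' \<in> carrier Q} \<union>
     {frag_of (rsmult P p b, q) - frag_of (p, lsmult Q b q) | p b q.
        p \<in> carrier P \<and> b \<in> carrier B \<and> q \<in> carrier Q}"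

text \<open>The outer actions are \<open>a (p \<otimes> q) = (a p) \<otimes> q\<close> and \<open>(p \<otimes> q) c = p \<otimes> (q c)\<close>. On a class
  \<open>S\<close>, they are given as the union of the classes of the images of all its representatives; since
  the relations are preserved, these classes all coincide.\<close>

definition tensor ::
  "'b ring \<Rightarrow> ('a, 'b, 'p) bimodule \<Rightarrow> ('b, 'c, 'q) bimodule
     \<Rightarrow> ('a, 'c, ('p \<times> 'q \<Rightarrow>\<^sub>0 int) set) bimodule" where
  "tensor B P Q =
     (let F = free_Abelian_group (carrier P \<times> carrier Q);
          I = generate F (tensor_relations B P Q)
      in \<lparr>carrier = carrier (F Mod I), monoid.mult = undefined, one = undefined,
          ring.zero = \<one>\<^bsub>F Mod I\<^esub>, ring.add = (\<lambda>S T. S \<otimes>\<^bsub>F Mod I\<^esub> T),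
          lsmult = (\<lambda>a S. \<Union>x\<in>S. I #>\<^bsub>F\<^esub> frag_extend (\<lambda>(p, q). frag_of (lsmult P a p, q)) x),
          rsmult = (\<lambda>S c. \<Union>x\<in>S. I #>\<^bsub>F\<^esub> frag_extend (\<lambda>(p, q). frag_of (p, rsmult Q q c)) x)\<rparr>)"


section \<open>Ring extensions and towers\<close>

text \<open>Rings are not assumed commutative. A ring extension is an arbitrary unital ring homomorphism;
  injectivity is not required.\<close>

definition ring_extension :: "'n ring \<Rightarrow> 'm ring \<Rightarrow> ('n \<Rightarrow> 'm) \<Rightarrow> bool" where
  "ring_extension N M \<iota> \<longleftrightarrow> ring N \<and> ring M \<and> \<iota> \<in> ring_hom N M"

definition frobenius_extension :: "'n ring \<Rightarrow> 'm ring \<Rightarrow> ('n \<Rightarrow> 'm) \<Rightarrow> bool" where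
  "frobenius_extension N M \<iota> \<longleftrightarrow> ring_extension N M \<iota> \<and>
     (\<exists>E \<in> bimod_hom N N (ring_bimod M \<iota> \<iota>) (ring_bimod N id id).
      \<exists>(r::nat) x y. x \<in> {..<r} \<rightarrow> carrier M \<and> y \<in> {..<r} \<rightarrow> carrier M \<and>
        (\<forall>a\<in>carrier M.
           (\<Oplus>\<^bsub>M\<^esub>i\<in>{..<r}. \<iota> (E (a \<otimes>\<^bsub>M\<^esub> x i)) \<otimes>\<^bsub>M\<^esub> y i) = a \<and>
           (\<Oplus>\<^bsub>M\<^esub>i\<in>{..<r}. x i \<otimes>\<^bsub>M\<^esub> \<iota> (E (y i \<otimes>\<^bsub>M\<^esub> a))) = a))"

text \<open>Towers \<open>A | B | C\<close>, with structure maps \<open>f : C \<rightarrow> B\<close> and \<open>g : B \<rightarrow> A\<close>.\<close>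

definition right_depth_three ::
  "'a ring \<Rightarrow> 'b ring \<Rightarrow> 'c ring \<Rightarrow> ('c \<Rightarrow> 'b) \<Rightarrow> ('b \<Rightarrow> 'a) \<Rightarrow> bool" where
  "right_depth_three A B C f g \<longleftrightarrow> ring_extension C B f \<and> ring_extension B A g \<and>
     (\<exists>k>0. iso_to_direct_summand A C
        (tensor B (ring_bimod A id g) (ring_bimod A g (g \<circ> f)))
        (bimod_power (ring_bimod A id (g \<circ> f)) k))"

definition left_depth_three ::
  "'a ring \<Rightarrow> 'b ring \<Rightarrow> 'c ring \<Rightarrow> ('c \<Rightarrow> 'b) \<Rightarrow> ('b \<Rightarrow> 'a) \<Rightarrow> bool" where
  "left_depth_three A B C f g \<longleftrightarrow> ring_extension C B f \<and> ring_extension B A g \<and>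
     (\<exists>k>0. iso_to_direct_summand C A
        (tensor B (ring_bimod A (g \<circ> f) g) (ring_bimod A g id))
        (bimod_power (ring_bimod A (g \<circ> f) id) k))"

definition depth_two :: "'a ring \<Rightarrow> 'c ring \<Rightarrow> ('c \<Rightarrow> 'a) \<Rightarrow> bool" where
  "depth_two A C u \<longleftrightarrow> ring_extension C A u \<and>
     (\<exists>k>0. iso_to_direct_summand A C
              (tensor C (ring_bimod A id u) (ring_bimod A u u))
              (bimod_power (ring_bimod A id u) k) \<and>
            iso_to_direct_summand C A
              (tensor C (ring_bimod A u u) (ring_bimod A u id))
              (bimod_power (ring_bimod A u id) k))"


section \<open>The Jones tower\<close>

text \<open>The ring of right \<open>N\<close>-linear endomorphisms of \<open>M\<close>, where \<open>N\<close> acts through \<open>\<iota>\<close>.\<close>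

definition right_End :: "'n ring \<Rightarrow> 'm ring \<Rightarrow> ('n \<Rightarrow> 'm) \<Rightarrow> ('m \<Rightarrow> 'm) ring" where
  "right_End N M \<iota> =
     \<lparr>carrier = {\<phi> \<in> carrier M \<rightarrow>\<^sub>E carrier M.
        (\<forall>x\<in>carrier M. \<forall>y\<in>carrier M. \<phi> (x \<oplus>\<^bsub>M\<^esub> y) = \<phi> x \<oplus>\<^bsub>M\<^esub> \<phi> y) \<and>
        (\<forall>x\<in>carrier M. \<forall>a\<in>carrier N. \<phi> (x \<otimes>\<^bsub>M\<^esub> \<iota> a) = \<phi> x \<otimes>\<^bsub>M\<^esub> \<iota> a)},
      monoid.mult = (\<lambda>\<phi> \<psi>. compose (carrier M) \<phi> \<psi>), one = (\<lambda>x\<in>carrier M. x),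
      ring.zero = (\<lambda>x\<in>carrier M. \<zero>\<^bsub>M\<^esub>), ring.add = (\<lambda>\<phi> \<psi>. \<lambda>x\<in>carrier M. \<phi> x \<oplus>\<^bsub>M\<^esub> \<psi> x)\<rparr>"

text \<open>The Jones tower of \<open>\<iota> : N \<rightarrow> M\<close>, with indices shifted to start at \<open>0\<close>: \<open>R k\<close> is
  \<open>M\<^bsub>k-1\<^esub>\<close> (so \<open>R 0 = N\<close> and \<open>R 1 = M\<close>), and \<open>h k\<close> is the map \<open>R k \<rightarrow> R (Suc k)\<close>.
  Iterating \<^const>\<open>right_End\<close> literally would change the element type at every step. Therefore
  \<open>R (k + 2)\<close> is any ring identified with the endomorphism ring of \<open>R (k + 1)\<close> over \<open>R k\<close> by an
  isomorphism carrying \<open>h (k + 1)\<close> to the left regular map. Only the levels up to \<open>L\<close> are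
  constrained. As \<open>'u\<close> is arbitrary, for given \<open>L\<close> it can be taken large enough (for example, a
  sum of iterated function types) to hold copies of any \<open>N\<close>, \<open>M\<close> and of all these levels.\<close>

definition jones_tower ::
  "nat \<Rightarrow> 'u ring \<Rightarrow> 'u ring \<Rightarrow> ('u \<Rightarrow> 'u) \<Rightarrow> (nat \<Rightarrow> 'u ring) \<Rightarrow> (nat \<Rightarrow> 'u \<Rightarrow> 'u) \<Rightarrow> bool" where
  "jones_tower L N M \<iota> R h \<longleftrightarrow> R 0 = N \<and> R 1 = M \<and> h 0 = \<iota> \<and>
     (\<forall>k<L. ring_extension (R k) (R (Suc k)) (h k)) \<and>
     (\<forall>k. k + 2 \<le> L \<longrightarrow>
        (\<exists>\<Phi> \<in> ring_iso (R (k + 2)) (right_End (R k) (R (k + 1)) (h k)).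
           \<forall>x\<in>carrier (R (k + 1)).
             \<Phi> (h (k + 1) x) = (\<lambda>y\<in>carrier (R (k + 1)). x \<otimes>\<^bsub>R (k + 1)\<^esub> y)))"

text \<open>The composite \<open>R 0 \<rightarrow> R k\<close>.\<close>

primrec tower_map :: "(nat \<Rightarrow> 'u \<Rightarrow> 'u) \<Rightarrow> nat \<Rightarrow> 'u \<Rightarrow> 'u" where
  "tower_map h 0 = id"
| "tower_map h (Suc k) = h k \<circ> tower_map h k"

text \<open>Depth \<open>n > 1\<close> refers to the tower \<open>M\<^bsub>n-2\<^esub> | M\<^bsub>n-3\<^esub> | M\<^bsub>-1\<^esub>\<close>, that is
  \<open>R (n - 1) | R (n - 2) | R 0\<close>.\<close>

definition tower_depth :: "(nat \<Rightarrow> 'u ring) \<Rightarrow> (nat \<Rightarrow> 'u \<Rightarrow> 'u) \<Rightarrow> nat \<Rightarrow> bool" where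
  "tower_depth R h n \<longleftrightarrow> n > 1 \<and>
     (right_depth_three (R (n - 1)) (R (n - 2)) (R 0) (tower_map h (n - 2)) (h (n - 2)) \<or>
      left_depth_three (R (n - 1)) (R (n - 2)) (R 0) (tower_map h (n - 2)) (h (n - 2)))"

end

theory Submission
  imports Defs
begin

text \<open>Let \<open>N = R\<^sub>0 \<rightarrow> R\<^sub>1 \<rightarrow> \<dots> \<rightarrow> R\<^sub>L = A\<close> be the tower. The mathematical heart is that depth three of
  \<open>A | R\<^bsub>L-1\<^esub> | N\<close> propagates downwards: if \<open>A \<otimes> A\<close> over \<open>R\<^bsub>L-1\<^esub>\<close> is, as an \<open>A\<close>-\<open>N\<close>-bimodule, a
  direct summand of a power of \<open>A\<close>, then so is \<open>A \<otimes> A\<close> over every \<open>R\<^sub>k\<close>, down to \<open>R\<^sub>0 = N\<close>, where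
  this is one half of depth two of \<open>A | N\<close>. The other half follows by symmetry.

  The basic construction gives \<open>R\<^bsub>k+2\<^esub> = R\<^bsub>k+1\<^esub> e R\<^bsub>k+1\<^esub>\<close>, which is \<open>R\<^bsub>k+1\<^esub> \<otimes> R\<^bsub>k+1\<^esub>\<close> over \<open>R\<^sub>k\<close>. Hence
  \<open>R\<^bsub>k+1\<^esub> \<otimes> A\<close> over \<open>R\<^sub>k\<close> is isomorphic to \<open>R\<^bsub>k+2\<^esub> \<otimes> A\<close> over \<open>R\<^bsub>k+1\<^esub>\<close>, as an \<open>R\<^bsub>k+1\<^esub>\<close>-\<open>N\<close>-bimodule, and so
  step by step to \<open>A \<otimes> A\<close> over \<open>R\<^bsub>L-1\<^esub>\<close>. Each of these is therefore a summand of a power of \<open>A\<close>, and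
  \<open>A \<otimes> A\<close> over \<open>R\<^sub>k\<close> is reached by tensoring: it is \<open>A \<otimes> (R\<^bsub>k+1\<^esub> \<otimes> A)\<close>, the outer product over
  \<open>R\<^bsub>k+1\<^esub>\<close> and the inner one over \<open>R\<^sub>k\<close>.

  For Frobenius extensions, all these statements can be expressed by finitely many additive
  endomorphisms of \<open>A\<close>, without tensor products. With \<open>\<epsilon>\<close> the Frobenius homomorphism, seen as a map
  \<open>A \<rightarrow> A\<close>, depth three means \<open>\<Sum>\<^sub>i \<beta>\<^sub>i(b) \<sigma>\<^sub>i(a) = \<epsilon>(b a)\<close> for suitable bilinear maps \<open>\<beta>\<^sub>i\<close> and \<open>\<sigma>\<^sub>i\<close>
  (\<open>right_tensor_summand_iff_pairing\<close>). This condition is invariant under passage to the opposite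
  ring, so that left and right depth three agree (\<open>left_tensor_summand_iff_pairing\<close>). It is also
  equivalent to \<open>\<Sum>\<^sub>i \<tau>\<^sub>i(z \<beta>\<^sub>i(a)) = \<epsilon>(z) a\<close> for bilinear \<open>\<tau>\<^sub>i\<close> and \<open>\<beta>\<^sub>i\<close>. In this second form, the
  isomorphism above amounts to multiplying \<open>\<tau>\<^sub>i\<close> and \<open>\<beta>\<^sub>i\<close> by the Jones projection
  (\<open>depth_quasibase_corner\<close>), and iterating tensor products amounts to composing maps
  (\<open>depth_quasibase_comp\<close>). The lemma \<open>quasibase_descent\<close> combines the two, and is applied from the
  top of the tower to the bottom. That \<open>N \<rightarrow> A\<close> is Frobenius follows from transitivity and from
  the basic construction.\<close>

section \<open>Additive maps and finite sums\<close>

abbreviation additive_maps ::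
  "('p, 'x) ring_scheme \<Rightarrow> ('q, 'y) ring_scheme \<Rightarrow> ('p \<Rightarrow> 'q) set" where
  "additive_maps G H \<equiv> hom (add_monoid G) (add_monoid H)"

lemma additive_mapsI:
  assumes "\<And>x. x \<in> carrier G \<Longrightarrow> f x \<in> carrier H"
    and "\<And>x y. x \<in> carrier G \<Longrightarrow> y \<in> carrier G \<Longrightarrow> f (x \<oplus>\<^bsub>G\<^esub> y) = f x \<oplus>\<^bsub>H\<^esub> f y"
  shows "f \<in> additive_maps G H"
  using assms by (auto simp: hom_def)

lemma additive_maps_closed: "f \<in> additive_maps G H \<Longrightarrow> x \<in> carrier G \<Longrightarrow> f x \<in> carrier H"
  by (auto simp: hom_def)

lemma additive_maps_add:
  "f \<in> additive_maps G H \<Longrightarrow> x \<in> carrier G \<Longrightarrow> y \<in> carrier G \<Longrightarrow> f (x \<oplus>\<^bsub>G\<^esub> y) = f x \<oplus>\<^bsub>H\<^esub> f y"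
  by (auto simp: hom_def)

lemma additive_maps_zero:
  assumes "abelian_group G" "abelian_group H" "f \<in> additive_maps G H"
  shows "f \<zero>\<^bsub>G\<^esub> = \<zero>\<^bsub>H\<^esub>"
  using hom_one[OF assms(3) abelian_group.a_group[OF assms(1)] abelian_group.a_group[OF assms(2)]]
  by simp

lemma additive_maps_uminus:
  assumes "abelian_group G" "abelian_group H" "f \<in> additive_maps G H" "x \<in> carrier G"
  shows "f (\<ominus>\<^bsub>G\<^esub> x) = \<ominus>\<^bsub>H\<^esub> f x"
proof -
  interpret group_hom "add_monoid G" "add_monoid H" f
    using assms(3) abelian_group.a_group[OF assms(1)] abelian_group.a_group[OF assms(2)]
    by (simp add: group_hom_def group_hom_axioms_def)
  show ?thesis
    using hom_inv[of x] assms(4) by (simp add: a_inv_def)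
qed

lemma additive_maps_finsum:
  assumes G: "abelian_group G" and H: "abelian_group H" and f: "f \<in> additive_maps G H"
    and s: "s \<in> I \<rightarrow> carrier G"
  shows "f (\<Oplus>\<^bsub>G\<^esub>i\<in>I. s i) = (\<Oplus>\<^bsub>H\<^esub>i\<in>I. f (s i))"
proof -
  interpret G: abelian_group G by fact
  interpret H: abelian_group H by fact
  show ?thesis
    using s
  proof (induction I rule: infinite_finite_induct)
    case (insert i I)
    have "f (\<Oplus>\<^bsub>G\<^esub>j\<in>insert i I. s j) = f (s i \<oplus>\<^bsub>G\<^esub> (\<Oplus>\<^bsub>G\<^esub>j\<in>I. s j))"
      using insert by (subst G.finsum_insert) auto
    also have "\<dots> = f (s i) \<oplus>\<^bsub>H\<^esub> (\<Oplus>\<^bsub>H\<^esub>j\<in>I. f (s j))"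
      using insert by (subst additive_maps_add[OF f]) (auto intro: G.finsum_closed)
    also have "\<dots> = (\<Oplus>\<^bsub>H\<^esub>j\<in>insert i I. f (s j))"
      using insert by (subst H.finsum_insert) (auto intro: additive_maps_closed[OF f])
    finally show ?case .
  qed (simp_all add: additive_maps_zero[OF G H f])
qed

context abelian_group
begin

lemma finsum_additive_maps:
  assumes P: "abelian_group P" and f: "\<And>i. i \<in> I \<Longrightarrow> f i \<in> additive_maps P G"
  shows "(\<lambda>p. \<Oplus>i\<in>I. f i p) \<in> additive_maps P G"
proof (rule additive_mapsI)
  fix x assume "x \<in> carrier P"
  then show "(\<Oplus>i\<in>I. f i x) \<in> carrier G"
    by (auto intro!: finsum_closed intro: additive_maps_closed[OF f])
next
  interpret P: abelian_group P by fact
  fix x y assume xy: "x \<in> carrier P" "y \<in> carrier P"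
  then have "(\<Oplus>i\<in>I. f i (x \<oplus>\<^bsub>P\<^esub> y)) = (\<Oplus>i\<in>I. f i x \<oplus> f i y)"
    by (intro finsum_cong')
      (auto simp: additive_maps_add[OF f] intro!: a_closed intro: additive_maps_closed[OF f])
  also have "\<dots> = (\<Oplus>i\<in>I. f i x) \<oplus> (\<Oplus>i\<in>I. f i y)"
    using xy by (intro finsum_addf) (auto intro: additive_maps_closed[OF f])
  finally show "(\<Oplus>i\<in>I. f i (x \<oplus>\<^bsub>P\<^esub> y)) = (\<Oplus>i\<in>I. f i x) \<oplus> (\<Oplus>i\<in>I. f i y)" .
qed

lemma finsum_swap:
  assumes s: "\<And>i j. i \<in> I \<Longrightarrow> j \<in> J \<Longrightarrow> s i j \<in> carrier G"
  shows "(\<Oplus>i\<in>I. \<Oplus>j\<in>J. s i j) = (\<Oplus>j\<in>J. \<Oplus>i\<in>I. s i j)"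
  using s
proof (induction I rule: infinite_finite_induct)
  case (insert i I)
  have "(\<Oplus>i\<in>insert i I. \<Oplus>j\<in>J. s i j) = (\<Oplus>j\<in>J. s i j) \<oplus> (\<Oplus>j\<in>J. \<Oplus>i\<in>I. s i j)"
    using insert by (subst finsum_insert) (auto intro!: finsum_closed)
  also have "\<dots> = (\<Oplus>j\<in>J. s i j \<oplus> (\<Oplus>i\<in>I. s i j))"
    using insert by (intro finsum_addf[symmetric]) (auto intro!: finsum_closed)
  also have "\<dots> = (\<Oplus>j\<in>J. \<Oplus>i\<in>insert i I. s i j)"
    using insert by (intro finsum_cong') (auto intro!: finsum_closed simp: finsum_insert Pi_iff)
  finally show ?case .
qed (simp_all add: finsum_zero)

text \<open>Quotient and remainder by \<open>l\<close> enumerate the pairs of indices, so that a family indexed by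
  pairs can be indexed by an initial segment of the natural numbers again.\<close>

lemma finsum_div_mod:
  fixes k l :: nat
  assumes s: "\<And>i j. i < k \<Longrightarrow> j < l \<Longrightarrow> s i j \<in> carrier G"
  shows "(\<Oplus>i\<in>{..<k * l}. s (i div l) (i mod l)) = (\<Oplus>i\<in>{..<k}. \<Oplus>j\<in>{..<l}. s i j)"
  using s
proof (induction k)
  case (Suc k)
  have closed: "s (i div l) (i mod l) \<in> carrier G" if "i < Suc k * l" for i
  proof -
    have "0 < l"
      using that by (cases l) auto
    with that show ?thesis
      by (intro Suc.prems) (auto simp: less_mult_imp_div_less)
  qed
  have reindex: "(\<Oplus>i\<in>{k * l..<Suc k * l}. s (i div l) (i mod l)) = (\<Oplus>j\<in>{..<l}. s k j)"
  proof -
    have img: "{k * l..<Suc k * l} = (\<lambda>j. k * l + j) ` {..<l}"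
      by (simp add: lessThan_atLeast0 add.commute)
    have "(\<Oplus>i\<in>{k * l..<Suc k * l}. s (i div l) (i mod l))
        = (\<Oplus>j\<in>{..<l}. s ((k * l + j) div l) ((k * l + j) mod l))"
      unfolding img by (intro finsum_reindex) (auto simp: inj_on_def intro: Suc.prems)
    also have "\<dots> = (\<Oplus>j\<in>{..<l}. s k j)"
      by (intro finsum_cong') (auto intro: Suc.prems)
    finally show ?thesis .
  qed
  have "{..<Suc k * l} = {..<k * l} \<union> {k * l..<Suc k * l}"
    by auto
  then have "(\<Oplus>i\<in>{..<Suc k * l}. s (i div l) (i mod l))
      = (\<Oplus>i\<in>{..<k * l}. s (i div l) (i mod l)) \<oplus> (\<Oplus>i\<in>{k * l..<Suc k * l}. s (i div l) (i mod l))"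
    using closed by (simp only:) (intro finsum_Un_disjoint; force)
  also have "\<dots> = (\<Oplus>i\<in>{..<k}. \<Oplus>j\<in>{..<l}. s i j) \<oplus> (\<Oplus>j\<in>{..<l}. s k j)"
    using Suc reindex by simp
  also have "\<dots> = (\<Oplus>i\<in>{..<Suc k}. \<Oplus>j\<in>{..<l}. s i j)"
    using Suc.prems by (simp add: lessThan_Suc finsum_closed a_comm Pi_iff)
  finally show ?case .
qed simp

end


section \<open>Bimodules and direct summands\<close>

locale additive_bimodule = abelian_group P
  for A :: "'a ring" and C :: "'c ring" and P :: "('a, 'c, 'p) bimodule" (structure) +
  assumes lsmult_additive: "a \<in> carrier A \<Longrightarrow> lsmult P a \<in> additive_maps P P"
    and rsmult_additive: "c \<in> carrier C \<Longrightarrow> (\<lambda>p. rsmult P p c) \<in> additive_maps P P"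
    and smult_assoc: "a \<in> carrier A \<Longrightarrow> c \<in> carrier C \<Longrightarrow> p \<in> carrier P \<Longrightarrow>
      rsmult P (lsmult P a p) c = lsmult P a (rsmult P p c)"
begin

lemmas lsmult_closed = additive_maps_closed[OF lsmult_additive]
lemmas rsmult_closed = additive_maps_closed[OF rsmult_additive]
lemmas lsmult_add = additive_maps_add[OF lsmult_additive]
lemmas rsmult_add = additive_maps_add[OF rsmult_additive]
lemmas lsmult_zero = additive_maps_zero[OF abelian_group_axioms abelian_group_axioms lsmult_additive]
lemmas rsmult_zero = additive_maps_zero[OF abelian_group_axioms abelian_group_axioms rsmult_additive]

end

lemma bimod_hom_altdef:
  "bimod_hom A C P Q = {f \<in> additive_maps P Q.
     (\<forall>a\<in>carrier A. \<forall>p\<in>carrier P. f (lsmult P a p) = lsmult Q a (f p)) \<and>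
     (\<forall>p\<in>carrier P. \<forall>c\<in>carrier C. f (rsmult P p c) = rsmult Q (f p) c)}"
  by (auto simp: bimod_hom_def hom_def)

lemma bimod_hom_comp:
  assumes "f \<in> bimod_hom A C P Q" "g \<in> bimod_hom A C Q S"
  shows "g \<circ> f \<in> bimod_hom A C P S"
  using assms by (auto simp: bimod_hom_def Pi_iff)

text \<open>The complement of the image of a split monomorphism \<open>f\<close> is the kernel of its retraction.\<close>

lemma iso_to_direct_summand_iff_retract:
  assumes P: "additive_bimodule A C P" and Q: "additive_bimodule A C Q"
  shows "iso_to_direct_summand A C P Q \<longleftrightarrow>
    (\<exists>f\<in>bimod_hom A C P Q. \<exists>g\<in>bimod_hom A C Q P. \<forall>p\<in>carrier P. g (f p) = p)"
proof
  interpret P: additive_bimodule A C P by fact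
  interpret Q: additive_bimodule A C Q by fact
  assume "iso_to_direct_summand A C P Q"
  then obtain U V \<phi> where U: "subbimodule A C U Q" and V: "subbimodule A C V Q"
    and sum: "U <+>\<^bsub>Q\<^esub> V = carrier Q" and int: "U \<inter> V = {\<zero>\<^bsub>Q\<^esub>}"
    and \<phi>: "\<phi> \<in> bimod_iso A C P (Q\<lparr>carrier := U\<rparr>)"
    by (auto simp: iso_to_direct_summand_def)
  interpret U: additive_subgroup U Q using U by (simp add: subbimodule_def)
  interpret V: additive_subgroup V Q using V by (simp add: subbimodule_def)
  have U_sub: "\<And>u. u \<in> U \<Longrightarrow> u \<in> carrier Q" and V_sub: "\<And>v. v \<in> V \<Longrightarrow> v \<in> carrier Q"
    using U.a_subset V.a_subset by auto
  have bij: "bij_betw \<phi> (carrier P) U"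
    using \<phi> by (simp add: bimod_iso_def)
  have \<phi>_add: "\<phi> (p \<oplus>\<^bsub>P\<^esub> p') = \<phi> p \<oplus>\<^bsub>Q\<^esub> \<phi> p'" if "p \<in> carrier P" "p' \<in> carrier P" for p p'
    using \<phi> that by (simp add: bimod_iso_def bimod_hom_def)
  have \<phi>_l: "\<phi> (lsmult P a p) = lsmult Q a (\<phi> p)" if "a \<in> carrier A" "p \<in> carrier P" for a p
    using \<phi> that by (simp add: bimod_iso_def bimod_hom_def)
  have \<phi>_r: "\<phi> (rsmult P p c) = rsmult Q (\<phi> p) c" if "c \<in> carrier C" "p \<in> carrier P" for c p
    using \<phi> that by (simp add: bimod_iso_def bimod_hom_def)
  have \<phi>_U: "\<phi> p \<in> U" if "p \<in> carrier P" for p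
    using bij that by (auto simp: bij_betw_def)
  have ex: "\<exists>p v. p \<in> carrier P \<and> v \<in> V \<and> q = \<phi> p \<oplus>\<^bsub>Q\<^esub> v" if q: "q \<in> carrier Q" for q
  proof -
    obtain u v where "u \<in> U" "v \<in> V" "q = u \<oplus>\<^bsub>Q\<^esub> v"
      using q unfolding sum[symmetric] by (auto simp: set_add_def set_mult_def)
    then show ?thesis
      using bij by (auto simp: bij_betw_def)
  qed
  have unique: "p = p'"
    if "p \<in> carrier P" "p' \<in> carrier P" "v \<in> V" "v' \<in> V" "\<phi> p \<oplus>\<^bsub>Q\<^esub> v = \<phi> p' \<oplus>\<^bsub>Q\<^esub> v'" for p p' v v'
  proof -
    have c: "\<phi> p \<in> carrier Q" "\<phi> p' \<in> carrier Q" "v \<in> carrier Q" "v' \<in> carrier Q"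
      using that by (auto intro: U_sub V_sub \<phi>_U)
    have "\<phi> p \<ominus>\<^bsub>Q\<^esub> \<phi> p' = v' \<ominus>\<^bsub>Q\<^esub> v"
    proof -
      have "\<phi> p \<ominus>\<^bsub>Q\<^esub> \<phi> p' = (\<phi> p \<oplus>\<^bsub>Q\<^esub> v) \<ominus>\<^bsub>Q\<^esub> v \<ominus>\<^bsub>Q\<^esub> \<phi> p'"
        using c by (simp add: Q.minus_eq Q.a_assoc Q.r_neg)
      also have "\<dots> = (\<phi> p' \<oplus>\<^bsub>Q\<^esub> v') \<ominus>\<^bsub>Q\<^esub> v \<ominus>\<^bsub>Q\<^esub> \<phi> p'"
        using that by simp
      also have "\<dots> = v' \<ominus>\<^bsub>Q\<^esub> v"
        using c Q.a_lcomm[of "\<phi> p'" "v' \<ominus>\<^bsub>Q\<^esub> v" "\<ominus>\<^bsub>Q\<^esub> \<phi> p'"]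
        by (simp add: Q.minus_eq Q.a_assoc Q.r_neg)
      finally show ?thesis .
    qed
    moreover have "\<phi> p \<ominus>\<^bsub>Q\<^esub> \<phi> p' \<in> U" "v' \<ominus>\<^bsub>Q\<^esub> v \<in> V"
      using that \<phi>_U by (auto simp: Q.minus_eq)
    ultimately have "\<phi> p \<ominus>\<^bsub>Q\<^esub> \<phi> p' = \<zero>\<^bsub>Q\<^esub>"
      using int by auto
    then have "\<phi> p \<ominus>\<^bsub>Q\<^esub> \<phi> p' \<oplus>\<^bsub>Q\<^esub> \<phi> p' = \<phi> p'"
      using c by simp
    then have "\<phi> p = \<phi> p'"
      using c by (simp add: Q.minus_eq Q.a_assoc Q.l_neg)
    with that bij show ?thesis
      by (auto simp: bij_betw_def inj_on_def)
  qed
  obtain g where g0: "\<And>q. q \<in> carrier Q \<Longrightarrow> g q \<in> carrier P \<and> (\<exists>v. v \<in> V \<and> q = \<phi> (g q) \<oplus>\<^bsub>Q\<^esub> v)"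
    using ex by metis
  have g: "g (\<phi> p \<oplus>\<^bsub>Q\<^esub> v) = p" if "p \<in> carrier P" "v \<in> V" for p v
    using g0[of "\<phi> p \<oplus>\<^bsub>Q\<^esub> v"] unique that by (metis Q.a_closed U_sub V_sub \<phi>_U)
  have "g \<in> bimod_hom A C Q P"
    unfolding bimod_hom_altdef
  proof (intro CollectI conjI ballI additive_mapsI)
    fix q assume "q \<in> carrier Q"
    then show "g q \<in> carrier P" using g0 by blast
  next
    fix q q' assume q: "q \<in> carrier Q" "q' \<in> carrier Q"
    obtain p v p' v' where pv: "p \<in> carrier P" "p' \<in> carrier P" "v \<in> V" "v' \<in> V"
        "q = \<phi> p \<oplus>\<^bsub>Q\<^esub> v" "q' = \<phi> p' \<oplus>\<^bsub>Q\<^esub> v'"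
      using ex q by metis
    have c: "\<phi> p \<in> carrier Q" "\<phi> p' \<in> carrier Q" "v \<in> carrier Q" "v' \<in> carrier Q"
      using pv by (auto intro: U_sub V_sub \<phi>_U)
    have "q \<oplus>\<^bsub>Q\<^esub> q' = \<phi> (p \<oplus>\<^bsub>P\<^esub> p') \<oplus>\<^bsub>Q\<^esub> (v \<oplus>\<^bsub>Q\<^esub> v')"
      using c pv by (simp add: \<phi>_add Q.a_ac)
    then show "g (q \<oplus>\<^bsub>Q\<^esub> q') = g q \<oplus>\<^bsub>P\<^esub> g q'"
      using pv by (simp add: g)
  next
    fix a q assume a: "a \<in> carrier A" and q: "q \<in> carrier Q"
    obtain p v where pv: "p \<in> carrier P" "v \<in> V" "q = \<phi> p \<oplus>\<^bsub>Q\<^esub> v"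
      using ex q by metis
    have "lsmult Q a q = \<phi> (lsmult P a p) \<oplus>\<^bsub>Q\<^esub> lsmult Q a v"
      using a pv by (simp add: \<phi>_l Q.lsmult_add U_sub V_sub \<phi>_U)
    moreover have "lsmult Q a v \<in> V"
      using V a pv by (simp add: subbimodule_def)
    ultimately show "g (lsmult Q a q) = lsmult P a (g q)"
      using a pv by (simp add: g P.lsmult_closed)
  next
    fix q c assume c: "c \<in> carrier C" and q: "q \<in> carrier Q"
    obtain p v where pv: "p \<in> carrier P" "v \<in> V" "q = \<phi> p \<oplus>\<^bsub>Q\<^esub> v"
      using ex q by metis
    have "rsmult Q q c = \<phi> (rsmult P p c) \<oplus>\<^bsub>Q\<^esub> rsmult Q v c"
      using c pv by (simp add: \<phi>_r Q.rsmult_add U_sub V_sub \<phi>_U)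
    moreover have "rsmult Q v c \<in> V"
      using V c pv by (simp add: subbimodule_def)
    ultimately show "g (rsmult Q q c) = rsmult P (g q) c"
      using c pv by (simp add: g P.rsmult_closed)
  qed
  moreover have "\<phi> \<in> bimod_hom A C P Q"
    by (auto simp: bimod_hom_altdef \<phi>_l \<phi>_r intro!: additive_mapsI U_sub \<phi>_U \<phi>_add)
  moreover have "g (\<phi> p) = p" if "p \<in> carrier P" for p
    using g[OF that V.zero_closed] that by (simp add: U_sub \<phi>_U)
  ultimately show "\<exists>f\<in>bimod_hom A C P Q. \<exists>g\<in>bimod_hom A C Q P. \<forall>p\<in>carrier P. g (f p) = p"
    by blast
next
  interpret P: additive_bimodule A C P by fact
  interpret Q: additive_bimodule A C Q by fact
  assume "\<exists>f\<in>bimod_hom A C P Q. \<exists>g\<in>bimod_hom A C Q P. \<forall>p\<in>carrier P. g (f p) = p"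
  then obtain f g where f: "f \<in> bimod_hom A C P Q" and g: "g \<in> bimod_hom A C Q P"
    and gf: "\<And>p. p \<in> carrier P \<Longrightarrow> g (f p) = p"
    by blast
  have fa: "f \<in> additive_maps P Q" and ga: "g \<in> additive_maps Q P"
    using f g by (auto simp: bimod_hom_altdef)
  have fr: "\<And>p c. p \<in> carrier P \<Longrightarrow> c \<in> carrier C \<Longrightarrow> f (rsmult P p c) = rsmult Q (f p) c"
    and fl: "\<And>p a. p \<in> carrier P \<Longrightarrow> a \<in> carrier A \<Longrightarrow> f (lsmult P a p) = lsmult Q a (f p)"
    and gr: "\<And>p c. p \<in> carrier Q \<Longrightarrow> c \<in> carrier C \<Longrightarrow> g (rsmult Q p c) = rsmult P (g p) c"
    and gl: "\<And>p a. p \<in> carrier Q \<Longrightarrow> a \<in> carrier A \<Longrightarrow> g (lsmult Q a p) = lsmult P a (g p)"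
    using f g by (auto simp: bimod_hom_altdef)
  note fc = additive_maps_closed[OF fa] and gc = additive_maps_closed[OF ga]
  note f0 = additive_maps_zero[OF P.abelian_group_axioms Q.abelian_group_axioms fa]
    and g0 = additive_maps_zero[OF Q.abelian_group_axioms P.abelian_group_axioms ga]
    and fm = additive_maps_uminus[OF P.abelian_group_axioms Q.abelian_group_axioms fa]
    and gm = additive_maps_uminus[OF Q.abelian_group_axioms P.abelian_group_axioms ga]
  let ?U = "f ` carrier P" and ?V = "{q \<in> carrier Q. g q = \<zero>\<^bsub>P\<^esub>}"
  have U: "subbimodule A C ?U Q"
    unfolding subbimodule_def
  proof (intro conjI ballI additive_subgroupI)
    show "subgroup ?U (add_monoid Q)"
    proof (rule group.subgroupI[OF Q.a_group])
      show "?U \<subseteq> carrier (add_monoid Q)" using fc by auto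
      show "?U \<noteq> {}" using P.zero_closed by blast
      show "inv\<^bsub>add_monoid Q\<^esub> u \<in> ?U" if u: "u \<in> ?U" for u
      proof -
        obtain p where "p \<in> carrier P" "u = f p" using u by blast
        then have "inv\<^bsub>add_monoid Q\<^esub> u = f (\<ominus>\<^bsub>P\<^esub> p)" "\<ominus>\<^bsub>P\<^esub> p \<in> carrier P"
          by (simp_all add: fm) (simp add: a_inv_def)
        then show ?thesis by blast
      qed
      show "u \<otimes>\<^bsub>add_monoid Q\<^esub> u' \<in> ?U" if "u \<in> ?U" "u' \<in> ?U" for u u'
        using that by (auto simp: additive_maps_add[OF fa, symmetric])
    qed
    show "lsmult Q a u \<in> ?U" if "a \<in> carrier A" "u \<in> ?U" for a u
      using that by (auto simp: fl[symmetric] P.lsmult_closed)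
    show "rsmult Q u c \<in> ?U" if "c \<in> carrier C" "u \<in> ?U" for c u
      using that by (auto simp: fr[symmetric] P.rsmult_closed)
  qed
  have V: "subbimodule A C ?V Q"
    unfolding subbimodule_def
  proof (intro conjI ballI additive_subgroupI)
    show "subgroup ?V (add_monoid Q)"
    proof (rule group.subgroupI[OF Q.a_group])
      show "?V \<subseteq> carrier (add_monoid Q)" by auto
      show "?V \<noteq> {}" using g0 Q.zero_closed by blast
      show "inv\<^bsub>add_monoid Q\<^esub> u \<in> ?V" if "u \<in> ?V" for u
        using that gm[of u] Q.a_inv_closed[of u] by (simp add: a_inv_def[of Q, symmetric])
      show "u \<otimes>\<^bsub>add_monoid Q\<^esub> u' \<in> ?V" if "u \<in> ?V" "u' \<in> ?V" for u u'
        using that by (auto simp: additive_maps_add[OF ga])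
    qed
    show "lsmult Q a u \<in> ?V" if "a \<in> carrier A" "u \<in> ?V" for a u
      using that by (auto simp: gl Q.lsmult_closed P.lsmult_zero)
    show "rsmult Q u c \<in> ?V" if "c \<in> carrier C" "u \<in> ?V" for c u
      using that by (auto simp: gr Q.rsmult_closed P.rsmult_zero)
  qed
  have sum: "?U <+>\<^bsub>Q\<^esub> ?V = carrier Q"
  proof
    show "?U <+>\<^bsub>Q\<^esub> ?V \<subseteq> carrier Q"
      using fc by (auto simp: set_add_def set_mult_def)
    show "carrier Q \<subseteq> ?U <+>\<^bsub>Q\<^esub> ?V"
    proof
      fix q assume q: "q \<in> carrier Q"
      have fgq: "f (g q) \<in> carrier Q" using q by (intro fc gc)
      have "g (q \<ominus>\<^bsub>Q\<^esub> f (g q)) = \<zero>\<^bsub>P\<^esub>"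
        using q fgq gc by (simp add: Q.minus_eq additive_maps_add[OF ga] gm gf P.r_neg)
      moreover have "q = f (g q) \<oplus>\<^bsub>Q\<^esub> (q \<ominus>\<^bsub>Q\<^esub> f (g q))"
        using q fgq by (simp add: Q.minus_eq Q.a_lcomm[of "f (g q)"] Q.r_neg)
      moreover have "f (g q) \<in> ?U" "q \<ominus>\<^bsub>Q\<^esub> f (g q) \<in> carrier Q"
        using q gc fgq by auto
      ultimately have "f (g q) \<in> ?U" "q \<ominus>\<^bsub>Q\<^esub> f (g q) \<in> ?V"
        and "q = f (g q) \<oplus>\<^bsub>Q\<^esub> (q \<ominus>\<^bsub>Q\<^esub> f (g q))"
        by simp_all
      then show "q \<in> ?U <+>\<^bsub>Q\<^esub> ?V"
        unfolding set_add_def' by blast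
    qed
  qed
  have int: "?U \<inter> ?V = {\<zero>\<^bsub>Q\<^esub>}"
  proof
    show "{\<zero>\<^bsub>Q\<^esub>} \<subseteq> ?U \<inter> ?V"
      using f0 g0 P.zero_closed Q.zero_closed by (auto simp: image_iff intro!: bexI[of _ "\<zero>\<^bsub>P\<^esub>"])
  qed (auto simp: gf f0)
  have "f \<in> bimod_hom A C P (Q\<lparr>carrier := ?U\<rparr>)"
    using f by (simp add: bimod_hom_def)
  moreover have "inj_on f (carrier P)"
    by (rule inj_on_inverseI[of _ g]) (rule gf)
  ultimately have "f \<in> bimod_iso A C P (Q\<lparr>carrier := ?U\<rparr>)"
    by (simp add: bimod_iso_def bij_betw_def)
  with U V sum int show "iso_to_direct_summand A C P Q"
    unfolding iso_to_direct_summand_def by blast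
qed


lemma additive_bimodule_ring_bimod:
  assumes A: "ring A" and u: "u \<in> carrier B \<rightarrow> carrier A" and v: "v \<in> carrier C \<rightarrow> carrier A"
  shows "additive_bimodule B C (ring_bimod A u v)"
proof -
  interpret A: ring A by fact
  have "abelian_group (ring_bimod A u v)"
    by (rule abelian_groupI)
      (auto simp: ring_bimod_def A.a_ac A.l_neg intro!: bexI[of _ "\<ominus>\<^bsub>A\<^esub> x" for x])
  then show ?thesis
    using u v
    by (intro additive_bimodule.intro additive_bimodule_axioms.intro additive_mapsI)
      (auto simp: ring_bimod_def A.r_distr A.l_distr A.m_assoc funcset_mem[OF u] funcset_mem[OF v])
qed

lemma ring_bimod_simps [simp]:
  "carrier (ring_bimod A u v) = carrier A"
  "ring.zero (ring_bimod A u v) = \<zero>\<^bsub>A\<^esub>"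
  "ring.add (ring_bimod A u v) = ring.add A"
  "lsmult (ring_bimod A u v) a x = u a \<otimes>\<^bsub>A\<^esub> x"
  "rsmult (ring_bimod A u v) x c = x \<otimes>\<^bsub>A\<^esub> v c"
  by (auto simp: ring_bimod_def)

lemma bimod_power_simps:
  "carrier (bimod_power P k) = {..<k} \<rightarrow>\<^sub>E carrier P"
  "ring.zero (bimod_power P k) = (\<lambda>i\<in>{..<k}. \<zero>\<^bsub>P\<^esub>)"
  "ring.add (bimod_power P k) f g = (\<lambda>i\<in>{..<k}. f i \<oplus>\<^bsub>P\<^esub> g i)"
  "lsmult (bimod_power P k) a f = (\<lambda>i\<in>{..<k}. lsmult P a (f i))"
  "rsmult (bimod_power P k) f c = (\<lambda>i\<in>{..<k}. rsmult P (f i) c)"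
  by (auto simp: bimod_power_def)

lemma (in additive_bimodule) additive_bimodule_power: "additive_bimodule A C (bimod_power P k)"
proof -
  have "abelian_group (bimod_power P k)"
  proof (rule abelian_groupI)
    fix x y z
    assume "x \<in> carrier (bimod_power P k)" "y \<in> carrier (bimod_power P k)"
      "z \<in> carrier (bimod_power P k)"
    then show "x \<oplus>\<^bsub>bimod_power P k\<^esub> y \<oplus>\<^bsub>bimod_power P k\<^esub> z =
        x \<oplus>\<^bsub>bimod_power P k\<^esub> (y \<oplus>\<^bsub>bimod_power P k\<^esub> z)"
      by (auto simp: bimod_power_simps PiE_iff a_assoc intro!: restrict_ext)
  next
    fix x y
    assume "x \<in> carrier (bimod_power P k)" "y \<in> carrier (bimod_power P k)"
    then show "x \<oplus>\<^bsub>bimod_power P k\<^esub> y = y \<oplus>\<^bsub>bimod_power P k\<^esub> x"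
      by (auto simp: bimod_power_simps PiE_iff a_comm intro!: restrict_ext)
  next
    fix x
    assume x: "x \<in> carrier (bimod_power P k)"
    then show "\<zero>\<^bsub>bimod_power P k\<^esub> \<oplus>\<^bsub>bimod_power P k\<^esub> x = x"
      by (auto simp: bimod_power_simps PiE_iff extensional_def fun_eq_iff restrict_def)
    have "(\<lambda>i\<in>{..<k}. \<ominus> x i) \<oplus>\<^bsub>bimod_power P k\<^esub> x = \<zero>\<^bsub>bimod_power P k\<^esub>"
      using x by (auto simp: bimod_power_simps PiE_iff l_neg intro!: restrict_ext)
    moreover have "(\<lambda>i\<in>{..<k}. \<ominus> x i) \<in> carrier (bimod_power P k)"
      using x by (auto simp: bimod_power_simps PiE_iff)
    ultimately show "\<exists>y\<in>carrier (bimod_power P k). y \<oplus>\<^bsub>bimod_power P k\<^esub> x = \<zero>\<^bsub>bimod_power P k\<^esub>"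
      by blast
  qed (auto simp: bimod_power_simps PiE_iff)
  then show ?thesis
    by (intro additive_bimodule.intro additive_bimodule_axioms.intro additive_mapsI)
      (auto simp: bimod_power_simps PiE_iff lsmult_closed rsmult_closed lsmult_add rsmult_add
        smult_assoc intro!: restrict_ext)
qed

lemma (in additive_bimodule) finsum_bimod_hom:
  assumes Q: "additive_bimodule A C Q" and f: "\<And>i. i \<in> I \<Longrightarrow> f i \<in> bimod_hom A C Q P"
  shows "(\<lambda>q. \<Oplus>i\<in>I. f i q) \<in> bimod_hom A C Q P"
proof -
  interpret Q: additive_bimodule A C Q by fact
  have fa: "f i \<in> additive_maps Q P" if "i \<in> I" for i
    using f[OF that] by (simp add: bimod_hom_altdef)
  note fc = additive_maps_closed[OF fa]
  have "(\<Oplus>i\<in>I. f i (lsmult Q a q)) = lsmult P a (\<Oplus>i\<in>I. f i q)"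
    if "a \<in> carrier A" "q \<in> carrier Q" for a q
  proof -
    have "lsmult P a (\<Oplus>i\<in>I. f i q) = (\<Oplus>i\<in>I. lsmult P a (f i q))"
      using that by (intro additive_maps_finsum lsmult_additive) (auto intro: fc abelian_group_axioms)
    also have "\<dots> = (\<Oplus>i\<in>I. f i (lsmult Q a q))"
      using that f by (intro finsum_cong') (auto simp: bimod_hom_altdef intro!: fc Q.lsmult_closed)
    finally show ?thesis by simp
  qed
  moreover have "(\<Oplus>i\<in>I. f i (rsmult Q q c)) = rsmult P (\<Oplus>i\<in>I. f i q) c"
    if "c \<in> carrier C" "q \<in> carrier Q" for c q
  proof -
    have "rsmult P (\<Oplus>i\<in>I. f i q) c = (\<Oplus>i\<in>I. rsmult P (f i q) c)"
      using that by (intro additive_maps_finsum[OF _ _ rsmult_additive]) (auto intro: fc abelian_group_axioms)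
    also have "\<dots> = (\<Oplus>i\<in>I. f i (rsmult Q q c))"
      using that f by (intro finsum_cong') (auto simp: bimod_hom_altdef intro!: fc Q.rsmult_closed)
    finally show ?thesis by simp
  qed
  ultimately show ?thesis
    using finsum_additive_maps[OF Q.abelian_group_axioms fa] by (simp add: bimod_hom_altdef)
qed

text \<open>Homomorphisms to and from \<open>Q\<^sup>k\<close> are \<open>k\<close>-tuples of homomorphisms to and from \<open>Q\<close>, so a retraction
  \<open>P \<rightarrow> Q\<^sup>k \<rightarrow> P\<close> is a decomposition of the identity of \<open>P\<close> into \<open>k\<close> maps that factor through \<open>Q\<close>.\<close>

lemma iso_to_direct_summand_power_iff:
  assumes P: "additive_bimodule A C P" and Q: "additive_bimodule A C Q"
  shows "iso_to_direct_summand A C P (bimod_power Q k) \<longleftrightarrow>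
    (\<exists>f g. (\<forall>i<k. f i \<in> bimod_hom A C P Q \<and> g i \<in> bimod_hom A C Q P) \<and>
      (\<forall>p\<in>carrier P. (\<Oplus>\<^bsub>P\<^esub>i\<in>{..<k}. g i (f i p)) = p))"
proof -
  interpret P: additive_bimodule A C P by fact
  interpret Q: additive_bimodule A C Q by fact
  interpret Qk: additive_bimodule A C "bimod_power Q k" by (rule Q.additive_bimodule_power)
  show ?thesis
    unfolding iso_to_direct_summand_iff_retract[OF P Q.additive_bimodule_power]
  proof (intro iffI; (elim bexE exE conjE)?)
    fix f g
    assume f: "f \<in> bimod_hom A C P (bimod_power Q k)"
      and g: "g \<in> bimod_hom A C (bimod_power Q k) P"
      and gf: "\<forall>p\<in>carrier P. g (f p) = p"
    define single where "single i q = (\<lambda>j\<in>{..<k}. if j = i then q else \<zero>\<^bsub>Q\<^esub>)" for i :: nat and q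
    have single: "single i \<in> bimod_hom A C Q (bimod_power Q k)" for i
      by (auto simp: single_def bimod_hom_def bimod_power_simps Q.lsmult_zero Q.rsmult_zero
          intro!: restrict_ext)
    have g_additive: "g \<in> additive_maps (bimod_power Q k) P"
      using g by (simp only: bimod_hom_altdef mem_Collect_eq)
    have f_closed: "f p \<in> {..<k} \<rightarrow>\<^sub>E carrier Q" if "p \<in> carrier P" for p
      using f that by (auto simp: bimod_hom_def bimod_power_simps)
    have "(\<lambda>p. f p i) \<in> bimod_hom A C P Q" if "i < k" for i
      using f that by (auto simp: bimod_hom_altdef bimod_power_simps hom_def PiE_iff Pi_iff)
    moreover have "g \<circ> single i \<in> bimod_hom A C Q P" for i
      using single g by (rule bimod_hom_comp)
    moreover have "(\<Oplus>\<^bsub>P\<^esub>i\<in>{..<k}. (g \<circ> single i) (f p i)) = p" if p: "p \<in> carrier P" for p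
    proof -
      (* the partial sums fill up f p from the left, with zeros in the remaining entries *)
      have partial: "(\<Oplus>\<^bsub>bimod_power Q k\<^esub>i\<in>{..<l}. single i (f p i))
          = (\<lambda>j\<in>{..<k}. if j < l then f p j else \<zero>\<^bsub>Q\<^esub>)" if "l \<le> k" for l
        using that
      proof (induction l)
        case (Suc l)
        have "(\<Oplus>\<^bsub>bimod_power Q k\<^esub>i\<in>{..<Suc l}. single i (f p i))
            = single l (f p l) \<oplus>\<^bsub>bimod_power Q k\<^esub> (\<Oplus>\<^bsub>bimod_power Q k\<^esub>i\<in>{..<l}. single i (f p i))"
          unfolding lessThan_Suc using Suc.prems f_closed[OF p]
          by (intro Qk.finsum_insert) (auto simp: single_def bimod_power_simps PiE_iff)
        also have "(\<Oplus>\<^bsub>bimod_power Q k\<^esub>i\<in>{..<l}. single i (f p i))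
            = (\<lambda>j\<in>{..<k}. if j < l then f p j else \<zero>\<^bsub>Q\<^esub>)"
          using Suc by (intro Suc.IH) simp
        also have "single l (f p l) \<oplus>\<^bsub>bimod_power Q k\<^esub> \<dots>
            = (\<lambda>j\<in>{..<k}. if j < Suc l then f p j else \<zero>\<^bsub>Q\<^esub>)"
          using Suc.prems f_closed[OF p]
          by (auto simp: single_def bimod_power_simps PiE_iff less_Suc_eq intro!: restrict_ext)
        finally show ?case .
      qed (auto simp: bimod_power_simps)
      have "(\<Oplus>\<^bsub>bimod_power Q k\<^esub>i\<in>{..<k}. single i (f p i)) = f p"
        using partial[of k] f_closed[OF p]
        by (auto simp: PiE_iff extensional_def fun_eq_iff restrict_def)
      moreover have "g (\<Oplus>\<^bsub>bimod_power Q k\<^esub>i\<in>{..<k}. single i (f p i))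
          = (\<Oplus>\<^bsub>P\<^esub>i\<in>{..<k}. g (single i (f p i)))"
        using f_closed[OF p]
        by (intro additive_maps_finsum[OF Qk.abelian_group_axioms P.abelian_group_axioms g_additive])
          (auto simp: single_def bimod_power_simps PiE_iff)
      ultimately show ?thesis
        using gf p by simp
    qed
    ultimately show "\<exists>f g. (\<forall>i<k. f i \<in> bimod_hom A C P Q \<and> g i \<in> bimod_hom A C Q P) \<and>
        (\<forall>p\<in>carrier P. (\<Oplus>\<^bsub>P\<^esub>i\<in>{..<k}. g i (f i p)) = p)"
      by (intro exI[of _ "\<lambda>i p. f p i"] exI[of _ "\<lambda>i. g \<circ> single i"] conjI allI impI ballI)
  next
    fix f g
    assume fg: "\<forall>i<k. f i \<in> bimod_hom A C P Q \<and> g i \<in> bimod_hom A C Q P"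
      and sum: "\<forall>p\<in>carrier P. (\<Oplus>\<^bsub>P\<^esub>i\<in>{..<k}. g i (f i p)) = p"
    then have f: "f i \<in> bimod_hom A C P Q" and g: "g i \<in> bimod_hom A C Q P" if "i < k" for i
      using that by blast+
    have fc: "f i p \<in> carrier Q" if "i < k" "p \<in> carrier P" for i p
      using f[OF that(1)] that(2) by (auto simp: bimod_hom_def)
    have gc: "g i q \<in> carrier P" if "i < k" "q \<in> carrier Q" for i q
      using g[OF that(1)] that(2) by (auto simp: bimod_hom_def)
    have "(\<lambda>p. \<lambda>i\<in>{..<k}. f i p) \<in> bimod_hom A C P (bimod_power Q k)"
      unfolding bimod_hom_def bimod_power_simps
    proof (intro CollectI conjI ballI restrict_ext)
      show "(\<lambda>p. \<lambda>i\<in>{..<k}. f i p) \<in> carrier P \<rightarrow> {..<k} \<rightarrow>\<^sub>E carrier Q"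
        using fc by auto
    qed (use f in \<open>simp_all add: bimod_hom_def\<close>)
    moreover have "(\<lambda>q. \<Oplus>\<^bsub>P\<^esub>i\<in>{..<k}. g i (q i)) \<in> bimod_hom A C (bimod_power Q k) P"
    proof (rule P.finsum_bimod_hom[OF Q.additive_bimodule_power])
      fix i assume "i \<in> {..<k}"
      then show "(\<lambda>q. g i (q i)) \<in> bimod_hom A C (bimod_power Q k) P"
        using g[of i] by (simp add: bimod_hom_def bimod_power_simps PiE_iff Pi_iff)
    qed
    moreover have "(\<Oplus>\<^bsub>P\<^esub>i\<in>{..<k}. g i ((\<lambda>i\<in>{..<k}. f i p) i)) = p" if p: "p \<in> carrier P" for p
    proof -
      have "(\<Oplus>\<^bsub>P\<^esub>i\<in>{..<k}. g i ((\<lambda>i\<in>{..<k}. f i p) i)) = (\<Oplus>\<^bsub>P\<^esub>i\<in>{..<k}. g i (f i p))"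
        using p by (intro P.finsum_cong') (auto intro: fc gc)
      with sum p show ?thesis by simp
    qed
    ultimately show "\<exists>f\<in>bimod_hom A C P (bimod_power Q k). \<exists>g\<in>bimod_hom A C (bimod_power Q k) P.
        \<forall>p\<in>carrier P. g (f p) = p"
      by (intro bexI[where x = "\<lambda>p. \<lambda>i\<in>{..<k}. f i p"]
          bexI[where x = "\<lambda>q. \<Oplus>\<^bsub>P\<^esub>i\<in>{..<k}. g i (q i)"] ballI)
  qed
qed


section \<open>Tensor products\<close>

definition balanced_maps ::
  "'b ring \<Rightarrow> ('a, 'b, 'p) bimodule \<Rightarrow> ('b, 'c, 'q) bimodule \<Rightarrow> ('g, 'x) ring_scheme
     \<Rightarrow> ('p \<Rightarrow> 'q \<Rightarrow> 'g) set" where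
  "balanced_maps B P Q G = {\<psi>.
     (\<forall>p\<in>carrier P. \<psi> p \<in> additive_maps Q G) \<and>
     (\<forall>q\<in>carrier Q. (\<lambda>p. \<psi> p q) \<in> additive_maps P G) \<and>
     (\<forall>p\<in>carrier P. \<forall>b\<in>carrier B. \<forall>q\<in>carrier Q. \<psi> (rsmult P p b) q = \<psi> p (lsmult Q b q))}"

definition pure_tensor ::
  "'b ring \<Rightarrow> ('a, 'b, 'p) bimodule \<Rightarrow> ('b, 'c, 'q) bimodule \<Rightarrow> 'p \<Rightarrow> 'q \<Rightarrow> ('p \<times> 'q \<Rightarrow>\<^sub>0 int) set" where
  "pure_tensor B P Q p q =
     generate (free_Abelian_group (carrier P \<times> carrier Q)) (tensor_relations B P Q)
       #>\<^bsub>free_Abelian_group (carrier P \<times> carrier Q)\<^esub> frag_of (p, q)"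

locale tensor_product = P: additive_bimodule A B P + Q: additive_bimodule B C Q
  for A :: "'a ring" and B :: "'b ring" and C :: "'c ring"
    and P :: "('a, 'b, 'p) bimodule" and Q :: "('b, 'c, 'q) bimodule"
begin

abbreviation (input) "F \<equiv> free_Abelian_group (carrier P \<times> carrier Q)"
abbreviation (input) "I \<equiv> generate F (tensor_relations B P Q)"
abbreviation (input) "T \<equiv> tensor B P Q"
abbreviation (input) "pure \<equiv> pure_tensor B P Q"

sublocale F: comm_group F
  by (rule abelian_free_Abelian_group)

lemma relations_subset: "tensor_relations B P Q \<subseteq> carrier F"
proof -
  have "Poly_Mapping.keys (x - y - z) \<subseteq> S"
    if "Poly_Mapping.keys x \<subseteq> S" "Poly_Mapping.keys y \<subseteq> S" "Poly_Mapping.keys z \<subseteq> S"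
    for x y z :: "'p \<times> 'q \<Rightarrow>\<^sub>0 int" and S
    using that by (meson Un_least keys_diff order.trans)
  moreover have "Poly_Mapping.keys (x - y) \<subseteq> S"
    if "Poly_Mapping.keys x \<subseteq> S" "Poly_Mapping.keys y \<subseteq> S"
    for x y :: "'p \<times> 'q \<Rightarrow>\<^sub>0 int" and S
    using that by (meson Un_least keys_diff order.trans)
  ultimately show ?thesis
    unfolding tensor_relations_def
    by (auto simp del: keys_diff simp: P.rsmult_closed Q.lsmult_closed)
qed

lemma subgroup_I: "subgroup I F"
  using relations_subset by (rule F.generate_is_subgroup)

sublocale I: normal I F
  using subgroup_I by (rule F.subgroup_imp_normal)

lemma tensor_simps:
  "carrier T = carrier (F Mod I)" "ring.add T = monoid.mult (F Mod I)" "ring.zero T = \<one>\<^bsub>F Mod I\<^esub>"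
  "lsmult T a S = (\<Union>x\<in>S. I #>\<^bsub>F\<^esub> frag_extend (\<lambda>(p, q). frag_of (lsmult P a p, q)) x)"
  "rsmult T S c = (\<Union>x\<in>S. I #>\<^bsub>F\<^esub> frag_extend (\<lambda>(p, q). frag_of (p, rsmult Q q c)) x)"
  by (simp_all add: tensor_def Let_def)

lemma carrier_tensor: "carrier T = (\<lambda>x. I #>\<^bsub>F\<^esub> x) ` carrier F"
  by (auto simp: tensor_simps FactGroup_def RCOSETS_def)

lemma coset_add:
  assumes "x \<in> carrier F" "y \<in> carrier F"
  shows "(I #>\<^bsub>F\<^esub> x) \<oplus>\<^bsub>T\<^esub> (I #>\<^bsub>F\<^esub> y) = I #>\<^bsub>F\<^esub> (x + y)"
  using I.rcos_sum[OF assms] by (simp add: tensor_simps FactGroup_def)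

lemma abelian_group_tensor: "abelian_group T"
proof -
  have *: "comm_group (F Mod I)"
    using F.abelian_FactGroup[OF subgroup_I] .
  then interpret T: comm_group "F Mod I" .
  show ?thesis
  proof (rule abelian_groupI)
    fix x assume "x \<in> carrier T"
    then show "\<exists>y\<in>carrier T. y \<oplus>\<^bsub>T\<^esub> x = \<zero>\<^bsub>T\<^esub>"
      using T.l_inv[of x] T.inv_closed[of x] unfolding tensor_simps by blast
  qed (simp_all only: tensor_simps T.m_closed T.one_closed T.l_one T.m_assoc, rule T.m_comm)
qed

lemma pure_closed: "p \<in> carrier P \<Longrightarrow> q \<in> carrier Q \<Longrightarrow> pure p q \<in> carrier T"
  by (auto simp: carrier_tensor pure_tensor_def)

lemma coset_eqI:
  assumes "x \<in> carrier F" "y \<in> carrier F" "x - y \<in> I"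
  shows "I #>\<^bsub>F\<^esub> x = I #>\<^bsub>F\<^esub> y"
proof -
  have "x \<in> I #>\<^bsub>F\<^esub> y"
    using assms by (auto simp: r_coset_def intro!: bexI[of _ "x - y"])
  then show ?thesis
    using F.repr_independence[of x I y] subgroup_I assms by auto
qed

lemma pure_balanced: "pure \<in> balanced_maps B P Q T"
proof -
  have sum: "pure p q \<oplus>\<^bsub>T\<^esub> pure p' q' = I #>\<^bsub>F\<^esub> (frag_of (p, q) + frag_of (p', q'))"
    and sum_closed: "frag_of (p, q) + frag_of (p', q') \<in> carrier F"
    if "p \<in> carrier P" "q \<in> carrier Q" "p' \<in> carrier P" "q' \<in> carrier Q" for p q p' q'
    using that coset_add[of "frag_of (p, q)" "frag_of (p', q')"]
      F.m_closed[of "frag_of (p, q)" "frag_of (p', q')"]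
    by (simp_all add: pure_tensor_def)
  have "pure p (q \<oplus>\<^bsub>Q\<^esub> q') = pure p q \<oplus>\<^bsub>T\<^esub> pure p q'"
    if *: "p \<in> carrier P" "q \<in> carrier Q" "q' \<in> carrier Q" for p q q'
  proof -
    have "frag_of (p, q \<oplus>\<^bsub>Q\<^esub> q') - (frag_of (p, q) + frag_of (p, q')) \<in> I"
      unfolding diff_diff_eq[symmetric]
      using * by (intro generate.incl) (auto simp: tensor_relations_def)
    then show ?thesis
      unfolding sum[OF *(1,2,1,3)] unfolding pure_tensor_def
      using * sum_closed[OF *(1,2,1,3)] by (intro coset_eqI) simp_all
  qed
  moreover have "pure (p \<oplus>\<^bsub>P\<^esub> p') q = pure p q \<oplus>\<^bsub>T\<^esub> pure p' q"
    if *: "p \<in> carrier P" "p' \<in> carrier P" "q \<in> carrier Q" for p p' q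
  proof -
    have "frag_of (p \<oplus>\<^bsub>P\<^esub> p', q) - (frag_of (p, q) + frag_of (p', q)) \<in> I"
      unfolding diff_diff_eq[symmetric]
      using * by (intro generate.incl) (auto simp: tensor_relations_def)
    then show ?thesis
      unfolding sum[OF *(1,3,2,3)] unfolding pure_tensor_def
      using * sum_closed[OF *(1,3,2,3)] by (intro coset_eqI) simp_all
  qed
  moreover have "pure (rsmult P p b) q = pure p (lsmult Q b q)"
    if *: "p \<in> carrier P" "b \<in> carrier B" "q \<in> carrier Q" for p b q
  proof -
    have "frag_of (rsmult P p b, q) - frag_of (p, lsmult Q b q) \<in> I"
      using * by (intro generate.incl) (auto simp: tensor_relations_def)
    then show ?thesis
      unfolding pure_tensor_def using *
      by (intro coset_eqI) (simp_all add: P.rsmult_closed Q.lsmult_closed)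
  qed
  ultimately show ?thesis
    unfolding balanced_maps_def
    by (intro CollectI conjI ballI additive_mapsI pure_closed)
qed

text \<open>The universal property. The homomorphism \<open>h\<close> that extends \<open>\<psi>\<close> to the free abelian group kills the
  defining relations, hence the subgroup that they generate, and so factors through the quotient.\<close>

lemma tensor_lift:
  assumes G: "abelian_group G" and \<psi>: "\<psi> \<in> balanced_maps B P Q G"
  obtains \<Psi> where "\<Psi> \<in> additive_maps T G"
    and "\<And>p q. p \<in> carrier P \<Longrightarrow> q \<in> carrier Q \<Longrightarrow> \<Psi> (pure p q) = \<psi> p q"
proof -
  interpret G: abelian_group G by fact
  have \<psi>1: "\<psi> p \<in> additive_maps Q G" if "p \<in> carrier P" for p
    using \<psi> that by (simp add: balanced_maps_def)
  have \<psi>2: "(\<lambda>p. \<psi> p q) \<in> additive_maps P G" if "q \<in> carrier Q" for q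
    using \<psi> that by (simp add: balanced_maps_def)
  have \<psi>3: "\<psi> (rsmult P p b) q = \<psi> p (lsmult Q b q)"
    if "p \<in> carrier P" "b \<in> carrier B" "q \<in> carrier Q" for p b q
    using \<psi> that by (simp add: balanced_maps_def)
  have \<psi>c: "\<psi> p q \<in> carrier G" if "p \<in> carrier P" "q \<in> carrier Q" for p q
    using additive_maps_closed[OF \<psi>1] that .
  obtain h where h: "h \<in> hom F (add_monoid G)"
    and h_of: "\<And>x. x \<in> carrier P \<times> carrier Q \<Longrightarrow> h (frag_of x) = case_prod \<psi> x"
    using comm_group.free_Abelian_group_universal
      [OF G.a_comm_group, of "case_prod \<psi>" "carrier P \<times> carrier Q"] \<psi>c
    by (auto simp: image_subset_iff)
  interpret h: group_hom F "add_monoid G" h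
    using h G.a_group by (simp add: group_hom_def group_hom_axioms_def)
  have h_diff: "h (x - y) = h x \<ominus>\<^bsub>G\<^esub> h y" if "x \<in> carrier F" "y \<in> carrier F" for x y
  proof -
    have "h (x - y) = h (x \<otimes>\<^bsub>F\<^esub> inv\<^bsub>F\<^esub> y)"
      using that by simp
    also have "\<dots> = h x \<ominus>\<^bsub>G\<^esub> h y"
      using that h.hom_mult[of x "inv\<^bsub>F\<^esub> y"] h.hom_inv[of y]
      by (simp add: G.minus_eq a_inv_def keys_minus)
    finally show ?thesis .
  qed
  have h_closed: "h x \<in> carrier G" if "x \<in> carrier F" for x
    using h.hom_closed[OF that] by simp
  have rel: "h x = \<zero>\<^bsub>G\<^esub>" if "x \<in> tensor_relations B P Q" for x
  proof -
    have diff_closed: "x - y \<in> carrier F" if "x \<in> carrier F" "y \<in> carrier F" for x y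
      using F.m_closed[OF that(1) F.inv_closed[OF that(2)]] that(2) by simp
    have zero: "s \<ominus>\<^bsub>G\<^esub> t \<ominus>\<^bsub>G\<^esub> u = \<zero>\<^bsub>G\<^esub>" if "s = t \<oplus>\<^bsub>G\<^esub> u" "t \<in> carrier G" "u \<in> carrier G" for s t u
    proof -
      have "s \<ominus>\<^bsub>G\<^esub> t \<ominus>\<^bsub>G\<^esub> u = s \<oplus>\<^bsub>G\<^esub> \<ominus>\<^bsub>G\<^esub> (t \<oplus>\<^bsub>G\<^esub> u)"
        using that by (simp add: G.minus_eq G.a_assoc G.minus_add)
      with that show ?thesis by (simp add: G.r_neg)
    qed
    from that consider
      (left) p p' q where "p \<in> carrier P" "p' \<in> carrier P" "q \<in> carrier Q"
        "x = frag_of (p \<oplus>\<^bsub>P\<^esub> p', q) - frag_of (p, q) - frag_of (p', q)"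
    | (right) p q q' where "p \<in> carrier P" "q \<in> carrier Q" "q' \<in> carrier Q"
        "x = frag_of (p, q \<oplus>\<^bsub>Q\<^esub> q') - frag_of (p, q) - frag_of (p, q')"
    | (mid) p b q where "p \<in> carrier P" "b \<in> carrier B" "q \<in> carrier Q"
        "x = frag_of (rsmult P p b, q) - frag_of (p, lsmult Q b q)"
      unfolding tensor_relations_def by (elim UnE CollectE exE conjE) metis+
    then show ?thesis
    proof cases
      case left
      then show ?thesis
        by (simp add: h_diff diff_closed h_of \<psi>c zero additive_maps_add[OF \<psi>2]
            del: carrier_free_Abelian_group_iff)
    next
      case right
      then show ?thesis
        by (simp add: h_diff diff_closed h_of \<psi>c zero additive_maps_add[OF \<psi>1]
            del: carrier_free_Abelian_group_iff)
    next
      case mid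
      then show ?thesis
        by (simp add: h_diff diff_closed h_of \<psi>c \<psi>3 P.rsmult_closed Q.lsmult_closed
            G.minus_eq G.r_neg del: carrier_free_Abelian_group_iff)
    qed
  qed
  have "I \<subseteq> kernel F (add_monoid G) h"
  proof (rule F.generate_subgroup_incl)
    show "tensor_relations B P Q \<subseteq> kernel F (add_monoid G) h"
      using rel relations_subset by (auto simp: kernel_def simp del: carrier_free_Abelian_group_iff)
  qed (rule h.subgroup_kernel)
  then have hI: "h x = \<zero>\<^bsub>G\<^esub>" if "x \<in> I" for x
    using that by (auto simp: kernel_def)
  have "h x = h y" if "x \<in> carrier F" "y \<in> carrier F" "I #>\<^bsub>F\<^esub> x = I #>\<^bsub>F\<^esub> y" for x y
  proof -
    have "x \<in> I #>\<^bsub>F\<^esub> y"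
      using that(3) F.rcos_self[OF that(1) subgroup_I] by simp
    then obtain i where i: "i \<in> I" "x = i \<otimes>\<^bsub>F\<^esub> y"
      by (auto simp: r_coset_def)
    moreover have "i \<in> carrier F"
      using i(1) subgroup.subset[OF subgroup_I] by blast
    ultimately show ?thesis
      using h.hom_mult[of i y] that(2) hI h_closed[of y] by simp
  qed
  then obtain \<Psi> where \<Psi>: "\<Psi> \<in> hom (F Mod I) (add_monoid G)"
    and \<Psi>_of: "\<And>x. x \<in> carrier F \<Longrightarrow> \<Psi> (I #>\<^bsub>F\<^esub> x) = h x"
    using FactGroup_universal[OF h I.normal_axioms] by metis
  show thesis
  proof
    show "\<Psi> \<in> additive_maps T G"
      using \<Psi> by (simp add: hom_def tensor_simps)
    show "\<Psi> (pure p q) = \<psi> p q" if "p \<in> carrier P" "q \<in> carrier Q" for p q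
      using that by (simp add: pure_tensor_def \<Psi>_of h_of)
  qed
qed

text \<open>The pure tensors generate, being the classes of the free generators.\<close>

lemma tensor_maps_eqI:
  assumes G: "abelian_group G" and \<Phi>: "\<Phi> \<in> additive_maps T G" and \<Psi>: "\<Psi> \<in> additive_maps T G"
    and pure: "\<And>p q. p \<in> carrier P \<Longrightarrow> q \<in> carrier Q \<Longrightarrow> \<Phi> (pure p q) = \<Psi> (pure p q)"
    and S: "S \<in> carrier T"
  shows "\<Phi> S = \<Psi> S"
proof -
  interpret T: abelian_group T by (rule abelian_group_tensor)
  obtain x where x: "Poly_Mapping.keys x \<subseteq> carrier P \<times> carrier Q" and S_eq: "S = I #>\<^bsub>F\<^esub> x"
    using S by (auto simp: carrier_tensor)
  have "\<Phi> (I #>\<^bsub>F\<^esub> x) = \<Psi> (I #>\<^bsub>F\<^esub> x)"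
    using x
  proof (induction x rule: free_Abelian_group_induct[consumes 1, case_names zero diff gen])
    case zero
    have "I #>\<^bsub>F\<^esub> 0 = \<zero>\<^bsub>T\<^esub>"
      using F.coset_mult_one[of I] subgroup.subset[OF subgroup_I]
      by (simp add: tensor_simps FactGroup_def)
    then show ?case
      by (simp add: additive_maps_zero[OF abelian_group_tensor G] \<Phi> \<Psi>)
  next
    case (diff x y)
    then have xy: "x \<in> carrier F" "y \<in> carrier F" "x - y \<in> carrier F"
      using F.m_closed[OF _ F.inv_closed, of x y] by auto
    note c = imageI[OF xy(1), of "\<lambda>x. I #>\<^bsub>F\<^esub> x", folded carrier_tensor]
      imageI[OF xy(2), of "\<lambda>x. I #>\<^bsub>F\<^esub> x", folded carrier_tensor]
      imageI[OF xy(3), of "\<lambda>x. I #>\<^bsub>F\<^esub> x", folded carrier_tensor]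
    have "I #>\<^bsub>F\<^esub> x = (I #>\<^bsub>F\<^esub> (x - y)) \<oplus>\<^bsub>T\<^esub> (I #>\<^bsub>F\<^esub> y)"
      using xy by (subst coset_add) auto
    then have "I #>\<^bsub>F\<^esub> (x - y) = (I #>\<^bsub>F\<^esub> x) \<oplus>\<^bsub>T\<^esub> \<ominus>\<^bsub>T\<^esub> (I #>\<^bsub>F\<^esub> y)"
      using c by (simp add: T.a_assoc T.r_neg)
    then show ?case
      using c diff by (simp add: additive_maps_add[OF \<Phi>] additive_maps_add[OF \<Psi>]
          additive_maps_uminus[OF abelian_group_tensor G \<Phi>]
          additive_maps_uminus[OF abelian_group_tensor G \<Psi>])
  next
    case (gen a)
    then show ?case
      using pure by (cases a) (auto simp: pure_tensor_def)
  qed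
  with S_eq show ?thesis by simp
qed

text \<open>As \<open>\<theta>\<close> preserves the subgroup generated by the relations, the class of \<open>\<theta> x\<close> only depends on the
  class of \<open>x\<close>. So the unions that define the outer actions are single classes.\<close>

lemma induced_map:
  fixes t :: "'p \<times> 'q \<Rightarrow> 'p \<times> 'q"
  defines "\<theta> \<equiv> frag_extend (\<lambda>x. frag_of (t x))"
  assumes t: "t \<in> carrier P \<times> carrier Q \<rightarrow> carrier P \<times> carrier Q"
    and rel: "\<And>x. x \<in> tensor_relations B P Q \<Longrightarrow> \<theta> x \<in> tensor_relations B P Q"
  shows "(\<lambda>S. \<Union>x\<in>S. I #>\<^bsub>F\<^esub> \<theta> x) \<in> additive_maps T T"
    and "x \<in> carrier F \<Longrightarrow> (\<Union>x'\<in>I #>\<^bsub>F\<^esub> x. I #>\<^bsub>F\<^esub> \<theta> x') = I #>\<^bsub>F\<^esub> \<theta> x"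
proof -
  have \<theta>_add: "\<theta> (x + y) = \<theta> x + \<theta> y" for x y
    by (simp add: \<theta>_def frag_extend_add)
  have \<theta>_F: "\<theta> x \<in> carrier F" if "x \<in> carrier F" for x
  proof -
    have "Poly_Mapping.keys x \<subseteq> carrier P \<times> carrier Q"
      using that by simp
    then show ?thesis
    proof (induction x rule: free_Abelian_group_induct[consumes 1, case_names zero diff gen])
      case (diff x y)
      then show ?case
        using F.m_closed[OF _ F.inv_closed, of "\<theta> x" "\<theta> y"] by (simp add: \<theta>_def frag_extend_diff)
    qed (use t in \<open>auto simp: \<theta>_def\<close>)
  qed
  have "\<theta> \<in> hom F F"
    using \<theta>_F by (auto simp: hom_def \<theta>_add)
  then interpret \<theta>: group_hom F F \<theta>
    by unfold_locales
  have \<theta>_I: "\<theta> x \<in> I" if "x \<in> I" for x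
    using that
  proof induction
    case one
    show ?case using \<theta>.hom_one generate.one[of F] by simp
  next
    case (incl x)
    then show ?case by (intro generate.incl rel)
  next
    case (inv x)
    then have "x \<in> carrier F" using relations_subset by blast
    then have "\<theta> (inv\<^bsub>F\<^esub> x) = inv\<^bsub>F\<^esub> \<theta> x" by (rule \<theta>.hom_inv)
    with inv rel show ?case by (metis generate.inv)
  next
    case (eng x y)
    then show ?case
      using generate.eng[of "\<theta> x" F _ "\<theta> y"] by (simp add: \<theta>_add)
  qed
  show coset: "(\<Union>x'\<in>I #>\<^bsub>F\<^esub> x. I #>\<^bsub>F\<^esub> \<theta> x') = I #>\<^bsub>F\<^esub> \<theta> x" if x: "x \<in> carrier F" for x
  proof -
    have "I #>\<^bsub>F\<^esub> \<theta> x' = I #>\<^bsub>F\<^esub> \<theta> x" if x': "x' \<in> I #>\<^bsub>F\<^esub> x" for x'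
    proof -
      obtain i where i: "i \<in> I" "x' = i + x"
        using x' by (auto simp: r_coset_def)
      have "i \<in> carrier F" using i subgroup.subset[OF subgroup_I] by blast
      then have "\<theta> x' \<in> carrier F"
        using x i F.m_closed[of i x] by (intro \<theta>_F) (simp only: mult_free_Abelian_group)
      then show ?thesis
        using i \<theta>_I x \<theta>_F by (intro coset_eqI) (auto simp: \<theta>_add simp del: carrier_free_Abelian_group_iff)
    qed
    moreover have "x \<in> I #>\<^bsub>F\<^esub> x"
      using F.rcos_self[OF x subgroup_I] .
    ultimately show ?thesis by blast
  qed
  show "(\<lambda>S. \<Union>x\<in>S. I #>\<^bsub>F\<^esub> \<theta> x) \<in> additive_maps T T"
  proof (rule additive_mapsI)
    fix S assume "S \<in> carrier T"
    then obtain x where "x \<in> carrier F" "S = I #>\<^bsub>F\<^esub> x" by (auto simp: carrier_tensor)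
    then show "(\<Union>x\<in>S. I #>\<^bsub>F\<^esub> \<theta> x) \<in> carrier T"
      unfolding carrier_tensor by (simp only: coset) (intro imageI \<theta>_F)
  next
    fix S S' assume "S \<in> carrier T" "S' \<in> carrier T"
    then obtain x x' where x: "x \<in> carrier F" "x' \<in> carrier F"
      and S: "S = I #>\<^bsub>F\<^esub> x" "S' = I #>\<^bsub>F\<^esub> x'"
      unfolding carrier_tensor by blast
    have "x + x' \<in> carrier F" using F.m_closed[OF x] by simp
    then show "(\<Union>x\<in>S \<oplus>\<^bsub>T\<^esub> S'. I #>\<^bsub>F\<^esub> \<theta> x) = (\<Union>x\<in>S. I #>\<^bsub>F\<^esub> \<theta> x) \<oplus>\<^bsub>T\<^esub> (\<Union>x\<in>S'. I #>\<^bsub>F\<^esub> \<theta> x)"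
      unfolding S by (simp only: coset_add[OF x] coset x coset_add[OF \<theta>_F \<theta>_F] \<theta>_add)
  qed
qed

lemma lsmult_tensor:
  assumes a: "a \<in> carrier A"
  shows "lsmult T a \<in> additive_maps T T"
    and "p \<in> carrier P \<Longrightarrow> q \<in> carrier Q \<Longrightarrow> lsmult T a (pure p q) = pure (lsmult P a p) q"
proof -
  let ?t = "\<lambda>(p, q). (lsmult P a p, q)"
  have t: "?t \<in> carrier P \<times> carrier Q \<rightarrow> carrier P \<times> carrier Q"
    using a by (auto simp: P.lsmult_closed)
  have *: "(\<lambda>(p, q). frag_of (lsmult P a p, q)) = (\<lambda>x. frag_of (?t x))"
    by auto
  have rel: "frag_extend (\<lambda>x. frag_of (?t x)) x \<in> tensor_relations B P Q"
    if "x \<in> tensor_relations B P Q" for x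
    using that unfolding tensor_relations_def
    apply (elim UnE)
    subgoal by (rule UnI1, rule UnI1) (use a in \<open>fastforce simp: frag_extend_diff P.lsmult_add P.lsmult_closed\<close>)
    subgoal by (rule UnI1, rule UnI2) (use a in \<open>fastforce simp: frag_extend_diff P.lsmult_closed\<close>)
    subgoal by (rule UnI2) (use a in \<open>fastforce simp: frag_extend_diff P.smult_assoc[symmetric] P.lsmult_closed\<close>)
    done
  note induced = induced_map[OF t rel]
  show "lsmult T a \<in> additive_maps T T"
    using induced(1) by (simp add: tensor_simps(4)[abs_def] *)
  show "lsmult T a (pure p q) = pure (lsmult P a p) q" if "p \<in> carrier P" "q \<in> carrier Q"
    using induced(2)[of "frag_of (p, q)"] that by (simp add: tensor_simps * pure_tensor_def)
qed

lemma rsmult_tensor: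
  assumes c: "c \<in> carrier C"
  shows "(\<lambda>S. rsmult T S c) \<in> additive_maps T T"
    and "p \<in> carrier P \<Longrightarrow> q \<in> carrier Q \<Longrightarrow> rsmult T (pure p q) c = pure p (rsmult Q q c)"
proof -
  let ?t = "\<lambda>(p, q). (p, rsmult Q q c)"
  have t: "?t \<in> carrier P \<times> carrier Q \<rightarrow> carrier P \<times> carrier Q"
    using c by (auto simp: Q.rsmult_closed)
  have *: "(\<lambda>(p, q). frag_of (p, rsmult Q q c)) = (\<lambda>x. frag_of (?t x))"
    by auto
  have rel: "frag_extend (\<lambda>x. frag_of (?t x)) x \<in> tensor_relations B P Q"
    if "x \<in> tensor_relations B P Q" for x
    using that unfolding tensor_relations_def
    apply (elim UnE)
    subgoal by (rule UnI1, rule UnI1) (use c in \<open>fastforce simp: frag_extend_diff Q.rsmult_closed\<close>)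
    subgoal by (rule UnI1, rule UnI2) (use c in \<open>fastforce simp: frag_extend_diff Q.rsmult_add Q.rsmult_closed\<close>)
    subgoal by (rule UnI2) (use c in \<open>fastforce simp: frag_extend_diff Q.smult_assoc Q.rsmult_closed\<close>)
    done
  note induced = induced_map[OF t rel]
  show "(\<lambda>S. rsmult T S c) \<in> additive_maps T T"
    using induced(1) by (simp add: tensor_simps(5)[abs_def] *)
  show "rsmult T (pure p q) c = pure p (rsmult Q q c)" if "p \<in> carrier P" "q \<in> carrier Q"
    using induced(2)[of "frag_of (p, q)"] that by (simp add: tensor_simps * pure_tensor_def)
qed

lemma additive_bimodule_tensor: "additive_bimodule A C T"
proof -
  have "rsmult T (lsmult T a S) c = lsmult T a (rsmult T S c)"
    if a: "a \<in> carrier A" and c: "c \<in> carrier C" and S: "S \<in> carrier T" for a c S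
  proof (rule tensor_maps_eqI[OF abelian_group_tensor _ _ _ S])
    show "(\<lambda>S. rsmult T (lsmult T a S) c) \<in> additive_maps T T"
      using lsmult_tensor(1)[OF a] rsmult_tensor(1)[OF c] by (auto simp: hom_def Pi_iff)
    show "(\<lambda>S. lsmult T a (rsmult T S c)) \<in> additive_maps T T"
      using lsmult_tensor(1)[OF a] rsmult_tensor(1)[OF c] by (auto simp: hom_def Pi_iff)
  qed (simp_all add: a c lsmult_tensor rsmult_tensor P.lsmult_closed Q.rsmult_closed)
  then show ?thesis
    using abelian_group_tensor lsmult_tensor(1) rsmult_tensor(1)
    by (simp add: additive_bimodule_def additive_bimodule_axioms_def)
qed

text \<open>Linearity for the outer actions needs to be checked on pure tensors only.\<close>

lemma tensor_lift_bimod_hom: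
  assumes M: "additive_bimodule A C M" and \<psi>: "\<psi> \<in> balanced_maps B P Q M"
    and l: "\<And>a p q. a \<in> carrier A \<Longrightarrow> p \<in> carrier P \<Longrightarrow> q \<in> carrier Q \<Longrightarrow>
      \<psi> (lsmult P a p) q = lsmult M a (\<psi> p q)"
    and r: "\<And>c p q. c \<in> carrier C \<Longrightarrow> p \<in> carrier P \<Longrightarrow> q \<in> carrier Q \<Longrightarrow>
      \<psi> p (rsmult Q q c) = rsmult M (\<psi> p q) c"
  obtains \<Psi> where "\<Psi> \<in> bimod_hom A C T M"
    and "\<And>p q. p \<in> carrier P \<Longrightarrow> q \<in> carrier Q \<Longrightarrow> \<Psi> (pure p q) = \<psi> p q"
proof -
  interpret M: additive_bimodule A C M by fact
  obtain \<Psi> where \<Psi>: "\<Psi> \<in> additive_maps T M"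
    and \<Psi>_pure: "\<And>p q. p \<in> carrier P \<Longrightarrow> q \<in> carrier Q \<Longrightarrow> \<Psi> (pure p q) = \<psi> p q"
    using tensor_lift[OF M.abelian_group_axioms \<psi>] by blast
  have "\<Psi> (lsmult T a S) = lsmult M a (\<Psi> S)" if a: "a \<in> carrier A" and S: "S \<in> carrier T" for a S
  proof (rule tensor_maps_eqI[OF M.abelian_group_axioms _ _ _ S])
    show "(\<lambda>S. \<Psi> (lsmult T a S)) \<in> additive_maps T M"
      using lsmult_tensor(1)[OF a] \<Psi> by (auto simp: hom_def Pi_iff)
    show "(\<lambda>S. lsmult M a (\<Psi> S)) \<in> additive_maps T M"
      using M.lsmult_additive[OF a] \<Psi> by (auto simp: hom_def Pi_iff)
  qed (simp_all add: a lsmult_tensor(2) \<Psi>_pure P.lsmult_closed l)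
  moreover have "\<Psi> (rsmult T S c) = rsmult M (\<Psi> S) c" if c: "c \<in> carrier C" and S: "S \<in> carrier T" for c S
  proof (rule tensor_maps_eqI[OF M.abelian_group_axioms _ _ _ S])
    show "(\<lambda>S. \<Psi> (rsmult T S c)) \<in> additive_maps T M"
      using rsmult_tensor(1)[OF c] \<Psi> by (auto simp: hom_def Pi_iff)
    show "(\<lambda>S. rsmult M (\<Psi> S) c) \<in> additive_maps T M"
      using M.rsmult_additive[OF c] \<Psi> by (auto simp: hom_def Pi_iff)
  qed (simp_all add: c rsmult_tensor(2) \<Psi>_pure Q.rsmult_closed r)
  ultimately show thesis
    using \<Psi> \<Psi>_pure by (intro that[of \<Psi>]) (auto simp: bimod_hom_altdef)
qed

end


section \<open>Frobenius systems inside a ring\<close>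

definition bilinear_maps :: "'a ring \<Rightarrow> 'a set \<Rightarrow> 'a set \<Rightarrow> ('a \<Rightarrow> 'a) set" where
  "bilinear_maps A U Y = {\<phi> \<in> additive_maps A A.
     (\<forall>s\<in>U. \<forall>a\<in>carrier A. \<phi> (s \<otimes>\<^bsub>A\<^esub> a) = s \<otimes>\<^bsub>A\<^esub> \<phi> a) \<and>
     (\<forall>a\<in>carrier A. \<forall>s\<in>Y. \<phi> (a \<otimes>\<^bsub>A\<^esub> s) = \<phi> a \<otimes>\<^bsub>A\<^esub> s)}"

lemma bilinear_maps_additive: "\<phi> \<in> bilinear_maps A U Y \<Longrightarrow> \<phi> \<in> additive_maps A A"
  by (simp add: bilinear_maps_def)

lemma bilinear_maps_closed: "\<phi> \<in> bilinear_maps A U Y \<Longrightarrow> a \<in> carrier A \<Longrightarrow> \<phi> a \<in> carrier A"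
  by (auto simp: bilinear_maps_def hom_def)

lemma bilinear_maps_add:
  "\<phi> \<in> bilinear_maps A U Y \<Longrightarrow> a \<in> carrier A \<Longrightarrow> b \<in> carrier A \<Longrightarrow> \<phi> (a \<oplus>\<^bsub>A\<^esub> b) = \<phi> a \<oplus>\<^bsub>A\<^esub> \<phi> b"
  by (auto simp: bilinear_maps_def hom_def)

lemma bilinear_maps_left:
  "\<phi> \<in> bilinear_maps A U Y \<Longrightarrow> s \<in> U \<Longrightarrow> a \<in> carrier A \<Longrightarrow> \<phi> (s \<otimes>\<^bsub>A\<^esub> a) = s \<otimes>\<^bsub>A\<^esub> \<phi> a"
  by (simp add: bilinear_maps_def)

lemma bilinear_maps_right:
  "\<phi> \<in> bilinear_maps A U Y \<Longrightarrow> s \<in> Y \<Longrightarrow> a \<in> carrier A \<Longrightarrow> \<phi> (a \<otimes>\<^bsub>A\<^esub> s) = \<phi> a \<otimes>\<^bsub>A\<^esub> s"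
  by (simp add: bilinear_maps_def)

lemma bilinear_mapsI:
  assumes "\<And>a. a \<in> carrier A \<Longrightarrow> \<phi> a \<in> carrier A"
    and "\<And>a b. a \<in> carrier A \<Longrightarrow> b \<in> carrier A \<Longrightarrow> \<phi> (a \<oplus>\<^bsub>A\<^esub> b) = \<phi> a \<oplus>\<^bsub>A\<^esub> \<phi> b"
    and "\<And>s a. s \<in> U \<Longrightarrow> a \<in> carrier A \<Longrightarrow> \<phi> (s \<otimes>\<^bsub>A\<^esub> a) = s \<otimes>\<^bsub>A\<^esub> \<phi> a"
    and "\<And>a s. a \<in> carrier A \<Longrightarrow> s \<in> Y \<Longrightarrow> \<phi> (a \<otimes>\<^bsub>A\<^esub> s) = \<phi> a \<otimes>\<^bsub>A\<^esub> s"
  shows "\<phi> \<in> bilinear_maps A U Y"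
  using assms by (simp add: bilinear_maps_def hom_def Pi_iff)

lemma (in ring) additive_maps_mult:
  "a \<in> carrier R \<Longrightarrow> (\<lambda>b. a \<otimes> b) \<in> additive_maps R R"
  "a \<in> carrier R \<Longrightarrow> (\<lambda>b. b \<otimes> a) \<in> additive_maps R R"
  by (auto intro!: additive_mapsI simp: r_distr l_distr)

lemma additive_maps_comp:
  "f \<in> additive_maps G H \<Longrightarrow> g \<in> additive_maps H K \<Longrightarrow> (\<lambda>a. g (f a)) \<in> additive_maps G K"
  by (auto simp: hom_def Pi_iff)

text \<open>Depth conditions see a Frobenius extension with top ring \<open>A\<close> only through the image \<open>U\<close> of the
  base ring in \<open>A\<close> and the Frobenius homomorphism \<open>\<epsilon>\<close>, composed with the map of the base to \<open>A\<close>.\<close>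

locale frobenius_system = ring A
  for A :: "'a ring" (structure) and U :: "'a set" and \<epsilon> :: "'a \<Rightarrow> 'a"
    and r :: nat and x y :: "nat \<Rightarrow> 'a" +
  assumes base_subset: "U \<subseteq> carrier A"
    and eps_bilinear: "\<epsilon> \<in> bilinear_maps A U U"
    and eps_base: "a \<in> carrier A \<Longrightarrow> \<epsilon> a \<in> U"
    and x_closed: "s < r \<Longrightarrow> x s \<in> carrier A"
    and y_closed: "s < r \<Longrightarrow> y s \<in> carrier A"
    and left_basis: "a \<in> carrier A \<Longrightarrow> (\<Oplus>s\<in>{..<r}. \<epsilon> (a \<otimes> x s) \<otimes> y s) = a"
    and right_basis: "a \<in> carrier A \<Longrightarrow> (\<Oplus>s\<in>{..<r}. x s \<otimes> \<epsilon> (y s \<otimes> a)) = a"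
begin

lemma base_closed: "s \<in> U \<Longrightarrow> s \<in> carrier A"
  using base_subset by blast

lemmas eps_closed = bilinear_maps_closed[OF eps_bilinear]
lemmas eps_additive = bilinear_maps_additive[OF eps_bilinear]
lemmas eps_left = bilinear_maps_left[OF eps_bilinear]
lemmas eps_right = bilinear_maps_right[OF eps_bilinear]

text \<open>The element \<open>\<Sum> x\<^sub>s \<otimes> y\<^sub>s\<close> of \<open>A \<otimes>\<^sub>U A\<close> commutes with \<open>A\<close>: expand \<open>a x\<^sub>s\<close> in the right basis,
  move the coefficients, which lie in \<open>U\<close>, across the tensor sign, and contract by the left basis.
  The map \<open>\<psi>\<close> stands for a map out of \<open>A \<otimes>\<^sub>U A\<close>.\<close>

lemma casimir:
  assumes G: "abelian_group G"
    and \<psi>1: "\<And>a. a \<in> carrier A \<Longrightarrow> \<psi> a \<in> additive_maps A G"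
    and \<psi>2: "\<And>b. b \<in> carrier A \<Longrightarrow> (\<lambda>a. \<psi> a b) \<in> additive_maps A G"
    and balanced: "\<And>a s b. a \<in> carrier A \<Longrightarrow> s \<in> U \<Longrightarrow> b \<in> carrier A \<Longrightarrow> \<psi> (a \<otimes> s) b = \<psi> a (s \<otimes> b)"
    and a: "a \<in> carrier A"
  shows "(\<Oplus>\<^bsub>G\<^esub>s\<in>{..<r}. \<psi> (a \<otimes> x s) (y s)) = (\<Oplus>\<^bsub>G\<^esub>s\<in>{..<r}. \<psi> (x s) (y s \<otimes> a))"
proof -
  interpret G: abelian_group G by fact
  note [simp] = x_closed y_closed eps_closed additive_maps_closed[OF \<psi>1]
  have left: "\<psi> (a \<otimes> x s) (y s) = (\<Oplus>\<^bsub>G\<^esub>t\<in>{..<r}. \<psi> (x t) (\<epsilon> (y t \<otimes> (a \<otimes> x s)) \<otimes> y s))"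
    if s: "s < r" for s
  proof -
    have "\<psi> (a \<otimes> x s) (y s) = \<psi> (\<Oplus>t\<in>{..<r}. x t \<otimes> \<epsilon> (y t \<otimes> (a \<otimes> x s))) (y s)"
      using s a by (simp add: right_basis)
    also have "\<dots> = (\<Oplus>\<^bsub>G\<^esub>t\<in>{..<r}. \<psi> (x t \<otimes> \<epsilon> (y t \<otimes> (a \<otimes> x s))) (y s))"
      using s a by (intro additive_maps_finsum[OF abelian_group_axioms G \<psi>2]) auto
    also have "\<dots> = (\<Oplus>\<^bsub>G\<^esub>t\<in>{..<r}. \<psi> (x t) (\<epsilon> (y t \<otimes> (a \<otimes> x s)) \<otimes> y s))"
      using s a by (intro G.finsum_cong') (auto simp: balanced eps_base)
    finally show ?thesis .
  qed
  have right: "\<psi> (x t) (y t \<otimes> a) = (\<Oplus>\<^bsub>G\<^esub>s\<in>{..<r}. \<psi> (x t) (\<epsilon> (y t \<otimes> (a \<otimes> x s)) \<otimes> y s))"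
    if t: "t < r" for t
  proof -
    have "\<psi> (x t) (y t \<otimes> a) = \<psi> (x t) (\<Oplus>s\<in>{..<r}. \<epsilon> (y t \<otimes> a \<otimes> x s) \<otimes> y s)"
      using t a by (simp add: left_basis)
    also have "\<dots> = (\<Oplus>\<^bsub>G\<^esub>s\<in>{..<r}. \<psi> (x t) (\<epsilon> (y t \<otimes> a \<otimes> x s) \<otimes> y s))"
      using t a by (intro additive_maps_finsum[OF abelian_group_axioms G \<psi>1]) auto
    also have "\<dots> = (\<Oplus>\<^bsub>G\<^esub>s\<in>{..<r}. \<psi> (x t) (\<epsilon> (y t \<otimes> (a \<otimes> x s)) \<otimes> y s))"
      using t a by (intro G.finsum_cong') (auto simp: m_assoc)
    finally show ?thesis .
  qed
  have "(\<Oplus>\<^bsub>G\<^esub>s\<in>{..<r}. \<psi> (a \<otimes> x s) (y s))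
      = (\<Oplus>\<^bsub>G\<^esub>s\<in>{..<r}. \<Oplus>\<^bsub>G\<^esub>t\<in>{..<r}. \<psi> (x t) (\<epsilon> (y t \<otimes> (a \<otimes> x s)) \<otimes> y s))"
    using a by (intro G.finsum_cong') (auto simp: left intro!: G.finsum_closed)
  also have "\<dots> = (\<Oplus>\<^bsub>G\<^esub>t\<in>{..<r}. \<Oplus>\<^bsub>G\<^esub>s\<in>{..<r}. \<psi> (x t) (\<epsilon> (y t \<otimes> (a \<otimes> x s)) \<otimes> y s))"
    using a by (intro G.finsum_swap) auto
  also have "\<dots> = (\<Oplus>\<^bsub>G\<^esub>t\<in>{..<r}. \<psi> (x t) (y t \<otimes> a))"
    using a by (intro G.finsum_cong') (auto simp: right)
  finally show ?thesis .
qed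

end


section \<open>Quasibases\<close>

text \<open>Depth three, with exponent \<open>k\<close>, of a tower with top ring \<open>A\<close> that is a Frobenius extension of the
  middle ring, where \<open>U\<close> and \<open>Y\<close> are the images of the middle and the bottom ring in \<open>A\<close>, and \<open>\<epsilon>\<close>
  is the Frobenius homomorphism composed with the map of the middle ring to \<open>A\<close>. The families \<open>\<beta>\<close> and \<open>\<sigma>\<close> change places on passing to the opposite ring.\<close>

definition depth_three_pairing ::
  "'a ring \<Rightarrow> 'a set \<Rightarrow> 'a set \<Rightarrow> ('a \<Rightarrow> 'a) \<Rightarrow> nat \<Rightarrow> bool" where
  "depth_three_pairing A U Y \<epsilon> k \<longleftrightarrow>
     (\<exists>\<beta> \<sigma>. (\<forall>i<k. \<beta> i \<in> bilinear_maps A U Y \<and> \<sigma> i \<in> bilinear_maps A Y U) \<and>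
       (\<forall>a\<in>carrier A. \<forall>b\<in>carrier A. (\<Oplus>\<^bsub>A\<^esub>i\<in>{..<k}. \<beta> i b \<otimes>\<^bsub>A\<^esub> \<sigma> i a) = \<epsilon> (b \<otimes>\<^bsub>A\<^esub> a)))"

text \<open>Consider a Frobenius extension whose top ring \<open>S\<close> maps to \<open>A\<close> by \<open>p\<close>, let \<open>U\<close> be the image of its
  base in \<open>A\<close>, and let \<open>q\<close> be the Frobenius homomorphism composed with the map of the base to \<open>A\<close>. The
  condition then says that the tensor product of \<open>S\<close> with \<open>A\<close> over the base is a direct summand of
  \<open>A\<^sup>k\<close>, as a bimodule for \<open>S\<close> on the left and for a ring with image \<open>Y\<close> in \<open>A\<close> on the right. As \<open>p\<close>
  need not be injective, \<open>q\<close> is a function on \<open>S\<close> and not on its image in \<open>A\<close>.\<close>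

definition depth_quasibase ::
  "'a ring \<Rightarrow> 'a set \<Rightarrow> 'a set \<Rightarrow> 's set \<Rightarrow> ('s \<Rightarrow> 'a) \<Rightarrow> ('s \<Rightarrow> 'a) \<Rightarrow> nat \<Rightarrow> bool" where
  "depth_quasibase A U Y S p q k \<longleftrightarrow>
     (\<exists>\<tau> \<beta>. (\<forall>i<k. \<tau> i \<in> bilinear_maps A U Y \<and> \<beta> i \<in> bilinear_maps A U Y) \<and>
       (\<forall>s\<in>S. \<forall>a\<in>carrier A. (\<Oplus>\<^bsub>A\<^esub>i\<in>{..<k}. \<tau> i (p s \<otimes>\<^bsub>A\<^esub> \<beta> i a)) = q s \<otimes>\<^bsub>A\<^esub> a))"

lemma depth_three_pairingE:
  assumes "depth_three_pairing A U Y \<epsilon> k"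
  obtains \<beta> \<sigma> where "\<And>i. i < k \<Longrightarrow> \<beta> i \<in> bilinear_maps A U Y" "\<And>i. i < k \<Longrightarrow> \<sigma> i \<in> bilinear_maps A Y U"
    and "\<And>a b. a \<in> carrier A \<Longrightarrow> b \<in> carrier A \<Longrightarrow>
      (\<Oplus>\<^bsub>A\<^esub>i\<in>{..<k}. \<beta> i b \<otimes>\<^bsub>A\<^esub> \<sigma> i a) = \<epsilon> (b \<otimes>\<^bsub>A\<^esub> a)"
proof -
  obtain \<beta> \<sigma> where *: "(\<forall>i<k. \<beta> i \<in> bilinear_maps A U Y \<and> \<sigma> i \<in> bilinear_maps A Y U) \<and>
      (\<forall>a\<in>carrier A. \<forall>b\<in>carrier A. (\<Oplus>\<^bsub>A\<^esub>i\<in>{..<k}. \<beta> i b \<otimes>\<^bsub>A\<^esub> \<sigma> i a) = \<epsilon> (b \<otimes>\<^bsub>A\<^esub> a))"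
    using assms[unfolded depth_three_pairing_def] by (elim exE) (rule that)
  show thesis
    by (rule that[of \<beta> \<sigma>]) (use * in simp_all)
qed

lemma depth_quasibaseE:
  assumes "depth_quasibase A U Y S p q k"
  obtains \<tau> \<beta> where "\<And>i. i < k \<Longrightarrow> \<tau> i \<in> bilinear_maps A U Y" "\<And>i. i < k \<Longrightarrow> \<beta> i \<in> bilinear_maps A U Y"
    and "\<And>s a. s \<in> S \<Longrightarrow> a \<in> carrier A \<Longrightarrow>
      (\<Oplus>\<^bsub>A\<^esub>i\<in>{..<k}. \<tau> i (p s \<otimes>\<^bsub>A\<^esub> \<beta> i a)) = q s \<otimes>\<^bsub>A\<^esub> a"
proof -
  obtain \<tau> \<beta> where *: "(\<forall>i<k. \<tau> i \<in> bilinear_maps A U Y \<and> \<beta> i \<in> bilinear_maps A U Y) \<and>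
      (\<forall>s\<in>S. \<forall>a\<in>carrier A. (\<Oplus>\<^bsub>A\<^esub>i\<in>{..<k}. \<tau> i (p s \<otimes>\<^bsub>A\<^esub> \<beta> i a)) = q s \<otimes>\<^bsub>A\<^esub> a)"
    using assms[unfolded depth_quasibase_def] by (elim exE) (rule that)
  show thesis
    by (rule that[of \<tau> \<beta>]) (use * in simp_all)
qed

context frobenius_system
begin

text \<open>The maps \<open>\<sigma>\<^sub>i\<close> and \<open>\<tau>\<^sub>i\<close> encode the same element \<open>\<Sum> \<sigma>\<^sub>i(x\<^sub>s) \<otimes> y\<^sub>s = \<Sum> x\<^sub>s \<otimes> \<tau>\<^sub>i(y\<^sub>s)\<close> of \<open>A \<otimes>\<^sub>U A\<close>:
  applying \<open>\<epsilon>\<close> to the right factor, multiplied by an argument, gives \<open>\<sigma>\<^sub>i\<close>, and doing so with the left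
  factor gives \<open>\<tau>\<^sub>i\<close>. The maps \<open>\<beta>\<^sub>i\<close> are kept.\<close>

lemma pairing_imp_quasibase:
  assumes Y: "Y \<subseteq> carrier A" and pairing: "depth_three_pairing A U Y \<epsilon> k"
  shows "depth_quasibase A U Y (carrier A) id \<epsilon> k"
proof -
  obtain \<beta> \<sigma> where \<beta>: "\<And>i. i < k \<Longrightarrow> \<beta> i \<in> bilinear_maps A U Y"
    and \<sigma>: "\<And>i. i < k \<Longrightarrow> \<sigma> i \<in> bilinear_maps A Y U"
    and sum: "\<And>a b. a \<in> carrier A \<Longrightarrow> b \<in> carrier A \<Longrightarrow> (\<Oplus>i\<in>{..<k}. \<beta> i b \<otimes> \<sigma> i a) = \<epsilon> (b \<otimes> a)"
    by (fact depth_three_pairingE[OF pairing])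
  note [simp] = x_closed y_closed eps_closed bilinear_maps_closed[OF \<beta>] bilinear_maps_closed[OF \<sigma>]
    base_closed subsetD[OF Y]
  define \<tau> where "\<tau> i a = (\<Oplus>s\<in>{..<r}. \<epsilon> (a \<otimes> \<sigma> i (x s)) \<otimes> y s)" for i a
  have \<tau>: "\<tau> i \<in> bilinear_maps A U Y" if i: "i < k" for i
  proof (rule bilinear_mapsI)
    fix a assume "a \<in> carrier A"
    then show "\<tau> i a \<in> carrier A"
      using i by (auto simp: \<tau>_def intro!: finsum_closed)
  next
    fix a b assume ab: "a \<in> carrier A" "b \<in> carrier A"
    have "\<tau> i (a \<oplus> b) = (\<Oplus>s\<in>{..<r}. \<epsilon> (a \<otimes> \<sigma> i (x s)) \<otimes> y s \<oplus> \<epsilon> (b \<otimes> \<sigma> i (x s)) \<otimes> y s)"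
      unfolding \<tau>_def using ab i
      by (intro finsum_cong') (auto simp: l_distr additive_maps_add[OF eps_additive])
    then show "\<tau> i (a \<oplus> b) = \<tau> i a \<oplus> \<tau> i b"
      unfolding \<tau>_def using ab i by (simp add: finsum_addf Pi_iff)
  next
    fix s a assume s: "s \<in> U" and a: "a \<in> carrier A"
    have "s \<otimes> \<tau> i a = (\<Oplus>t\<in>{..<r}. s \<otimes> (\<epsilon> (a \<otimes> \<sigma> i (x t)) \<otimes> y t))"
      unfolding \<tau>_def using s a i by (intro finsum_rdistr) auto
    also have "\<dots> = \<tau> i (s \<otimes> a)"
      unfolding \<tau>_def using s a i by (intro finsum_cong') (auto simp: m_assoc eps_left)
    finally show "\<tau> i (s \<otimes> a) = s \<otimes> \<tau> i a" by simp
  next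
    fix a c assume a: "a \<in> carrier A" and c: "c \<in> Y"
    have "\<tau> i (a \<otimes> c) = (\<Oplus>s\<in>{..<r}. \<epsilon> (a \<otimes> \<sigma> i (c \<otimes> x s)) \<otimes> y s)"
      unfolding \<tau>_def using a c i
      by (intro finsum_cong') (auto simp: bilinear_maps_left[OF \<sigma>] m_assoc)
    also have "\<dots> = (\<Oplus>s\<in>{..<r}. \<epsilon> (a \<otimes> \<sigma> i (x s)) \<otimes> (y s \<otimes> c))"
    proof (rule casimir[OF abelian_group_axioms])
      show "(\<lambda>q. \<epsilon> (a \<otimes> \<sigma> i p) \<otimes> q) \<in> additive_maps A A" if "p \<in> carrier A" for p
        using that a i by (intro additive_maps_mult) auto
      show "(\<lambda>p. \<epsilon> (a \<otimes> \<sigma> i p) \<otimes> q) \<in> additive_maps A A" if "q \<in> carrier A" for q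
        using that a i bilinear_maps_additive[OF \<sigma>[OF i]]
        by (intro additive_maps_comp[OF _ additive_maps_mult(2)] additive_maps_comp[OF _ eps_additive]
            additive_maps_comp[OF _ additive_maps_mult(1)]) auto
      show "\<epsilon> (a \<otimes> \<sigma> i (p \<otimes> s)) \<otimes> q = \<epsilon> (a \<otimes> \<sigma> i p) \<otimes> (s \<otimes> q)"
        if "p \<in> carrier A" "s \<in> U" "q \<in> carrier A" for p s q
        using that a i eps_right[of s "a \<otimes> \<sigma> i p"]
        by (simp add: bilinear_maps_right[OF \<sigma>] m_assoc)
    qed (use c in auto)
    also have "\<dots> = (\<Oplus>s\<in>{..<r}. \<epsilon> (a \<otimes> \<sigma> i (x s)) \<otimes> y s \<otimes> c)"
      using a c i by (intro finsum_cong') (auto simp: m_assoc)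
    also have "\<dots> = \<tau> i a \<otimes> c"
      unfolding \<tau>_def using a c i by (intro finsum_ldistr[symmetric]) auto
    finally show "\<tau> i (a \<otimes> c) = \<tau> i a \<otimes> c" .
  qed
  have "(\<Oplus>i\<in>{..<k}. \<tau> i (z \<otimes> \<beta> i a)) = \<epsilon> z \<otimes> a" if z: "z \<in> carrier A" and a: "a \<in> carrier A" for z a
  proof -
    have "(\<Oplus>i\<in>{..<k}. \<tau> i (z \<otimes> \<beta> i a))
        = (\<Oplus>s\<in>{..<r}. \<Oplus>i\<in>{..<k}. \<epsilon> (z \<otimes> \<beta> i a \<otimes> \<sigma> i (x s)) \<otimes> y s)"
      unfolding \<tau>_def using z a by (intro finsum_swap) auto
    also have "\<dots> = (\<Oplus>s\<in>{..<r}. \<epsilon> z \<otimes> (\<epsilon> (a \<otimes> x s) \<otimes> y s))"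
    proof (rule finsum_cong')
      fix s assume s: "s \<in> {..<r}"
      have "(\<Oplus>i\<in>{..<k}. \<epsilon> (z \<otimes> \<beta> i a \<otimes> \<sigma> i (x s)) \<otimes> y s)
          = (\<Oplus>i\<in>{..<k}. \<epsilon> (z \<otimes> (\<beta> i a \<otimes> \<sigma> i (x s))) \<otimes> y s)"
        using s z a by (intro finsum_cong') (auto simp: m_assoc)
      also have "\<dots> = \<epsilon> (z \<otimes> (\<Oplus>i\<in>{..<k}. \<beta> i a \<otimes> \<sigma> i (x s))) \<otimes> y s"
        using s z a
        by (intro additive_maps_finsum[OF abelian_group_axioms abelian_group_axioms, symmetric]
            additive_maps_comp[OF _ additive_maps_mult(2)] additive_maps_comp[OF _ eps_additive]
            additive_maps_mult) auto
      also have "\<dots> = \<epsilon> z \<otimes> (\<epsilon> (a \<otimes> x s) \<otimes> y s)"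
        using s z a by (simp add: sum eps_right eps_base m_assoc)
      finally show "(\<Oplus>i\<in>{..<k}. \<epsilon> (z \<otimes> \<beta> i a \<otimes> \<sigma> i (x s)) \<otimes> y s)
          = \<epsilon> z \<otimes> (\<epsilon> (a \<otimes> x s) \<otimes> y s)" .
    qed (use z a in auto)
    also have "\<dots> = \<epsilon> z \<otimes> (\<Oplus>s\<in>{..<r}. \<epsilon> (a \<otimes> x s) \<otimes> y s)"
      using z a by (intro finsum_rdistr[symmetric]) auto
    finally show ?thesis
      using a by (simp add: left_basis)
  qed
  with \<tau> \<beta> show ?thesis
    unfolding depth_quasibase_def by (intro exI[of _ \<tau>] exI[of _ \<beta>]) auto
qed

lemma quasibase_imp_pairing:
  assumes Y: "Y \<subseteq> carrier A" and quasibase: "depth_quasibase A U Y (carrier A) id \<epsilon> k"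
  shows "depth_three_pairing A U Y \<epsilon> k"
proof -
  obtain \<tau> \<beta> where \<tau>: "\<And>i. i < k \<Longrightarrow> \<tau> i \<in> bilinear_maps A U Y"
    and \<beta>: "\<And>i. i < k \<Longrightarrow> \<beta> i \<in> bilinear_maps A U Y"
    and sum: "\<And>z a. z \<in> carrier A \<Longrightarrow> a \<in> carrier A \<Longrightarrow> (\<Oplus>i\<in>{..<k}. \<tau> i (z \<otimes> \<beta> i a)) = \<epsilon> z \<otimes> a"
    by (fact depth_quasibaseE[OF quasibase, unfolded id_apply])
  note [simp] = x_closed y_closed eps_closed bilinear_maps_closed[OF \<beta>] bilinear_maps_closed[OF \<tau>]
    base_closed subsetD[OF Y]
  define \<sigma> where "\<sigma> i a = (\<Oplus>s\<in>{..<r}. x s \<otimes> \<epsilon> (\<tau> i (y s) \<otimes> a))" for i a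
  have casimir_\<sigma>: "(\<Oplus>s\<in>{..<r}. (c \<otimes> x s) \<otimes> \<epsilon> (\<tau> i (y s) \<otimes> a))
      = (\<Oplus>s\<in>{..<r}. x s \<otimes> \<epsilon> (\<tau> i (y s \<otimes> c) \<otimes> a))"
    if i: "i < k" and a: "a \<in> carrier A" and c: "c \<in> carrier A" for i a c
  proof (rule casimir[OF abelian_group_axioms _ _ _ c])
    show "(\<lambda>q. p \<otimes> \<epsilon> (\<tau> i q \<otimes> a)) \<in> additive_maps A A" if "p \<in> carrier A" for p
      using that a i bilinear_maps_additive[OF \<tau>[OF i]]
      by (intro additive_maps_comp[OF _ additive_maps_mult(1)] additive_maps_comp[OF _ eps_additive]
          additive_maps_comp[OF _ additive_maps_mult(2)]) auto
    show "(\<lambda>p. p \<otimes> \<epsilon> (\<tau> i q \<otimes> a)) \<in> additive_maps A A" if "q \<in> carrier A" for q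
      using that a i by (intro additive_maps_mult) auto
    show "p \<otimes> s \<otimes> \<epsilon> (\<tau> i q \<otimes> a) = p \<otimes> \<epsilon> (\<tau> i (s \<otimes> q) \<otimes> a)"
      if "p \<in> carrier A" "s \<in> U" "q \<in> carrier A" for p s q
      using that a i by (simp add: bilinear_maps_left[OF \<tau>] eps_left m_assoc)
  qed
  have expand: "c \<otimes> \<sigma> i a = (\<Oplus>s\<in>{..<r}. x s \<otimes> \<epsilon> (\<tau> i (y s \<otimes> c) \<otimes> a))"
    if i: "i < k" and a: "a \<in> carrier A" and c: "c \<in> carrier A" for i a c
  proof -
    have "c \<otimes> \<sigma> i a = (\<Oplus>s\<in>{..<r}. c \<otimes> (x s \<otimes> \<epsilon> (\<tau> i (y s) \<otimes> a)))"
      unfolding \<sigma>_def using i a c by (intro finsum_rdistr) auto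
    also have "\<dots> = (\<Oplus>s\<in>{..<r}. (c \<otimes> x s) \<otimes> \<epsilon> (\<tau> i (y s) \<otimes> a))"
      using i a c by (intro finsum_cong') (auto simp: m_assoc)
    finally show ?thesis
      using casimir_\<sigma>[OF i a c] by simp
  qed
  have \<sigma>: "\<sigma> i \<in> bilinear_maps A Y U" if i: "i < k" for i
  proof (rule bilinear_mapsI)
    fix a assume "a \<in> carrier A"
    then show "\<sigma> i a \<in> carrier A"
      using i by (auto simp: \<sigma>_def intro!: finsum_closed)
  next
    fix a b assume ab: "a \<in> carrier A" "b \<in> carrier A"
    have "\<sigma> i (a \<oplus> b) = (\<Oplus>s\<in>{..<r}. x s \<otimes> \<epsilon> (\<tau> i (y s) \<otimes> a) \<oplus> x s \<otimes> \<epsilon> (\<tau> i (y s) \<otimes> b))"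
      unfolding \<sigma>_def using ab i
      by (intro finsum_cong') (auto simp: r_distr additive_maps_add[OF eps_additive])
    then show "\<sigma> i (a \<oplus> b) = \<sigma> i a \<oplus> \<sigma> i b"
      unfolding \<sigma>_def using ab i by (simp add: finsum_addf Pi_iff)
  next
    fix c a assume c: "c \<in> Y" and a: "a \<in> carrier A"
    have "c \<otimes> \<sigma> i a = (\<Oplus>s\<in>{..<r}. x s \<otimes> \<epsilon> (\<tau> i (y s \<otimes> c) \<otimes> a))"
      using a c i by (intro expand) auto
    also have "\<dots> = \<sigma> i (c \<otimes> a)"
      unfolding \<sigma>_def using a c i
      by (intro finsum_cong') (auto simp: bilinear_maps_right[OF \<tau>] m_assoc)
    finally show "\<sigma> i (c \<otimes> a) = c \<otimes> \<sigma> i a" by simp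
  next
    fix a s assume a: "a \<in> carrier A" and s: "s \<in> U"
    have "\<sigma> i a \<otimes> s = (\<Oplus>t\<in>{..<r}. x t \<otimes> \<epsilon> (\<tau> i (y t) \<otimes> a) \<otimes> s)"
      unfolding \<sigma>_def using s a i by (intro finsum_ldistr) auto
    also have "\<dots> = \<sigma> i (a \<otimes> s)"
      unfolding \<sigma>_def
    proof (rule finsum_cong')
      fix t assume "t \<in> {..<r}"
      then show "x t \<otimes> \<epsilon> (\<tau> i (y t) \<otimes> a) \<otimes> s = x t \<otimes> \<epsilon> (\<tau> i (y t) \<otimes> (a \<otimes> s))"
        using s a i eps_right[of s "\<tau> i (y t) \<otimes> a"] by (simp add: m_assoc)
    qed (use s a i in auto)
    finally show "\<sigma> i (a \<otimes> s) = \<sigma> i a \<otimes> s" by simp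
  qed
  have "(\<Oplus>i\<in>{..<k}. \<beta> i b \<otimes> \<sigma> i a) = \<epsilon> (b \<otimes> a)" if a: "a \<in> carrier A" and b: "b \<in> carrier A" for a b
  proof -
    have "(\<Oplus>i\<in>{..<k}. \<beta> i b \<otimes> \<sigma> i a)
        = (\<Oplus>i\<in>{..<k}. \<Oplus>s\<in>{..<r}. x s \<otimes> \<epsilon> (\<tau> i (y s \<otimes> \<beta> i b) \<otimes> a))"
      using a b by (intro finsum_cong') (auto simp: expand intro!: finsum_closed)
    also have "\<dots> = (\<Oplus>s\<in>{..<r}. \<Oplus>i\<in>{..<k}. x s \<otimes> \<epsilon> (\<tau> i (y s \<otimes> \<beta> i b) \<otimes> a))"
      using a b by (intro finsum_swap) auto
    also have "\<dots> = (\<Oplus>s\<in>{..<r}. x s \<otimes> \<epsilon> (y s \<otimes> \<one>) \<otimes> \<epsilon> (b \<otimes> a))"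
    proof (rule finsum_cong')
      fix s assume s: "s \<in> {..<r}"
      have "(\<Oplus>i\<in>{..<k}. x s \<otimes> \<epsilon> (\<tau> i (y s \<otimes> \<beta> i b) \<otimes> a))
          = x s \<otimes> \<epsilon> ((\<Oplus>i\<in>{..<k}. \<tau> i (y s \<otimes> \<beta> i b)) \<otimes> a)"
        using s b a
        by (intro additive_maps_finsum[OF abelian_group_axioms abelian_group_axioms, symmetric]
            additive_maps_comp[OF _ additive_maps_mult(1)] additive_maps_comp[OF _ eps_additive]
            additive_maps_mult) auto
      also have "\<dots> = x s \<otimes> \<epsilon> (y s \<otimes> \<one>) \<otimes> \<epsilon> (b \<otimes> a)"
        using s b a by (simp add: sum eps_left eps_base m_assoc)
      finally show "(\<Oplus>i\<in>{..<k}. x s \<otimes> \<epsilon> (\<tau> i (y s \<otimes> \<beta> i b) \<otimes> a))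
          = x s \<otimes> \<epsilon> (y s \<otimes> \<one>) \<otimes> \<epsilon> (b \<otimes> a)" .
    qed (use a b in auto)
    also have "\<dots> = (\<Oplus>s\<in>{..<r}. x s \<otimes> \<epsilon> (y s \<otimes> \<one>)) \<otimes> \<epsilon> (b \<otimes> a)"
      using a b by (intro finsum_ldistr[symmetric]) auto
    finally show ?thesis
      using a b by (simp only: right_basis[OF one_closed]) simp
  qed
  with \<sigma> \<beta> show ?thesis
    unfolding depth_three_pairing_def by (intro exI[of _ \<beta>] exI[of _ \<sigma>]) auto
qed

end

text \<open>Let \<open>S\<close> be a Frobenius extension of \<open>S\<^sub>0\<close> with Frobenius homomorphism \<open>\<phi>\<close>, and \<open>S\<^sub>0\<close> one of some ring
  with image \<open>U\<^sub>0\<close>. If the tensor products of \<open>S\<close> with \<open>A\<close> over \<open>S\<^sub>0\<close>, and of \<open>S\<^sub>0\<close> with \<open>A\<close> over the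
  smaller ring, are summands of powers of \<open>A\<close>, then so is that of \<open>S\<close> with \<open>A\<close> over the smaller ring:
  it arises from the latter by tensoring with \<open>S\<close> over \<open>S\<^sub>0\<close>, and the retractions compose.\<close>

lemma depth_quasibase_comp:
  fixes A :: "'a ring" (structure)
  assumes ring: "ring A"
    and outer: "depth_quasibase A U Y S p q k"
    and inner: "depth_quasibase A U\<^sub>0 Y S\<^sub>0 p\<^sub>0 q\<^sub>0 l"
    and U: "U\<^sub>0 \<subseteq> U" and \<phi>: "\<And>s. s \<in> S \<Longrightarrow> \<phi> s \<in> S\<^sub>0 \<and> q s = p\<^sub>0 (\<phi> s)"
    and p: "\<And>s. s \<in> S \<Longrightarrow> p s \<in> carrier A"
  shows "depth_quasibase A U\<^sub>0 Y S p (\<lambda>s. q\<^sub>0 (\<phi> s)) (k * l)"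
proof -
  interpret ring A by (rule ring)
  obtain \<tau> \<beta> where \<tau>: "\<And>i. i < k \<Longrightarrow> \<tau> i \<in> bilinear_maps A U Y"
    and \<beta>: "\<And>i. i < k \<Longrightarrow> \<beta> i \<in> bilinear_maps A U Y"
    and sum: "\<And>s a. s \<in> S \<Longrightarrow> a \<in> carrier A \<Longrightarrow> (\<Oplus>i\<in>{..<k}. \<tau> i (p s \<otimes> \<beta> i a)) = q s \<otimes> a"
    by (fact depth_quasibaseE[OF outer])
  obtain \<tau>\<^sub>0 \<beta>\<^sub>0 where \<tau>\<^sub>0: "\<And>j. j < l \<Longrightarrow> \<tau>\<^sub>0 j \<in> bilinear_maps A U\<^sub>0 Y"
    and \<beta>\<^sub>0: "\<And>j. j < l \<Longrightarrow> \<beta>\<^sub>0 j \<in> bilinear_maps A U\<^sub>0 Y"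
    and sum\<^sub>0: "\<And>s a. s \<in> S\<^sub>0 \<Longrightarrow> a \<in> carrier A \<Longrightarrow>
      (\<Oplus>j\<in>{..<l}. \<tau>\<^sub>0 j (p\<^sub>0 s \<otimes> \<beta>\<^sub>0 j a)) = q\<^sub>0 s \<otimes> a"
    by (fact depth_quasibaseE[OF inner])
  note [simp] = bilinear_maps_closed[OF \<tau>] bilinear_maps_closed[OF \<beta>]
    bilinear_maps_closed[OF \<tau>\<^sub>0] bilinear_maps_closed[OF \<beta>\<^sub>0]
  have restrict: "\<psi> \<in> bilinear_maps A U\<^sub>0 Y" if "\<psi> \<in> bilinear_maps A U Y" for \<psi>
    using that U by (auto simp: bilinear_maps_def)
  have comp: "(\<lambda>a. \<psi> (\<psi>' a)) \<in> bilinear_maps A U\<^sub>0 Y"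
    if "\<psi> \<in> bilinear_maps A U\<^sub>0 Y" "\<psi>' \<in> bilinear_maps A U\<^sub>0 Y" for \<psi> \<psi>'
    using that by (auto simp: bilinear_maps_def hom_def Pi_iff)
  define \<tau>' where "\<tau>' n a = \<tau>\<^sub>0 (n mod l) (\<tau> (n div l) a)" for n a
  define \<beta>' where "\<beta>' n a = \<beta> (n div l) (\<beta>\<^sub>0 (n mod l) a)" for n a
  have bound: "n div l < k" "n mod l < l" if "n < k * l" for n
  proof -
    have "0 < l" using that by (cases l) auto
    with that show "n div l < k" "n mod l < l"
      by (auto simp: less_mult_imp_div_less)
  qed
  have "\<tau>' n \<in> bilinear_maps A U\<^sub>0 Y" "\<beta>' n \<in> bilinear_maps A U\<^sub>0 Y" if "n < k * l" for n
    unfolding \<tau>'_def \<beta>'_def using bound[OF that]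
    by (auto intro: comp[OF \<tau>\<^sub>0 restrict[OF \<tau>]] comp[OF restrict[OF \<beta>] \<beta>\<^sub>0])
  moreover have "(\<Oplus>n\<in>{..<k * l}. \<tau>' n (p s \<otimes> \<beta>' n a)) = q\<^sub>0 (\<phi> s) \<otimes> a"
    if s: "s \<in> S" and a: "a \<in> carrier A" for s a
  proof -
    have "(\<Oplus>n\<in>{..<k * l}. \<tau>' n (p s \<otimes> \<beta>' n a))
        = (\<Oplus>i\<in>{..<k}. \<Oplus>j\<in>{..<l}. \<tau>\<^sub>0 j (\<tau> i (p s \<otimes> \<beta> i (\<beta>\<^sub>0 j a))))"
      unfolding \<tau>'_def \<beta>'_def using s a p
      by (intro finsum_div_mod[where s = "\<lambda>i j. \<tau>\<^sub>0 j (\<tau> i (p s \<otimes> \<beta> i (\<beta>\<^sub>0 j a)))"]) auto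
    also have "\<dots> = (\<Oplus>j\<in>{..<l}. \<Oplus>i\<in>{..<k}. \<tau>\<^sub>0 j (\<tau> i (p s \<otimes> \<beta> i (\<beta>\<^sub>0 j a))))"
      using s a p by (intro finsum_swap) auto
    also have "\<dots> = (\<Oplus>j\<in>{..<l}. \<tau>\<^sub>0 j (p\<^sub>0 (\<phi> s) \<otimes> \<beta>\<^sub>0 j a))"
    proof (rule finsum_cong')
      fix j assume j: "j \<in> {..<l}"
      have "(\<Oplus>i\<in>{..<k}. \<tau>\<^sub>0 j (\<tau> i (p s \<otimes> \<beta> i (\<beta>\<^sub>0 j a))))
          = \<tau>\<^sub>0 j (\<Oplus>i\<in>{..<k}. \<tau> i (p s \<otimes> \<beta> i (\<beta>\<^sub>0 j a)))"
        using j s a p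
        by (intro additive_maps_finsum[OF abelian_group_axioms abelian_group_axioms
              bilinear_maps_additive[OF \<tau>\<^sub>0], symmetric]) auto
      then show "(\<Oplus>i\<in>{..<k}. \<tau>\<^sub>0 j (\<tau> i (p s \<otimes> \<beta> i (\<beta>\<^sub>0 j a)))) = \<tau>\<^sub>0 j (p\<^sub>0 (\<phi> s) \<otimes> \<beta>\<^sub>0 j a)"
        using j s a \<phi>[OF s] by (simp add: sum)
    next
      have "p\<^sub>0 (\<phi> s) \<otimes> \<beta>\<^sub>0 j a \<in> carrier A" if j: "j < l" for j
      proof -
        have "p\<^sub>0 (\<phi> s) \<otimes> \<beta>\<^sub>0 j a = (\<Oplus>i\<in>{..<k}. \<tau> i (p s \<otimes> \<beta> i (\<beta>\<^sub>0 j a)))"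
          using j s a \<phi>[OF s] by (simp add: sum)
        also have "\<dots> \<in> carrier A"
          using j s a p by (intro finsum_closed) auto
        finally show ?thesis .
      qed
      then show "(\<lambda>j. \<tau>\<^sub>0 j (p\<^sub>0 (\<phi> s) \<otimes> \<beta>\<^sub>0 j a)) \<in> {..<l} \<rightarrow> carrier A"
        by auto
    qed simp
    also have "\<dots> = q\<^sub>0 (\<phi> s) \<otimes> a"
      using s a \<phi> by (intro sum\<^sub>0) auto
    finally show ?thesis .
  qed
  ultimately show ?thesis
    unfolding depth_quasibase_def by (intro exI[of _ \<tau>'] exI[of _ \<beta>']) auto
qed

text \<open>Multiplication by an element \<open>e\<close> that commutes with \<open>U\<^sub>0\<close> keeps bilinearity over \<open>U\<^sub>0\<close>. The maps
  \<open>a \<mapsto> \<tau>\<^sub>i(e a)\<close> and \<open>a \<mapsto> e \<beta>\<^sub>i(a)\<close> turn the middle factor \<open>p\<^sub>0(s)\<close> into the corner element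
  \<open>e p\<^sub>0(s) e\<close>, for which the sum is known.\<close>

lemma depth_quasibase_corner:
  fixes A :: "'a ring" (structure)
  assumes ring: "ring A"
    and quasibase: "depth_quasibase A U Y S p q k"
    and U: "U\<^sub>0 \<subseteq> U" "U\<^sub>0 \<subseteq> carrier A" and Y: "Y \<subseteq> carrier A"
    and e: "e \<in> carrier A" "\<And>s. s \<in> U\<^sub>0 \<Longrightarrow> e \<otimes> s = s \<otimes> e"
    and p\<^sub>0: "\<And>s. s \<in> S\<^sub>0 \<Longrightarrow> p\<^sub>0 s \<in> carrier A"
    and corner: "\<And>s. s \<in> S\<^sub>0 \<Longrightarrow> \<exists>z\<in>S. p z = e \<otimes> p\<^sub>0 s \<otimes> e \<and> q z = q\<^sub>0 s"
  shows "depth_quasibase A U\<^sub>0 Y S\<^sub>0 p\<^sub>0 q\<^sub>0 k"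
proof -
  interpret ring A by (rule ring)
  obtain \<tau> \<beta> where \<tau>: "\<And>i. i < k \<Longrightarrow> \<tau> i \<in> bilinear_maps A U Y"
    and \<beta>: "\<And>i. i < k \<Longrightarrow> \<beta> i \<in> bilinear_maps A U Y"
    and sum: "\<And>s a. s \<in> S \<Longrightarrow> a \<in> carrier A \<Longrightarrow> (\<Oplus>i\<in>{..<k}. \<tau> i (p s \<otimes> \<beta> i a)) = q s \<otimes> a"
    by (fact depth_quasibaseE[OF quasibase])
  note [simp] = bilinear_maps_closed[OF \<tau>] bilinear_maps_closed[OF \<beta>] subsetD[OF U(1)]
    subsetD[OF U(2)] subsetD[OF Y] e(1)
  have e_swap: "e \<otimes> (s \<otimes> a) = s \<otimes> (e \<otimes> a)" if "s \<in> U\<^sub>0" "a \<in> carrier A" for s a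
    using that e by (simp flip: m_assoc)
  have "(\<lambda>a. \<tau> i (e \<otimes> a)) \<in> bilinear_maps A U\<^sub>0 Y" if i: "i < k" for i
  proof (rule bilinear_mapsI)
    show "\<tau> i (e \<otimes> (a \<otimes> c)) = \<tau> i (e \<otimes> a) \<otimes> c" if "a \<in> carrier A" "c \<in> Y" for a c
      using that i by (simp add: bilinear_maps_right[OF \<tau>] flip: m_assoc)
  qed (use i in \<open>auto simp: r_distr e_swap bilinear_maps_add[OF \<tau>] bilinear_maps_left[OF \<tau>]\<close>)
  moreover have "(\<lambda>a. e \<otimes> \<beta> i a) \<in> bilinear_maps A U\<^sub>0 Y" if i: "i < k" for i
    using i by (intro bilinear_mapsI)
      (auto simp: r_distr e_swap m_assoc bilinear_maps_add[OF \<beta>] bilinear_maps_left[OF \<beta>]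
        bilinear_maps_right[OF \<beta>])
  moreover have "(\<Oplus>i\<in>{..<k}. \<tau> i (e \<otimes> (p\<^sub>0 s \<otimes> (e \<otimes> \<beta> i a)))) = q\<^sub>0 s \<otimes> a"
    if s: "s \<in> S\<^sub>0" and a: "a \<in> carrier A" for s a
  proof -
    obtain z where z: "z \<in> S" "p z = e \<otimes> p\<^sub>0 s \<otimes> e" "q z = q\<^sub>0 s"
      using corner[OF s] by blast
    have "(\<Oplus>i\<in>{..<k}. \<tau> i (e \<otimes> (p\<^sub>0 s \<otimes> (e \<otimes> \<beta> i a)))) = (\<Oplus>i\<in>{..<k}. \<tau> i (p z \<otimes> \<beta> i a))"
      using s a z p\<^sub>0 by (intro finsum_cong') (auto simp: m_assoc)
    with sum[OF z(1) a] z show ?thesis by simp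
  qed
  ultimately show ?thesis
    unfolding depth_quasibase_def
    by (intro exI[of _ "\<lambda>i a. \<tau> i (e \<otimes> a)"] exI[of _ "\<lambda>i a. e \<otimes> \<beta> i a"]) auto
qed


section \<open>Depth three of a Frobenius extension\<close>

text \<open>The \<open>A\<close>-\<open>C\<close>-linear maps \<open>A \<otimes>\<^sub>B A \<rightarrow> A\<close> are the \<open>a \<otimes> b \<mapsto> a \<beta>(b)\<close> with \<open>\<beta>\<close> linear over \<open>B\<close> on the
  left and over \<open>C\<close> on the right. The \<open>A\<close>-\<open>C\<close>-linear maps \<open>A \<rightarrow> A \<otimes>\<^sub>B A\<close> are given by the elements of
  \<open>A \<otimes>\<^sub>B A\<close> that commute with \<open>C\<close>. Because the extension is Frobenius, \<open>u \<otimes> v \<mapsto> (a \<mapsto> u \<epsilon>(v a))\<close>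
  identifies these with endomorphisms \<open>\<sigma>\<close> of \<open>A\<close> that are linear over \<open>C\<close> on the left and over \<open>B\<close> on
  the right. Under these identifications a retraction becomes a pairing.\<close>

lemma right_tensor_summand_iff_pairing:
  fixes A :: "'a ring" (structure) and B :: "'b ring" and C :: "'c ring"
  assumes frobenius: "frobenius_system A (g ` carrier B) \<epsilon> r x y"
    and v: "v \<in> carrier C \<rightarrow> carrier A"
  shows "iso_to_direct_summand A C (tensor B (ring_bimod A id g) (ring_bimod A g v))
      (bimod_power (ring_bimod A id v) k) \<longleftrightarrow>
    depth_three_pairing A (g ` carrier B) (v ` carrier C) \<epsilon> k"
proof -
  interpret frobenius_system A "g ` carrier B" \<epsilon> r x y by fact
  have g: "g \<in> carrier B \<rightarrow> carrier A"
    using base_subset by auto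
  (* a name for the identity that keeps the arguments of the tensor product in one syntactic form *)
  define u where "u = (id :: 'a \<Rightarrow> 'a)"
  have u_apply: "u a = a" for a
    by (simp add: u_def)
  have u: "u \<in> carrier A \<rightarrow> carrier A"
    by (simp add: u_apply)
  interpret tensor_product A B C "ring_bimod A u g" "ring_bimod A g v"
    by (intro tensor_product.intro additive_bimodule_ring_bimod ring_axioms g v u)
  let ?T = "tensor B (ring_bimod A u g) (ring_bimod A g v)"
  let ?pure = "pure_tensor B (ring_bimod A u g) (ring_bimod A g v)"
  let ?Q = "ring_bimod A u v"
  interpret T: additive_bimodule A C ?T by (rule additive_bimodule_tensor)
  interpret M: additive_bimodule A C ?Q
    by (intro additive_bimodule_ring_bimod ring_axioms v u)
  have vc [simp]: "v c \<in> carrier A" if "c \<in> carrier C" for c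
    using v that by auto
  have gb [simp]: "g b \<in> carrier A" if "b \<in> carrier B" for b
    using g that by auto
  have pure_closed [simp]: "?pure p q \<in> carrier ?T" if "p \<in> carrier A" "q \<in> carrier A" for p q
    using pure_closed[of p q] that by simp
  have pure1: "?pure p \<in> additive_maps A ?T" if "p \<in> carrier A" for p
    using pure_balanced that by (auto simp: balanced_maps_def hom_def)
  have pure2: "(\<lambda>p. ?pure p q) \<in> additive_maps A ?T" if "q \<in> carrier A" for q
    using pure_balanced that by (auto simp: balanced_maps_def hom_def)
  have pure3: "?pure (p \<otimes> g b) q = ?pure p (g b \<otimes> q)"
    if "p \<in> carrier A" "b \<in> carrier B" "q \<in> carrier A" for p b q
    using pure_balanced that by (auto simp: balanced_maps_def)
  have pure_l: "lsmult ?T a (?pure p q) = ?pure (a \<otimes> p) q"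
    if "a \<in> carrier A" "p \<in> carrier A" "q \<in> carrier A" for a p q
    using lsmult_tensor(2)[of a p q] that by (simp add: u_apply)
  have pure_r: "rsmult ?T (?pure p q) c = ?pure p (q \<otimes> v c)"
    if "c \<in> carrier C" "p \<in> carrier A" "q \<in> carrier A" for c p q
    using rsmult_tensor(2)[of c p q] that by simp
  have eqI: "\<Phi> S = \<Psi> S"
    if "\<Phi> \<in> additive_maps ?T G" "\<Psi> \<in> additive_maps ?T G" "abelian_group G"
      "\<And>p q. p \<in> carrier A \<Longrightarrow> q \<in> carrier A \<Longrightarrow> \<Phi> (?pure p q) = \<Psi> (?pure p q)" "S \<in> carrier ?T"
    for \<Phi> \<Psi> S and G :: "('g, 'x) ring_scheme"
    using tensor_maps_eqI[OF that(3,1,2)] that(4,5) by simp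
  note [simp] = x_closed y_closed eps_closed
  show ?thesis
    unfolding u_def[symmetric] iso_to_direct_summand_power_iff[OF additive_bimodule_tensor M.additive_bimodule_axioms]
  proof
    assume "\<exists>f h. (\<forall>i<k. f i \<in> bimod_hom A C ?T ?Q \<and> h i \<in> bimod_hom A C ?Q ?T) \<and>
      (\<forall>p\<in>carrier ?T. (\<Oplus>\<^bsub>?T\<^esub>i\<in>{..<k}. h i (f i p)) = p)"
    then obtain f h where fh: "(\<forall>i<k. f i \<in> bimod_hom A C ?T ?Q \<and> h i \<in> bimod_hom A C ?Q ?T) \<and>
      (\<forall>p\<in>carrier ?T. (\<Oplus>\<^bsub>?T\<^esub>i\<in>{..<k}. h i (f i p)) = p)"
      by (elim exE) (rule that)
    then have f: "f i \<in> bimod_hom A C ?T ?Q" and h: "h i \<in> bimod_hom A C ?Q ?T" if "i < k" for i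
      using that by simp_all
    have f_additive: "f i \<in> additive_maps ?T A" and f_closed [simp]: "S \<in> carrier ?T \<Longrightarrow> f i S \<in> carrier A"
      and f_l: "a \<in> carrier A \<Longrightarrow> S \<in> carrier ?T \<Longrightarrow> f i (lsmult ?T a S) = a \<otimes> f i S"
      and f_r: "c \<in> carrier C \<Longrightarrow> S \<in> carrier ?T \<Longrightarrow> f i (rsmult ?T S c) = f i S \<otimes> v c"
      if "i < k" for i a c S
      using f[OF that] by (auto simp: bimod_hom_def hom_def u_apply)
    have h_additive: "h i \<in> additive_maps A ?T" and h_closed [simp]: "a \<in> carrier A \<Longrightarrow> h i a \<in> carrier ?T"
      and h_l: "a \<in> carrier A \<Longrightarrow> b \<in> carrier A \<Longrightarrow> h i (a \<otimes> b) = lsmult ?T a (h i b)"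
      and h_r: "c \<in> carrier C \<Longrightarrow> a \<in> carrier A \<Longrightarrow> h i (a \<otimes> v c) = rsmult ?T (h i a) c"
      if "i < k" for i a b c
      using h[OF that] by (auto simp: bimod_hom_def hom_def u_apply)
    (* \<Theta> a evaluates an element of the tensor product at a, as an endomorphism of A *)
    have "\<exists>\<Psi>. \<Psi> \<in> additive_maps ?T A \<and>
        (\<forall>p\<in>carrier A. \<forall>q\<in>carrier A. \<Psi> (?pure p q) = p \<otimes> \<epsilon> (q \<otimes> a))" if a: "a \<in> carrier A" for a
    proof -
      have "(\<lambda>p q. p \<otimes> \<epsilon> (q \<otimes> a)) \<in> balanced_maps B (ring_bimod A u g) (ring_bimod A g v) A"
        using a by (auto simp: balanced_maps_def hom_def l_distr r_distr eps_left m_assoc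
            additive_maps_add[OF eps_additive])
      from tensor_lift[OF abelian_group_axioms this] show ?thesis
        by (metis ring_bimod_simps(1))
    qed
    then obtain \<Theta> where \<Theta>: "\<And>a. a \<in> carrier A \<Longrightarrow> \<Theta> a \<in> additive_maps ?T A"
      and \<Theta>_pure: "\<And>a p q. a \<in> carrier A \<Longrightarrow> p \<in> carrier A \<Longrightarrow> q \<in> carrier A \<Longrightarrow>
        \<Theta> a (?pure p q) = p \<otimes> \<epsilon> (q \<otimes> a)"
      by metis
    note [simp] = additive_maps_closed[OF \<Theta>]
    have \<Theta>_add: "\<Theta> (a \<oplus> b) S = \<Theta> a S \<oplus> \<Theta> b S"
      if "a \<in> carrier A" "b \<in> carrier A" "S \<in> carrier ?T" for a b S
    proof (rule eqI[OF \<Theta> _ abelian_group_axioms])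
      show "(\<lambda>S. \<Theta> a S \<oplus> \<Theta> b S) \<in> additive_maps ?T A"
        using that by (intro additive_mapsI) (auto simp: additive_maps_add[OF \<Theta>] a_ac)
    qed (use that in \<open>auto simp: \<Theta>_pure r_distr additive_maps_add[OF eps_additive]\<close>)
    have \<Theta>_l: "\<Theta> a (lsmult ?T b S) = b \<otimes> \<Theta> a S"
      if "a \<in> carrier A" "b \<in> carrier A" "S \<in> carrier ?T" for a b S
    proof (rule eqI[OF _ _ abelian_group_axioms])
      show "(\<lambda>S. \<Theta> a (lsmult ?T b S)) \<in> additive_maps ?T A"
        using that by (intro additive_maps_comp[OF T.lsmult_additive \<Theta>]) auto
      show "(\<lambda>S. b \<otimes> \<Theta> a S) \<in> additive_maps ?T A"
        using that by (intro additive_maps_comp[OF \<Theta> additive_maps_mult(1)]) auto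
    qed (use that in \<open>auto simp: \<Theta>_pure pure_l m_assoc\<close>)
    have \<Theta>_r: "\<Theta> a (rsmult ?T S c) = \<Theta> (v c \<otimes> a) S"
      if "a \<in> carrier A" "c \<in> carrier C" "S \<in> carrier ?T" for a c S
    proof (rule eqI[OF _ \<Theta> abelian_group_axioms])
      show "(\<lambda>S. \<Theta> a (rsmult ?T S c)) \<in> additive_maps ?T A"
        using that by (intro additive_maps_comp[OF T.rsmult_additive \<Theta>]) auto
    qed (use that in \<open>auto simp: \<Theta>_pure pure_r m_assoc\<close>)
    have \<Theta>_base: "\<Theta> (a \<otimes> g b) S = \<Theta> a S \<otimes> g b"
      if "a \<in> carrier A" "b \<in> carrier B" "S \<in> carrier ?T" for a b S
    proof (rule eqI[OF \<Theta> _ abelian_group_axioms])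
      show "(\<lambda>S. \<Theta> a S \<otimes> g b) \<in> additive_maps ?T A"
        using that by (intro additive_maps_comp[OF \<Theta> additive_maps_mult(2)]) auto
      show "\<Theta> (a \<otimes> g b) (?pure p q) = \<Theta> a (?pure p q) \<otimes> g b" if "p \<in> carrier A" "q \<in> carrier A" for p q
        using that \<open>a \<in> carrier A\<close> \<open>b \<in> carrier B\<close> eps_right[of "g b" "q \<otimes> a"]
        by (simp add: \<Theta>_pure m_assoc)
    qed (use that in auto)
    define \<beta> where "\<beta> i b = f i (?pure \<one> b)" for i b
    define \<sigma> where "\<sigma> i a = \<Theta> a (h i \<one>)" for i a
    have "\<beta> i \<in> bilinear_maps A (g ` carrier B) (v ` carrier C)" if i: "i < k" for i
    proof (rule bilinear_mapsI)
      fix s b assume "s \<in> g ` carrier B" and b: "b \<in> carrier A"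
      then obtain b' where b': "b' \<in> carrier B" "s = g b'" by blast
      have "?pure \<one> (g b' \<otimes> b) = lsmult ?T (g b') (?pure \<one> b)"
        using b b' pure3[of \<one> b' b] by (simp add: pure_l)
      then show "\<beta> i (s \<otimes> b) = s \<otimes> \<beta> i b"
        using b b' i by (simp add: \<beta>_def f_l)
    next
      fix b s assume "s \<in> v ` carrier C" and b: "b \<in> carrier A"
      then obtain c where c: "c \<in> carrier C" "s = v c" by blast
      have "?pure \<one> (b \<otimes> v c) = rsmult ?T (?pure \<one> b) c"
        using b c by (simp add: pure_r)
      then show "\<beta> i (b \<otimes> s) = \<beta> i b \<otimes> s"
        using b c i by (simp add: \<beta>_def f_r)
    qed (use i in \<open>auto simp: \<beta>_def additive_maps_add[OF pure1] additive_maps_add[OF f_additive]\<close>)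
    moreover have "\<sigma> i \<in> bilinear_maps A (v ` carrier C) (g ` carrier B)" if i: "i < k" for i
    proof (rule bilinear_mapsI)
      fix s a assume "s \<in> v ` carrier C" and a: "a \<in> carrier A"
      then obtain c where c: "c \<in> carrier C" "s = v c" by blast
      have "rsmult ?T (h i \<one>) c = lsmult ?T (v c) (h i \<one>)"
        using i c h_r[of i c \<one>] h_l[of i "v c" \<one>] by simp
      then show "\<sigma> i (s \<otimes> a) = s \<otimes> \<sigma> i a"
        using a c i \<Theta>_r[of a c "h i \<one>"] \<Theta>_l[of a "v c" "h i \<one>"] by (simp add: \<sigma>_def)
    qed (use i in \<open>auto simp: \<sigma>_def \<Theta>_add \<Theta>_base\<close>)
    moreover have "(\<Oplus>i\<in>{..<k}. \<beta> i b \<otimes> \<sigma> i a) = \<epsilon> (b \<otimes> a)"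
      if a: "a \<in> carrier A" and b: "b \<in> carrier A" for a b
    proof -
      have "(\<Oplus>i\<in>{..<k}. \<beta> i b \<otimes> \<sigma> i a) = (\<Oplus>i\<in>{..<k}. \<Theta> a (h i (f i (?pure \<one> b))))"
      proof (rule finsum_cong')
        fix i assume "i \<in> {..<k}"
        then show "\<beta> i b \<otimes> \<sigma> i a = \<Theta> a (h i (f i (?pure \<one> b)))"
          using a b h_l[of i "\<beta> i b" \<one>] by (simp add: \<beta>_def \<sigma>_def \<Theta>_l)
      qed (use a b in auto)
      also have "\<dots> = \<Theta> a (\<Oplus>\<^bsub>?T\<^esub>i\<in>{..<k}. h i (f i (?pure \<one> b)))"
        using a b
        by (intro additive_maps_finsum[OF abelian_group_tensor abelian_group_axioms \<Theta>, symmetric]) auto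
      also have "\<dots> = \<Theta> a (?pure \<one> b)"
        using fh b by simp
      finally show ?thesis
        using a b by (simp add: \<Theta>_pure)
    qed
    ultimately show "depth_three_pairing A (g ` carrier B) (v ` carrier C) \<epsilon> k"
      unfolding depth_three_pairing_def by (intro exI[of _ \<beta>] exI[of _ \<sigma>]) auto
  next
    assume pairing: "depth_three_pairing A (g ` carrier B) (v ` carrier C) \<epsilon> k"
    obtain \<beta> \<sigma> where \<beta>: "\<And>i. i < k \<Longrightarrow> \<beta> i \<in> bilinear_maps A (g ` carrier B) (v ` carrier C)"
      and \<sigma>: "\<And>i. i < k \<Longrightarrow> \<sigma> i \<in> bilinear_maps A (v ` carrier C) (g ` carrier B)"
      and sum: "\<And>a b. a \<in> carrier A \<Longrightarrow> b \<in> carrier A \<Longrightarrow> (\<Oplus>i\<in>{..<k}. \<beta> i b \<otimes> \<sigma> i a) = \<epsilon> (b \<otimes> a)"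
      by (fact depth_three_pairingE[OF pairing])
    note [simp] = bilinear_maps_closed[OF \<beta>] bilinear_maps_closed[OF \<sigma>]
    have "\<exists>\<Psi>. \<Psi> \<in> bimod_hom A C ?T ?Q \<and>
        (\<forall>p\<in>carrier A. \<forall>q\<in>carrier A. \<Psi> (?pure p q) = p \<otimes> \<beta> i q)" if i: "i < k" for i
    proof -
      have balanced: "(\<lambda>p q. p \<otimes> \<beta> i q) \<in> balanced_maps B (ring_bimod A u g) (ring_bimod A g v) ?Q"
        using i by (auto simp: balanced_maps_def hom_def l_distr r_distr m_assoc
            bilinear_maps_add[OF \<beta>] bilinear_maps_left[OF \<beta>])
      show ?thesis
        by (rule tensor_lift_bimod_hom[OF M.additive_bimodule_axioms balanced])
          (use i in \<open>auto simp: m_assoc bilinear_maps_right[OF \<beta>] u_apply\<close>)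
    qed
    then obtain f where f: "\<And>i. i < k \<Longrightarrow> f i \<in> bimod_hom A C ?T ?Q"
      and f_pure: "\<And>i p q. i < k \<Longrightarrow> p \<in> carrier A \<Longrightarrow> q \<in> carrier A \<Longrightarrow> f i (?pure p q) = p \<otimes> \<beta> i q"
      by metis
    define h where "h i a = (\<Oplus>\<^bsub>?T\<^esub>s\<in>{..<r}. ?pure (a \<otimes> \<sigma> i (x s)) (y s))" for i a
    have h: "h i \<in> bimod_hom A C ?Q ?T" if i: "i < k" for i
      unfolding bimod_hom_def
    proof (intro CollectI conjI ballI)
      show "h i \<in> carrier ?Q \<rightarrow> carrier ?T"
        using i by (auto simp: h_def intro!: T.finsum_closed)
    next
      fix a b assume ab: "a \<in> carrier ?Q" "b \<in> carrier ?Q"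
      have "h i (a \<oplus> b) = (\<Oplus>\<^bsub>?T\<^esub>s\<in>{..<r}. ?pure (a \<otimes> \<sigma> i (x s)) (y s) \<oplus>\<^bsub>?T\<^esub> ?pure (b \<otimes> \<sigma> i (x s)) (y s))"
        unfolding h_def using ab i
        by (intro T.finsum_cong') (auto simp: l_distr additive_maps_add[OF pure2])
      also have "\<dots> = h i a \<oplus>\<^bsub>?T\<^esub> h i b"
        unfolding h_def using ab i by (intro T.finsum_addf) auto
      finally show "h i (a \<oplus>\<^bsub>?Q\<^esub> b) = h i a \<oplus>\<^bsub>?T\<^esub> h i b" by simp
    next
      fix a b assume a: "a \<in> carrier A" and b: "b \<in> carrier ?Q"
      have "lsmult ?T a (h i b) = (\<Oplus>\<^bsub>?T\<^esub>s\<in>{..<r}. lsmult ?T a (?pure (b \<otimes> \<sigma> i (x s)) (y s)))"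
        unfolding h_def using a b i
        by (intro additive_maps_finsum[OF abelian_group_tensor abelian_group_tensor T.lsmult_additive]) auto
      also have "\<dots> = h i (a \<otimes> b)"
        unfolding h_def using a b i by (intro T.finsum_cong') (auto simp: pure_l m_assoc)
      finally show "h i (lsmult ?Q a b) = lsmult ?T a (h i b)" by (simp add: u_apply)
    next
      fix a c assume "a \<in> carrier ?Q" and c: "c \<in> carrier C"
      then have a: "a \<in> carrier A" by simp
      have "h i (a \<otimes> v c) = (\<Oplus>\<^bsub>?T\<^esub>s\<in>{..<r}. ?pure (a \<otimes> \<sigma> i (v c \<otimes> x s)) (y s))"
        unfolding h_def using a c i
        by (intro T.finsum_cong') (auto simp: bilinear_maps_left[OF \<sigma>] m_assoc)
      also have "\<dots> = (\<Oplus>\<^bsub>?T\<^esub>s\<in>{..<r}. ?pure (a \<otimes> \<sigma> i (x s)) (y s \<otimes> v c))"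
      proof (rule casimir[OF abelian_group_tensor])
        show "(\<lambda>p. ?pure (a \<otimes> \<sigma> i p) q) \<in> additive_maps A ?T" if "q \<in> carrier A" for q
          using that a i bilinear_maps_additive[OF \<sigma>[OF i]]
          by (intro additive_maps_comp[OF _ pure2] additive_maps_comp[OF _ additive_maps_mult(1)]) auto
        show "?pure (a \<otimes> \<sigma> i (p \<otimes> s)) q = ?pure (a \<otimes> \<sigma> i p) (s \<otimes> q)"
          if "p \<in> carrier A" "s \<in> g ` carrier B" "q \<in> carrier A" for p s q
          using that a i by (auto simp: bilinear_maps_right[OF \<sigma>] simp flip: m_assoc pure3)
        show "?pure (a \<otimes> \<sigma> i p) \<in> additive_maps A ?T" if "p \<in> carrier A" for p
          using that a i by (intro pure1) simp
      qed (use c in simp)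
      also have "\<dots> = (\<Oplus>\<^bsub>?T\<^esub>s\<in>{..<r}. rsmult ?T (?pure (a \<otimes> \<sigma> i (x s)) (y s)) c)"
        using a c i by (intro T.finsum_cong') (auto simp: pure_r intro!: T.rsmult_closed)
      also have "\<dots> = rsmult ?T (h i a) c"
        unfolding h_def using a c i
        by (intro additive_maps_finsum[OF abelian_group_tensor abelian_group_tensor T.rsmult_additive, symmetric])
          auto
      finally show "h i (rsmult ?Q a c) = rsmult ?T (h i a) c" by simp
    qed
    have "(\<Oplus>\<^bsub>?T\<^esub>i\<in>{..<k}. h i (f i S)) = S" if S: "S \<in> carrier ?T" for S
    proof (rule eqI[OF _ _ abelian_group_tensor _ S])
      show "(\<lambda>S. \<Oplus>\<^bsub>?T\<^esub>i\<in>{..<k}. h i (f i S)) \<in> additive_maps ?T ?T"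
      proof (rule T.finsum_additive_maps[OF abelian_group_tensor])
        fix i assume "i \<in> {..<k}"
        then show "(\<lambda>S. h i (f i S)) \<in> additive_maps ?T ?T"
          using f[of i] h[of i] by (intro additive_maps_comp[of "f i" _ ?Q "h i"]) (auto simp: bimod_hom_altdef)
      qed
      show "(\<lambda>S. S) \<in> additive_maps ?T ?T"
        by (auto simp: hom_def)
      fix p q assume p: "p \<in> carrier A" and q: "q \<in> carrier A"
      have "h i (f i (?pure p q)) = (\<Oplus>\<^bsub>?T\<^esub>s\<in>{..<r}. ?pure (p \<otimes> (\<beta> i q \<otimes> \<sigma> i (x s))) (y s))"
        if "i < k" for i
        unfolding h_def using p q that by (intro T.finsum_cong') (auto simp: f_pure m_assoc)
      then have "(\<Oplus>\<^bsub>?T\<^esub>i\<in>{..<k}. h i (f i (?pure p q)))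
          = (\<Oplus>\<^bsub>?T\<^esub>i\<in>{..<k}. \<Oplus>\<^bsub>?T\<^esub>s\<in>{..<r}. ?pure (p \<otimes> (\<beta> i q \<otimes> \<sigma> i (x s))) (y s))"
        using p q by (intro T.finsum_cong') (auto intro!: T.finsum_closed)
      also have "\<dots> = (\<Oplus>\<^bsub>?T\<^esub>s\<in>{..<r}. \<Oplus>\<^bsub>?T\<^esub>i\<in>{..<k}. ?pure (p \<otimes> (\<beta> i q \<otimes> \<sigma> i (x s))) (y s))"
        using p q by (intro T.finsum_swap) auto
      also have "\<dots> = (\<Oplus>\<^bsub>?T\<^esub>s\<in>{..<r}. ?pure p (\<epsilon> (q \<otimes> x s) \<otimes> y s))"
      proof (rule T.finsum_cong')
        fix s assume s: "s \<in> {..<r}"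
        have "(\<Oplus>\<^bsub>?T\<^esub>i\<in>{..<k}. ?pure (p \<otimes> (\<beta> i q \<otimes> \<sigma> i (x s))) (y s))
            = ?pure (p \<otimes> (\<Oplus>i\<in>{..<k}. \<beta> i q \<otimes> \<sigma> i (x s))) (y s)"
          using s p q
          by (intro additive_maps_finsum[OF abelian_group_axioms abelian_group_tensor, symmetric]
              additive_maps_comp[OF _ pure2] additive_maps_mult) auto
        also have "\<dots> = ?pure (p \<otimes> \<epsilon> (q \<otimes> x s)) (y s)"
          using s q by (simp add: sum)
        also have "\<dots> = ?pure p (\<epsilon> (q \<otimes> x s) \<otimes> y s)"
          using eps_base[of "q \<otimes> x s"] s p q by (auto simp: pure3)
        finally show "(\<Oplus>\<^bsub>?T\<^esub>i\<in>{..<k}. ?pure (p \<otimes> (\<beta> i q \<otimes> \<sigma> i (x s))) (y s))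
            = ?pure p (\<epsilon> (q \<otimes> x s) \<otimes> y s)" .
      qed (use p q in auto)
      also have "\<dots> = ?pure p (\<Oplus>s\<in>{..<r}. \<epsilon> (q \<otimes> x s) \<otimes> y s)"
        using p q
        by (intro additive_maps_finsum[OF abelian_group_axioms abelian_group_tensor pure1, symmetric]) auto
      finally show "(\<Oplus>\<^bsub>?T\<^esub>i\<in>{..<k}. h i (f i (?pure p q))) = ?pure p q"
        using q by (simp add: left_basis)
    qed
    with f h show "\<exists>f h. (\<forall>i<k. f i \<in> bimod_hom A C ?T ?Q \<and> h i \<in> bimod_hom A C ?Q ?T) \<and>
        (\<forall>p\<in>carrier ?T. (\<Oplus>\<^bsub>?T\<^esub>i\<in>{..<k}. h i (f i p)) = p)"
      by (intro exI[of _ f] exI[of _ h]) auto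
  qed
qed


section \<open>Opposite rings\<close>

definition opposite :: "'a ring \<Rightarrow> 'a ring" where
  "opposite A = A\<lparr>monoid.mult := \<lambda>a b. b \<otimes>\<^bsub>A\<^esub> a\<rparr>"

definition flip_bimodule :: "('a, 'c, 'p) bimodule \<Rightarrow> ('c, 'a, 'p) bimodule" where
  "flip_bimodule P =
     \<lparr>carrier = carrier P, monoid.mult = monoid.mult P, one = \<one>\<^bsub>P\<^esub>,
      ring.zero = \<zero>\<^bsub>P\<^esub>, ring.add = ring.add P,
      lsmult = (\<lambda>c p. rsmult P p c), rsmult = (\<lambda>p a. lsmult P a p)\<rparr>"

lemma opposite_simps [simp]:
  "carrier (opposite A) = carrier A"
  "a \<otimes>\<^bsub>opposite A\<^esub> b = b \<otimes>\<^bsub>A\<^esub> a"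
  "\<one>\<^bsub>opposite A\<^esub> = \<one>\<^bsub>A\<^esub>"
  "\<zero>\<^bsub>opposite A\<^esub> = \<zero>\<^bsub>A\<^esub>"
  "ring.add (opposite A) = ring.add A"
  by (simp_all add: opposite_def)

lemma finsum_opposite [simp]: "finsum (opposite A) f I = finsum A f I"
  by (simp add: finsum_def finprod_def)

lemma flip_bimodule_simps [simp]:
  "carrier (flip_bimodule P) = carrier P"
  "\<zero>\<^bsub>flip_bimodule P\<^esub> = \<zero>\<^bsub>P\<^esub>"
  "ring.add (flip_bimodule P) = ring.add P"
  "lsmult (flip_bimodule P) c p = rsmult P p c"
  "rsmult (flip_bimodule P) p a = lsmult P a p"
  by (simp_all add: flip_bimodule_def)

lemma flip_flip_bimodule [simp]: "flip_bimodule (flip_bimodule P) = P"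
  by (simp add: flip_bimodule_def)

lemma flip_ring_bimod: "flip_bimodule (ring_bimod A u v) = ring_bimod (opposite A) v u"
  by (simp add: flip_bimodule_def ring_bimod_def)

lemma flip_bimod_power: "flip_bimodule (bimod_power P k) = bimod_power (flip_bimodule P) k"
  by (simp add: flip_bimodule_def bimod_power_def)

lemma ring_opposite:
  assumes "ring A"
  shows "ring (opposite A)"
proof -
  interpret ring A by fact
  show ?thesis
    by (rule ringI)
      (auto intro!: abelian_groupI monoidI bexI[of _ "\<ominus>\<^bsub>A\<^esub> x" for x] simp: a_ac l_neg r_neg m_assoc l_distr r_distr)
qed

lemma bimod_hom_flip:
  "bimod_hom C A (flip_bimodule P) (flip_bimodule Q) = bimod_hom A C P Q"
  by (auto simp: bimod_hom_def)

lemma additive_bimodule_flip: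
  assumes "additive_bimodule A C P"
  shows "additive_bimodule C A (flip_bimodule P)"
proof -
  interpret additive_bimodule A C P by fact
  have "abelian_group (flip_bimodule P)"
    by (rule abelian_groupI) (auto simp: a_ac l_neg intro!: bexI[of _ "\<ominus>\<^bsub>P\<^esub> x" for x])
  then show ?thesis
    by (intro additive_bimodule.intro additive_bimodule_axioms.intro additive_mapsI)
      (auto simp: lsmult_closed rsmult_closed lsmult_add rsmult_add smult_assoc)
qed

lemma iso_to_direct_summand_flip:
  assumes "additive_bimodule A C P" "additive_bimodule A C Q"
  shows "iso_to_direct_summand C A (flip_bimodule P) (flip_bimodule Q) \<longleftrightarrow>
    iso_to_direct_summand A C P Q"
  using assms
  by (simp add: iso_to_direct_summand_iff_retract additive_bimodule_flip bimod_hom_flip)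

lemma iso_to_direct_summand_retract:
  assumes P: "additive_bimodule A C P" and P': "additive_bimodule A C P'" and Q: "additive_bimodule A C Q"
    and f: "f \<in> bimod_hom A C P P'" and g: "g \<in> bimod_hom A C P' P"
    and gf: "\<And>p. p \<in> carrier P \<Longrightarrow> g (f p) = p"
    and summand: "iso_to_direct_summand A C P' Q"
  shows "iso_to_direct_summand A C P Q"
proof -
  obtain f' g' where f': "f' \<in> bimod_hom A C P' Q" and g': "g' \<in> bimod_hom A C Q P'"
    and "\<forall>p\<in>carrier P'. g' (f' p) = p"
    using summand unfolding iso_to_direct_summand_iff_retract[OF P' Q] by blast
  moreover have "f p \<in> carrier P'" if "p \<in> carrier P" for p
    using f that by (auto simp: bimod_hom_def)
  ultimately have "\<forall>p\<in>carrier P. (g \<circ> g') ((f' \<circ> f) p) = p"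
    using gf by simp
  then show ?thesis
    unfolding iso_to_direct_summand_iff_retract[OF P Q]
    using bimod_hom_comp[OF f f'] bimod_hom_comp[OF g' g] by blast
qed

lemma (in tensor_product) tensor_product_flip:
  "tensor_product C B A (flip_bimodule Q) (flip_bimodule P)"
  by (intro tensor_product.intro additive_bimodule_flip P.additive_bimodule_axioms
      Q.additive_bimodule_axioms)

lemma (in tensor_product) tensor_swap:
  obtains \<chi> where "\<chi> \<in> bimod_hom A C T (flip_bimodule (tensor B (flip_bimodule Q) (flip_bimodule P)))"
    and "\<And>p q. p \<in> carrier P \<Longrightarrow> q \<in> carrier Q \<Longrightarrow>
      \<chi> (pure p q) = pure_tensor B (flip_bimodule Q) (flip_bimodule P) q p"
proof -
  interpret op: tensor_product C B A "flip_bimodule Q" "flip_bimodule P"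
    by (rule tensor_product_flip)
  have "(\<lambda>p q. pure_tensor B (flip_bimodule Q) (flip_bimodule P) q p)
      \<in> balanced_maps B P Q (flip_bimodule (tensor B (flip_bimodule Q) (flip_bimodule P)))"
    using op.pure_balanced by (auto simp: balanced_maps_def hom_def)
  then show thesis
    by (rule tensor_lift_bimod_hom[OF additive_bimodule_flip[OF op.additive_bimodule_tensor]])
      (simp_all add: op.lsmult_tensor op.rsmult_tensor that)
qed

text \<open>Swapping the factors twice gives the identity, so the swap is an isomorphism.\<close>

lemma (in tensor_product) iso_to_direct_summand_swap:
  assumes M: "additive_bimodule A C M"
  shows "iso_to_direct_summand A C T M \<longleftrightarrow>
    iso_to_direct_summand C A (tensor B (flip_bimodule Q) (flip_bimodule P)) (flip_bimodule M)"
proof -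
  interpret op: tensor_product C B A "flip_bimodule Q" "flip_bimodule P"
    by (rule tensor_product_flip)
  let ?T' = "tensor B (flip_bimodule Q) (flip_bimodule P)"
  obtain \<chi> where \<chi>: "\<chi> \<in> bimod_hom A C T (flip_bimodule ?T')"
    and \<chi>_pure: "\<And>p q. p \<in> carrier P \<Longrightarrow> q \<in> carrier Q \<Longrightarrow>
      \<chi> (pure p q) = pure_tensor B (flip_bimodule Q) (flip_bimodule P) q p"
    by (fact tensor_swap)
  obtain \<chi>' where \<chi>': "\<chi>' \<in> bimod_hom C A ?T' (flip_bimodule T)"
    and \<chi>'_pure: "\<And>q p. q \<in> carrier Q \<Longrightarrow> p \<in> carrier P \<Longrightarrow>
      \<chi>' (pure_tensor B (flip_bimodule Q) (flip_bimodule P) q p) = pure p q"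
    by (fact op.tensor_swap[unfolded flip_flip_bimodule flip_bimodule_simps])
  have \<chi>'': "\<chi>' \<in> bimod_hom A C (flip_bimodule ?T') T"
    using \<chi>' bimod_hom_flip[of A C ?T' "flip_bimodule T"] by simp
  have T: "additive_bimodule A C T" and T': "additive_bimodule C A ?T'"
    by (rule additive_bimodule_tensor) (rule op.additive_bimodule_tensor)
  have inv: "\<chi>' (\<chi> S) = S" if "S \<in> carrier T" for S
  proof (rule tensor_maps_eqI[OF abelian_group_tensor _ _ _ that])
    show "(\<lambda>S. \<chi>' (\<chi> S)) \<in> additive_maps T T"
      using \<chi> \<chi>' by (auto simp: bimod_hom_def hom_def Pi_iff)
    show "(\<lambda>S. S) \<in> additive_maps T T"
      by (auto simp: hom_def)
  qed (simp add: \<chi>_pure \<chi>'_pure)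
  have inv': "\<chi> (\<chi>' S) = S" if "S \<in> carrier ?T'" for S
  proof (rule op.tensor_maps_eqI[OF op.abelian_group_tensor _ _ _ that])
    show "(\<lambda>S. \<chi> (\<chi>' S)) \<in> additive_maps ?T' ?T'"
      using \<chi> \<chi>' by (auto simp: bimod_hom_def hom_def Pi_iff)
    show "(\<lambda>S. S) \<in> additive_maps ?T' ?T'"
      by (auto simp: hom_def)
  qed (simp add: \<chi>_pure \<chi>'_pure)
  have "iso_to_direct_summand A C T M \<longleftrightarrow> iso_to_direct_summand A C (flip_bimodule ?T') M"
    using iso_to_direct_summand_retract[OF T additive_bimodule_flip[OF T'] M \<chi> \<chi>'' inv]
      iso_to_direct_summand_retract[OF additive_bimodule_flip[OF T'] T M \<chi>'' \<chi>] inv'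
    by auto
  also have "\<dots> \<longleftrightarrow> iso_to_direct_summand C A ?T' (flip_bimodule M)"
    using iso_to_direct_summand_flip[OF T' additive_bimodule_flip[OF M]] by simp
  finally show ?thesis .
qed

lemma bilinear_maps_opposite: "bilinear_maps (opposite A) Y U = bilinear_maps A U Y"
  by (auto simp: bilinear_maps_def hom_def)

lemma depth_three_pairing_opposite:
  "depth_three_pairing (opposite A) U Y \<epsilon> k \<longleftrightarrow> depth_three_pairing A U Y \<epsilon> k"
proof -
  have *: "depth_three_pairing (opposite A') U Y \<epsilon> k" if pairing: "depth_three_pairing A' U Y \<epsilon> k" for A'
  proof -
    obtain \<beta> \<sigma> where "\<And>i. i < k \<Longrightarrow> \<beta> i \<in> bilinear_maps A' U Y" "\<And>i. i < k \<Longrightarrow> \<sigma> i \<in> bilinear_maps A' Y U"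
      and "\<And>a b. a \<in> carrier A' \<Longrightarrow> b \<in> carrier A' \<Longrightarrow>
        (\<Oplus>\<^bsub>A'\<^esub>i\<in>{..<k}. \<beta> i b \<otimes>\<^bsub>A'\<^esub> \<sigma> i a) = \<epsilon> (b \<otimes>\<^bsub>A'\<^esub> a)"
      by (fact depth_three_pairingE[OF pairing])
    then show ?thesis
      unfolding depth_three_pairing_def bilinear_maps_opposite
      by (intro exI[of _ \<sigma>] exI[of _ \<beta>]) simp
  qed
  have "opposite (opposite A) = A"
    by (simp add: opposite_def)
  with *[of A] *[of "opposite A"] show ?thesis by auto
qed

lemma (in frobenius_system) frobenius_system_opposite:
  "frobenius_system (opposite A) U \<epsilon> r y x"
proof -
  have "\<epsilon> \<in> bilinear_maps (opposite A) U U"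
    using eps_bilinear by (simp add: bilinear_maps_opposite)
  then show ?thesis
    using base_subset eps_base x_closed y_closed left_basis right_basis
    by (intro frobenius_system.intro frobenius_system_axioms.intro ring_opposite ring_axioms) simp_all
qed

text \<open>Over the opposite ring, after interchanging the two tensor factors, the left condition becomes the
  right one, while the pairing condition keeps its form.\<close>

lemma left_tensor_summand_iff_pairing:
  fixes A :: "'a ring" (structure) and B :: "'b ring" and C :: "'c ring"
  assumes frobenius: "frobenius_system A (g ` carrier B) \<epsilon> r x y"
    and v: "v \<in> carrier C \<rightarrow> carrier A"
  shows "iso_to_direct_summand C A (tensor B (ring_bimod A v g) (ring_bimod A g id))
      (bimod_power (ring_bimod A v id) k) \<longleftrightarrow>
    depth_three_pairing A (g ` carrier B) (v ` carrier C) \<epsilon> k"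
proof -
  interpret frobenius_system A "g ` carrier B" \<epsilon> r x y by fact
  have g: "g \<in> carrier B \<rightarrow> carrier A"
    using base_subset by auto
  have id: "id \<in> carrier A \<rightarrow> carrier A"
    by simp
  interpret tensor_product C B A "ring_bimod A v g" "ring_bimod A g id"
    by (intro tensor_product.intro additive_bimodule_ring_bimod ring_axioms g v id)
  interpret M: additive_bimodule C A "ring_bimod A v id"
    by (intro additive_bimodule_ring_bimod ring_axioms v id)
  have same_carrier: "iso_to_direct_summand A C = iso_to_direct_summand (opposite A) C"
    by (intro ext) (simp add: iso_to_direct_summand_def subbimodule_def bimod_iso_def bimod_hom_def)
  have "iso_to_direct_summand C A (tensor B (ring_bimod A v g) (ring_bimod A g id))
      (bimod_power (ring_bimod A v id) k)
    \<longleftrightarrow> iso_to_direct_summand (opposite A) C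
      (tensor B (ring_bimod (opposite A) id g) (ring_bimod (opposite A) g v))
      (bimod_power (ring_bimod (opposite A) id v) k)"
    unfolding iso_to_direct_summand_swap[OF M.additive_bimodule_power]
    by (simp add: flip_ring_bimod flip_bimod_power same_carrier)
  also have "\<dots> \<longleftrightarrow> depth_three_pairing (opposite A) (g ` carrier B) (v ` carrier C) \<epsilon> k"
    using v by (intro right_tensor_summand_iff_pairing[OF frobenius_system_opposite]) simp
  finally show ?thesis
    by (simp add: depth_three_pairing_opposite)
qed


section \<open>Frobenius homomorphisms and the basic construction\<close>

locale frobenius_data = N: ring N + M: ring M
  for N :: "'n ring" and M :: "'m ring" and \<iota> :: "'n \<Rightarrow> 'm" and E :: "'m \<Rightarrow> 'n"
    and r :: nat and x y :: "nat \<Rightarrow> 'm" +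
  assumes hom: "\<iota> \<in> ring_hom N M"
    and E_closed: "a \<in> carrier M \<Longrightarrow> E a \<in> carrier N"
    and E_add: "a \<in> carrier M \<Longrightarrow> b \<in> carrier M \<Longrightarrow> E (a \<oplus>\<^bsub>M\<^esub> b) = E a \<oplus>\<^bsub>N\<^esub> E b"
    and E_left: "n \<in> carrier N \<Longrightarrow> a \<in> carrier M \<Longrightarrow> E (\<iota> n \<otimes>\<^bsub>M\<^esub> a) = n \<otimes>\<^bsub>N\<^esub> E a"
    and E_right: "n \<in> carrier N \<Longrightarrow> a \<in> carrier M \<Longrightarrow> E (a \<otimes>\<^bsub>M\<^esub> \<iota> n) = E a \<otimes>\<^bsub>N\<^esub> n"
    and x_closed: "s < r \<Longrightarrow> x s \<in> carrier M"
    and y_closed: "s < r \<Longrightarrow> y s \<in> carrier M"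
    and left_basis: "a \<in> carrier M \<Longrightarrow> (\<Oplus>\<^bsub>M\<^esub>s\<in>{..<r}. \<iota> (E (a \<otimes>\<^bsub>M\<^esub> x s)) \<otimes>\<^bsub>M\<^esub> y s) = a"
    and right_basis: "a \<in> carrier M \<Longrightarrow> (\<Oplus>\<^bsub>M\<^esub>s\<in>{..<r}. x s \<otimes>\<^bsub>M\<^esub> \<iota> (E (y s \<otimes>\<^bsub>M\<^esub> a))) = a"

definition frobenius_hom :: "'n ring \<Rightarrow> 'm ring \<Rightarrow> ('n \<Rightarrow> 'm) \<Rightarrow> ('m \<Rightarrow> 'n) \<Rightarrow> bool" where
  "frobenius_hom N M \<iota> E \<longleftrightarrow> (\<exists>r x y. frobenius_data N M \<iota> E r x y)"

lemma frobenius_extension_iff: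
  "frobenius_extension N M \<iota> \<longleftrightarrow> (\<exists>E. frobenius_hom N M \<iota> E)"
proof
  assume "frobenius_extension N M \<iota>"
  then have ext: "ring_extension N M \<iota>"
    and ex: "\<exists>E\<in>bimod_hom N N (ring_bimod M \<iota> \<iota>) (ring_bimod N id id). \<exists>(r::nat) x y.
      x \<in> {..<r} \<rightarrow> carrier M \<and> y \<in> {..<r} \<rightarrow> carrier M \<and>
      (\<forall>a\<in>carrier M. (\<Oplus>\<^bsub>M\<^esub>i\<in>{..<r}. \<iota> (E (a \<otimes>\<^bsub>M\<^esub> x i)) \<otimes>\<^bsub>M\<^esub> y i) = a \<and>
        (\<Oplus>\<^bsub>M\<^esub>i\<in>{..<r}. x i \<otimes>\<^bsub>M\<^esub> \<iota> (E (y i \<otimes>\<^bsub>M\<^esub> a))) = a)"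
    by (simp_all add: frobenius_extension_def)
  obtain E and r :: nat and x y where E: "E \<in> bimod_hom N N (ring_bimod M \<iota> \<iota>) (ring_bimod N id id)"
    and basis: "x \<in> {..<r} \<rightarrow> carrier M \<and> y \<in> {..<r} \<rightarrow> carrier M \<and>
      (\<forall>a\<in>carrier M. (\<Oplus>\<^bsub>M\<^esub>i\<in>{..<r}. \<iota> (E (a \<otimes>\<^bsub>M\<^esub> x i)) \<otimes>\<^bsub>M\<^esub> y i) = a \<and>
        (\<Oplus>\<^bsub>M\<^esub>i\<in>{..<r}. x i \<otimes>\<^bsub>M\<^esub> \<iota> (E (y i \<otimes>\<^bsub>M\<^esub> a))) = a)"
    using ex by (elim bexE exE) (rule that)
  with ext have "frobenius_data N M \<iota> E r x y"
    by (intro frobenius_data.intro frobenius_data_axioms.intro)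
      (auto simp: ring_extension_def bimod_hom_def)
  then show "\<exists>E. frobenius_hom N M \<iota> E"
    unfolding frobenius_hom_def by (intro exI)
next
  assume "\<exists>E. frobenius_hom N M \<iota> E"
  then obtain E r x y where "frobenius_data N M \<iota> E r x y"
    unfolding frobenius_hom_def by (elim exE) (rule that)
  then interpret frobenius_data N M \<iota> E r x y .
  have "E \<in> bimod_hom N N (ring_bimod M \<iota> \<iota>) (ring_bimod N id id)"
    by (auto simp: bimod_hom_def E_closed E_add E_left E_right)
  moreover have "x \<in> {..<r} \<rightarrow> carrier M" "y \<in> {..<r} \<rightarrow> carrier M"
    using x_closed y_closed by auto
  ultimately show "frobenius_extension N M \<iota>"
    unfolding frobenius_extension_def ring_extension_def
    using N.ring_axioms M.ring_axioms hom left_basis right_basis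
    by (intro conjI bexI[of _ E] exI[of _ r] exI[of _ x] exI[of _ y]) simp_all
qed

lemma ring_hom_additive: "f \<in> ring_hom N M \<Longrightarrow> f \<in> additive_maps N M"
  by (auto simp: ring_hom_def hom_def)

context frobenius_data
begin

lemmas \<iota>_closed = ring_hom_closed[OF hom]
lemmas \<iota>_additive = ring_hom_additive[OF hom]

sublocale frobenius_system M "\<iota> ` carrier N" "\<lambda>a. \<iota> (E a)" r x y
proof (intro frobenius_system.intro frobenius_system_axioms.intro M.ring_axioms)
  show "(\<lambda>a. \<iota> (E a)) \<in> bilinear_maps M (\<iota> ` carrier N) (\<iota> ` carrier N)"
    by (rule bilinear_mapsI)
      (auto simp: \<iota>_closed E_closed E_add E_left E_right ring_hom_add[OF hom] ring_hom_mult[OF hom])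
qed (auto simp: \<iota>_closed E_closed x_closed y_closed left_basis right_basis)

end

text \<open>The dual bases of a composite consist of the products of those of the two steps.\<close>

lemma frobenius_hom_trans:
  fixes N :: "'n ring" and M :: "'m ring" and L :: "'l ring"
  assumes "frobenius_hom N M \<iota> E" and "frobenius_hom M L \<kappa> F"
  shows "frobenius_hom N L (\<kappa> \<circ> \<iota>) (E \<circ> F)"
proof -
  obtain r x y where "frobenius_data N M \<iota> E r x y"
    using assms(1) unfolding frobenius_hom_def by (elim exE) (rule that)
  then interpret NM: frobenius_data N M \<iota> E r x y .
  obtain q u w where "frobenius_data M L \<kappa> F q u w"
    using assms(2) unfolding frobenius_hom_def by (elim exE) (rule that)
  then interpret LM: frobenius_data M L \<kappa> F q u w .
  note [simp] = NM.x_closed NM.y_closed LM.x_closed LM.y_closed NM.E_closed LM.E_closed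
    NM.\<iota>_closed LM.\<iota>_closed ring_hom_mult[OF NM.hom] ring_hom_mult[OF LM.hom]
  have bound: "i div r < q" "i mod r < r" if "i < q * r" for i
  proof -
    have "0 < r" using that by (cases r) auto
    with that show "i div r < q" "i mod r < r"
      by (auto simp: less_mult_imp_div_less)
  qed
  have "frobenius_data N L (\<kappa> \<circ> \<iota>) (E \<circ> F) (q * r)
    (\<lambda>i. u (i div r) \<otimes>\<^bsub>L\<^esub> \<kappa> (x (i mod r))) (\<lambda>i. \<kappa> (y (i mod r)) \<otimes>\<^bsub>L\<^esub> w (i div r))"
  proof (intro frobenius_data.intro frobenius_data_axioms.intro NM.N.ring_axioms LM.M.ring_axioms)
    show "\<kappa> \<circ> \<iota> \<in> ring_hom N L"
      by (rule ring_hom_trans[OF NM.hom LM.hom])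
  next
    fix a assume a: "a \<in> carrier L"
    let ?f = "\<lambda>i j. \<kappa> (\<iota> (E (F (a \<otimes>\<^bsub>L\<^esub> (u i \<otimes>\<^bsub>L\<^esub> \<kappa> (x j)))))) \<otimes>\<^bsub>L\<^esub> (\<kappa> (y j) \<otimes>\<^bsub>L\<^esub> w i)"
    have f: "?f i j = \<kappa> (\<iota> (E (F (a \<otimes>\<^bsub>L\<^esub> u i) \<otimes>\<^bsub>M\<^esub> x j)) \<otimes>\<^bsub>M\<^esub> y j) \<otimes>\<^bsub>L\<^esub> w i" if "i < q" "j < r" for i j
      using that a LM.E_right[of "x j" "a \<otimes>\<^bsub>L\<^esub> u i"] by (simp add: LM.M.m_assoc)
    have "(\<Oplus>\<^bsub>L\<^esub>i\<in>{..<q * r}. ?f (i div r) (i mod r)) = (\<Oplus>\<^bsub>L\<^esub>i\<in>{..<q}. \<Oplus>\<^bsub>L\<^esub>j\<in>{..<r}. ?f i j)"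
      using a by (intro LM.M.finsum_div_mod) simp
    also have "\<dots> = (\<Oplus>\<^bsub>L\<^esub>i\<in>{..<q}. \<kappa> (F (a \<otimes>\<^bsub>L\<^esub> u i)) \<otimes>\<^bsub>L\<^esub> w i)"
    proof (rule LM.M.finsum_cong')
      fix i assume i: "i \<in> {..<q}"
      have "(\<Oplus>\<^bsub>L\<^esub>j\<in>{..<r}. ?f i j)
          = (\<Oplus>\<^bsub>L\<^esub>j\<in>{..<r}. \<kappa> (\<iota> (E (F (a \<otimes>\<^bsub>L\<^esub> u i) \<otimes>\<^bsub>M\<^esub> x j)) \<otimes>\<^bsub>M\<^esub> y j) \<otimes>\<^bsub>L\<^esub> w i)"
        using i a by (intro LM.M.finsum_cong') (simp_all only: f lessThan_iff, auto)
      also have "\<dots> = \<kappa> (\<Oplus>\<^bsub>M\<^esub>j\<in>{..<r}. \<iota> (E (F (a \<otimes>\<^bsub>L\<^esub> u i) \<otimes>\<^bsub>M\<^esub> x j)) \<otimes>\<^bsub>M\<^esub> y j) \<otimes>\<^bsub>L\<^esub> w i"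
        using i a
        by (intro additive_maps_finsum[OF NM.M.abelian_group_axioms LM.M.abelian_group_axioms, symmetric]
            additive_maps_comp[OF LM.\<iota>_additive LM.M.additive_maps_mult(2)]) auto
      also have "\<dots> = \<kappa> (F (a \<otimes>\<^bsub>L\<^esub> u i)) \<otimes>\<^bsub>L\<^esub> w i"
        using i a by (simp only: NM.left_basis LM.E_closed LM.M.m_closed LM.x_closed lessThan_iff)
      finally show "(\<Oplus>\<^bsub>L\<^esub>j\<in>{..<r}. ?f i j) = \<kappa> (F (a \<otimes>\<^bsub>L\<^esub> u i)) \<otimes>\<^bsub>L\<^esub> w i" .
    qed (use a in auto)
    finally show "(\<Oplus>\<^bsub>L\<^esub>i\<in>{..<q * r}. (\<kappa> \<circ> \<iota>) ((E \<circ> F) (a \<otimes>\<^bsub>L\<^esub> (u (i div r) \<otimes>\<^bsub>L\<^esub> \<kappa> (x (i mod r))))) \<otimes>\<^bsub>L\<^esub>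
        (\<kappa> (y (i mod r)) \<otimes>\<^bsub>L\<^esub> w (i div r))) = a"
      using a LM.left_basis by simp
    let ?g = "\<lambda>i j. (u i \<otimes>\<^bsub>L\<^esub> \<kappa> (x j)) \<otimes>\<^bsub>L\<^esub> \<kappa> (\<iota> (E (F ((\<kappa> (y j) \<otimes>\<^bsub>L\<^esub> w i) \<otimes>\<^bsub>L\<^esub> a))))"
    have g: "?g i j = u i \<otimes>\<^bsub>L\<^esub> \<kappa> (x j \<otimes>\<^bsub>M\<^esub> \<iota> (E (y j \<otimes>\<^bsub>M\<^esub> F (w i \<otimes>\<^bsub>L\<^esub> a))))" if "i < q" "j < r" for i j
      using that a LM.E_left[of "y j" "w i \<otimes>\<^bsub>L\<^esub> a"] by (simp add: LM.M.m_assoc)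
    have "(\<Oplus>\<^bsub>L\<^esub>i\<in>{..<q * r}. ?g (i div r) (i mod r)) = (\<Oplus>\<^bsub>L\<^esub>i\<in>{..<q}. \<Oplus>\<^bsub>L\<^esub>j\<in>{..<r}. ?g i j)"
      using a by (intro LM.M.finsum_div_mod) simp
    also have "\<dots> = (\<Oplus>\<^bsub>L\<^esub>i\<in>{..<q}. u i \<otimes>\<^bsub>L\<^esub> \<kappa> (F (w i \<otimes>\<^bsub>L\<^esub> a)))"
    proof (rule LM.M.finsum_cong')
      fix i assume i: "i \<in> {..<q}"
      have "(\<Oplus>\<^bsub>L\<^esub>j\<in>{..<r}. ?g i j)
          = (\<Oplus>\<^bsub>L\<^esub>j\<in>{..<r}. u i \<otimes>\<^bsub>L\<^esub> \<kappa> (x j \<otimes>\<^bsub>M\<^esub> \<iota> (E (y j \<otimes>\<^bsub>M\<^esub> F (w i \<otimes>\<^bsub>L\<^esub> a)))))"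
        using i a by (intro LM.M.finsum_cong') (simp_all only: g lessThan_iff, auto)
      also have "\<dots> = u i \<otimes>\<^bsub>L\<^esub> \<kappa> (\<Oplus>\<^bsub>M\<^esub>j\<in>{..<r}. x j \<otimes>\<^bsub>M\<^esub> \<iota> (E (y j \<otimes>\<^bsub>M\<^esub> F (w i \<otimes>\<^bsub>L\<^esub> a))))"
        using i a
        by (intro additive_maps_finsum[OF NM.M.abelian_group_axioms LM.M.abelian_group_axioms, symmetric]
            additive_maps_comp[OF LM.\<iota>_additive LM.M.additive_maps_mult(1)]) auto
      also have "\<dots> = u i \<otimes>\<^bsub>L\<^esub> \<kappa> (F (w i \<otimes>\<^bsub>L\<^esub> a))"
        using i a by (simp only: NM.right_basis LM.E_closed LM.M.m_closed LM.y_closed lessThan_iff)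
      finally show "(\<Oplus>\<^bsub>L\<^esub>j\<in>{..<r}. ?g i j) = u i \<otimes>\<^bsub>L\<^esub> \<kappa> (F (w i \<otimes>\<^bsub>L\<^esub> a))" .
    qed (use a in auto)
    finally show "(\<Oplus>\<^bsub>L\<^esub>i\<in>{..<q * r}. (u (i div r) \<otimes>\<^bsub>L\<^esub> \<kappa> (x (i mod r))) \<otimes>\<^bsub>L\<^esub>
        (\<kappa> \<circ> \<iota>) ((E \<circ> F) ((\<kappa> (y (i mod r)) \<otimes>\<^bsub>L\<^esub> w (i div r)) \<otimes>\<^bsub>L\<^esub> a))) = a"
      using a LM.right_basis by simp
  qed (auto simp: bound NM.E_add LM.E_add NM.E_left NM.E_right LM.E_left LM.E_right)
  then show ?thesis
    unfolding frobenius_hom_def by (intro exI)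
qed

text \<open>If \<open>E'\<close> is left linear over \<open>M\<close>, the last two relations give \<open>E'(e a e) = E(a)\<close>.\<close>

definition jones_projection ::
  "'n ring \<Rightarrow> 'm ring \<Rightarrow> 'p ring \<Rightarrow> ('n \<Rightarrow> 'm) \<Rightarrow> ('m \<Rightarrow> 'p) \<Rightarrow> ('m \<Rightarrow> 'n) \<Rightarrow> ('p \<Rightarrow> 'm) \<Rightarrow> 'p \<Rightarrow> bool" where
  "jones_projection N M P \<iota> \<kappa> E E' e \<longleftrightarrow> e \<in> carrier P \<and>
     (\<forall>n\<in>carrier N. e \<otimes>\<^bsub>P\<^esub> \<kappa> (\<iota> n) = \<kappa> (\<iota> n) \<otimes>\<^bsub>P\<^esub> e) \<and>
     (\<forall>a\<in>carrier M. e \<otimes>\<^bsub>P\<^esub> \<kappa> a \<otimes>\<^bsub>P\<^esub> e = \<kappa> (\<iota> (E a)) \<otimes>\<^bsub>P\<^esub> e) \<and> E' e = \<one>\<^bsub>M\<^esub>"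

text \<open>Every endomorphism \<open>\<phi>\<close> is \<open>\<Sum> \<phi>(x\<^sub>s) e y\<^sub>s\<close>, where \<open>e\<close> is the Frobenius homomorphism \<open>E\<close> seen as an
  endomorphism of \<open>M\<close>. Hence the endomorphism ring is \<open>M e M\<close>, which is \<open>M \<otimes>\<^sub>N M\<close>, and multiplication
  \<open>a e b \<mapsto> a b\<close> is a Frobenius homomorphism \<open>E'\<close> with dual bases \<open>x\<^sub>s e\<close> and \<open>e y\<^sub>s\<close>.\<close>

lemma (in frobenius_data) basic_construction:
  fixes P :: "'p ring"
  assumes ext: "ring_extension M P \<kappa>"
    and iso: "\<Phi> \<in> ring_iso P (right_End N M \<iota>)"
    and \<Phi>_\<kappa>: "\<And>a. a \<in> carrier M \<Longrightarrow> \<Phi> (\<kappa> a) = (\<lambda>b\<in>carrier M. a \<otimes>\<^bsub>M\<^esub> b)"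
  shows "\<exists>E' e. frobenius_hom M P \<kappa> E' \<and> jones_projection N M P \<iota> \<kappa> E E' e"
proof -
  interpret P: ring P using ext by (simp add: ring_extension_def)
  have \<kappa>: "\<kappa> \<in> ring_hom M P" using ext by (simp add: ring_extension_def)
  have \<kappa>_closed [simp]: "\<kappa> a \<in> carrier P" if "a \<in> carrier M" for a
    using that by (rule ring_hom_closed[OF \<kappa>])
  have \<Phi>_hom: "\<Phi> \<in> ring_hom P (right_End N M \<iota>)"
    and \<Phi>_bij: "bij_betw \<Phi> (carrier P) (carrier (right_End N M \<iota>))"
    using iso by (auto simp: ring_iso_def)
  note [simp] = x_closed y_closed E_closed \<iota>_closed
  have \<Phi>_closed: "\<Phi> \<phi> \<in> carrier (right_End N M \<iota>)" if "\<phi> \<in> carrier P" for \<phi>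
    using ring_hom_closed[OF \<Phi>_hom that] .
  have act_closed [simp]: "\<Phi> \<phi> a \<in> carrier M" if "\<phi> \<in> carrier P" "a \<in> carrier M" for \<phi> a
    using \<Phi>_closed[OF that(1)] that(2) by (auto simp: right_End_def)
  have act_additive: "\<Phi> \<phi> \<in> additive_maps M M" if "\<phi> \<in> carrier P" for \<phi>
    using \<Phi>_closed[OF that] by (auto simp: right_End_def hom_def)
  have act_right: "\<Phi> \<phi> (a \<otimes>\<^bsub>M\<^esub> \<iota> n) = \<Phi> \<phi> a \<otimes>\<^bsub>M\<^esub> \<iota> n"
    if "\<phi> \<in> carrier P" "a \<in> carrier M" "n \<in> carrier N" for \<phi> a n
    using \<Phi>_closed[OF that(1)] that by (auto simp: right_End_def)
  have act_add: "\<Phi> (\<phi> \<oplus>\<^bsub>P\<^esub> \<psi>) a = \<Phi> \<phi> a \<oplus>\<^bsub>M\<^esub> \<Phi> \<psi> a"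
    if "\<phi> \<in> carrier P" "\<psi> \<in> carrier P" "a \<in> carrier M" for \<phi> \<psi> a
    using ring_hom_add[OF \<Phi>_hom that(1,2)] that(3) by (simp add: right_End_def)
  have act_mult [simp]: "\<Phi> (\<phi> \<otimes>\<^bsub>P\<^esub> \<psi>) a = \<Phi> \<phi> (\<Phi> \<psi> a)"
    if "\<phi> \<in> carrier P" "\<psi> \<in> carrier P" "a \<in> carrier M" for \<phi> \<psi> a
    using ring_hom_mult[OF \<Phi>_hom that(1,2)] that(3) by (simp add: right_End_def compose_def)
  have act_one [simp]: "\<Phi> \<one>\<^bsub>P\<^esub> a = a" if "a \<in> carrier M" for a
    using ring_hom_one[OF \<Phi>_hom] that by (simp add: right_End_def)
  have act_\<kappa> [simp]: "\<Phi> (\<kappa> a) b = a \<otimes>\<^bsub>M\<^esub> b" if "a \<in> carrier M" "b \<in> carrier M" for a b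
    using \<Phi>_\<kappa> that by simp
  have act_finsum: "\<Phi> (\<Oplus>\<^bsub>P\<^esub>i\<in>I. f i) a = (\<Oplus>\<^bsub>M\<^esub>i\<in>I. \<Phi> (f i) a)"
    if "f \<in> I \<rightarrow> carrier P" "a \<in> carrier M" for f a and I :: "nat set"
  proof (rule additive_maps_finsum[OF P.abelian_group_axioms M.abelian_group_axioms _ that(1)])
    show "(\<lambda>\<phi>. \<Phi> \<phi> a) \<in> additive_maps P M"
      using that(2) by (intro additive_mapsI) (auto simp: act_add)
  qed
  have ext: "\<phi> = \<psi>"
    if "\<phi> \<in> carrier P" "\<psi> \<in> carrier P" "\<And>a. a \<in> carrier M \<Longrightarrow> \<Phi> \<phi> a = \<Phi> \<psi> a" for \<phi> \<psi>
  proof -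
    have "\<Phi> \<phi> \<in> extensional (carrier M)" "\<Phi> \<psi> \<in> extensional (carrier M)"
      using \<Phi>_closed that(1,2) by (auto simp: right_End_def PiE_def)
    then have "\<Phi> \<phi> = \<Phi> \<psi>"
      using that(3) by (rule extensionalityI)
    then show ?thesis
      using \<Phi>_bij that(1,2) by (auto simp: bij_betw_def inj_on_def)
  qed
  have "(\<lambda>a\<in>carrier M. \<iota> (E a)) \<in> carrier (right_End N M \<iota>)"
    by (auto simp: right_End_def E_add E_right ring_hom_add[OF hom] ring_hom_mult[OF hom])
  then have "(\<lambda>a\<in>carrier M. \<iota> (E a)) \<in> \<Phi> ` carrier P"
    using \<Phi>_bij by (simp add: bij_betw_def)
  then obtain e where e [simp]: "e \<in> carrier P" and "\<Phi> e = (\<lambda>a\<in>carrier M. \<iota> (E a))"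
    by (elim imageE) simp
  then have act_e [simp]: "\<Phi> e a = \<iota> (E a)" if "a \<in> carrier M" for a
    using that by simp
  define E' where "E' \<phi> = (\<Oplus>\<^bsub>M\<^esub>s\<in>{..<r}. \<Phi> \<phi> (x s) \<otimes>\<^bsub>M\<^esub> y s)" for \<phi>
  have E'_closed [simp]: "E' \<phi> \<in> carrier M" if "\<phi> \<in> carrier P" for \<phi>
    unfolding E'_def using that by (intro M.finsum_closed) auto
  have E'_mult: "E' \<phi> \<otimes>\<^bsub>M\<^esub> a = (\<Oplus>\<^bsub>M\<^esub>s\<in>{..<r}. \<Phi> \<phi> (x s) \<otimes>\<^bsub>M\<^esub> (y s \<otimes>\<^bsub>M\<^esub> a))"
    if "\<phi> \<in> carrier P" "a \<in> carrier M" for \<phi> a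
  proof -
    have "E' \<phi> \<otimes>\<^bsub>M\<^esub> a = (\<Oplus>\<^bsub>M\<^esub>s\<in>{..<r}. \<Phi> \<phi> (x s) \<otimes>\<^bsub>M\<^esub> y s \<otimes>\<^bsub>M\<^esub> a)"
      unfolding E'_def using that by (intro M.finsum_ldistr) auto
    also have "\<dots> = (\<Oplus>\<^bsub>M\<^esub>s\<in>{..<r}. \<Phi> \<phi> (x s) \<otimes>\<^bsub>M\<^esub> (y s \<otimes>\<^bsub>M\<^esub> a))"
      using that by (intro M.finsum_cong') (auto simp: M.m_assoc)
    finally show ?thesis .
  qed
  have unit: "(\<Oplus>\<^bsub>P\<^esub>s\<in>{..<r}. \<kappa> (x s) \<otimes>\<^bsub>P\<^esub> e \<otimes>\<^bsub>P\<^esub> \<kappa> (y s)) = \<one>\<^bsub>P\<^esub>"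
  proof (rule ext)
    fix a assume a: "a \<in> carrier M"
    have "\<Phi> (\<Oplus>\<^bsub>P\<^esub>s\<in>{..<r}. \<kappa> (x s) \<otimes>\<^bsub>P\<^esub> e \<otimes>\<^bsub>P\<^esub> \<kappa> (y s)) a
        = (\<Oplus>\<^bsub>M\<^esub>s\<in>{..<r}. \<Phi> (\<kappa> (x s) \<otimes>\<^bsub>P\<^esub> e \<otimes>\<^bsub>P\<^esub> \<kappa> (y s)) a)"
      using a by (intro act_finsum) auto
    also have "\<dots> = (\<Oplus>\<^bsub>M\<^esub>s\<in>{..<r}. x s \<otimes>\<^bsub>M\<^esub> \<iota> (E (y s \<otimes>\<^bsub>M\<^esub> a)))"
      using a by (intro M.finsum_cong') auto
    finally show "\<Phi> (\<Oplus>\<^bsub>P\<^esub>s\<in>{..<r}. \<kappa> (x s) \<otimes>\<^bsub>P\<^esub> e \<otimes>\<^bsub>P\<^esub> \<kappa> (y s)) a = \<Phi> \<one>\<^bsub>P\<^esub> a"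
      using a by (simp add: right_basis)
  qed (auto intro!: P.finsum_closed)
  have E'_e: "E' e = \<one>\<^bsub>M\<^esub>"
  proof -
    have "E' e = (\<Oplus>\<^bsub>M\<^esub>s\<in>{..<r}. \<iota> (E (\<one>\<^bsub>M\<^esub> \<otimes>\<^bsub>M\<^esub> x s)) \<otimes>\<^bsub>M\<^esub> y s)"
      unfolding E'_def by (intro M.finsum_cong') auto
    then show ?thesis
      by (simp only: left_basis[OF M.one_closed])
  qed
  (* the two pull-down identities: e P = e M and P e = M e *)
  have pull_right: "e \<otimes>\<^bsub>P\<^esub> \<kappa> (E' (e \<otimes>\<^bsub>P\<^esub> \<phi>)) = e \<otimes>\<^bsub>P\<^esub> \<phi>" if \<phi>: "\<phi> \<in> carrier P" for \<phi>
  proof (rule ext)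
    fix a assume a: "a \<in> carrier M"
    have "\<Phi> (e \<otimes>\<^bsub>P\<^esub> \<kappa> (E' (e \<otimes>\<^bsub>P\<^esub> \<phi>))) a
        = \<iota> (E (\<Oplus>\<^bsub>M\<^esub>s\<in>{..<r}. \<iota> (E (\<Phi> \<phi> (x s))) \<otimes>\<^bsub>M\<^esub> (y s \<otimes>\<^bsub>M\<^esub> a)))"
    proof -
      have "E' (e \<otimes>\<^bsub>P\<^esub> \<phi>) \<otimes>\<^bsub>M\<^esub> a = (\<Oplus>\<^bsub>M\<^esub>s\<in>{..<r}. \<iota> (E (\<Phi> \<phi> (x s))) \<otimes>\<^bsub>M\<^esub> (y s \<otimes>\<^bsub>M\<^esub> a))"
        using a \<phi> by (subst E'_mult) (auto intro!: M.finsum_cong')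
      then show ?thesis
        using a \<phi> by simp
    qed
    also have "\<dots> = (\<Oplus>\<^bsub>M\<^esub>s\<in>{..<r}. \<iota> (E (\<iota> (E (\<Phi> \<phi> (x s))) \<otimes>\<^bsub>M\<^esub> (y s \<otimes>\<^bsub>M\<^esub> a))))"
      using a \<phi> by (intro additive_maps_finsum[OF M.abelian_group_axioms M.abelian_group_axioms eps_additive]) auto
    also have "\<dots> = (\<Oplus>\<^bsub>M\<^esub>s\<in>{..<r}. \<iota> (E (\<Phi> \<phi> (x s \<otimes>\<^bsub>M\<^esub> \<iota> (E (y s \<otimes>\<^bsub>M\<^esub> a))))))"
      using a \<phi> by (intro M.finsum_cong') (auto simp: E_left E_right act_right)
    also have "\<dots> = \<iota> (E (\<Phi> \<phi> (\<Oplus>\<^bsub>M\<^esub>s\<in>{..<r}. x s \<otimes>\<^bsub>M\<^esub> \<iota> (E (y s \<otimes>\<^bsub>M\<^esub> a)))))"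
      using a \<phi>
      by (intro additive_maps_finsum[OF M.abelian_group_axioms M.abelian_group_axioms, symmetric]
          additive_maps_comp[OF act_additive eps_additive]) auto
    also have "\<dots> = \<Phi> (e \<otimes>\<^bsub>P\<^esub> \<phi>) a"
      using a \<phi> by (simp add: right_basis)
    finally show "\<Phi> (e \<otimes>\<^bsub>P\<^esub> \<kappa> (E' (e \<otimes>\<^bsub>P\<^esub> \<phi>))) a = \<Phi> (e \<otimes>\<^bsub>P\<^esub> \<phi>) a" .
  qed (use \<phi> in auto)
  have pull_left: "\<kappa> (E' (\<phi> \<otimes>\<^bsub>P\<^esub> e)) \<otimes>\<^bsub>P\<^esub> e = \<phi> \<otimes>\<^bsub>P\<^esub> e" if \<phi>: "\<phi> \<in> carrier P" for \<phi>
  proof (rule ext)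
    have act_base: "\<Phi> \<phi> (\<iota> n) = \<Phi> \<phi> \<one>\<^bsub>M\<^esub> \<otimes>\<^bsub>M\<^esub> \<iota> n" if "n \<in> carrier N" for n
      using act_right[of \<phi> "\<one>\<^bsub>M\<^esub>" n] \<phi> that by simp
    have "E' (\<phi> \<otimes>\<^bsub>P\<^esub> e) = (\<Oplus>\<^bsub>M\<^esub>s\<in>{..<r}. \<Phi> \<phi> \<one>\<^bsub>M\<^esub> \<otimes>\<^bsub>M\<^esub> (\<iota> (E (\<one>\<^bsub>M\<^esub> \<otimes>\<^bsub>M\<^esub> x s)) \<otimes>\<^bsub>M\<^esub> y s))"
      unfolding E'_def using \<phi> by (intro M.finsum_cong') (auto simp: act_base M.m_assoc)
    also have "\<dots> = \<Phi> \<phi> \<one>\<^bsub>M\<^esub> \<otimes>\<^bsub>M\<^esub> (\<Oplus>\<^bsub>M\<^esub>s\<in>{..<r}. \<iota> (E (\<one>\<^bsub>M\<^esub> \<otimes>\<^bsub>M\<^esub> x s)) \<otimes>\<^bsub>M\<^esub> y s)"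
      using \<phi> by (intro M.finsum_rdistr[symmetric]) auto
    also have "\<dots> = \<Phi> \<phi> \<one>\<^bsub>M\<^esub>"
      using \<phi> by (simp only: left_basis[OF M.one_closed]) simp
    finally have "E' (\<phi> \<otimes>\<^bsub>P\<^esub> e) = \<Phi> \<phi> \<one>\<^bsub>M\<^esub>" .
    then show "\<Phi> (\<kappa> (E' (\<phi> \<otimes>\<^bsub>P\<^esub> e)) \<otimes>\<^bsub>P\<^esub> e) a = \<Phi> (\<phi> \<otimes>\<^bsub>P\<^esub> e) a" if "a \<in> carrier M" for a
      using \<phi> that by (simp add: act_base)
  qed (use \<phi> in auto)
  have "frobenius_data M P \<kappa> E' r (\<lambda>s. \<kappa> (x s) \<otimes>\<^bsub>P\<^esub> e) (\<lambda>s. e \<otimes>\<^bsub>P\<^esub> \<kappa> (y s))"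
  proof (intro frobenius_data.intro frobenius_data_axioms.intro M.ring_axioms P.ring_axioms \<kappa>)
    fix \<phi> \<psi> assume *: "\<phi> \<in> carrier P" "\<psi> \<in> carrier P"
    have "E' (\<phi> \<oplus>\<^bsub>P\<^esub> \<psi>) = (\<Oplus>\<^bsub>M\<^esub>s\<in>{..<r}. \<Phi> \<phi> (x s) \<otimes>\<^bsub>M\<^esub> y s \<oplus>\<^bsub>M\<^esub> \<Phi> \<psi> (x s) \<otimes>\<^bsub>M\<^esub> y s)"
      unfolding E'_def using * by (intro M.finsum_cong') (auto simp: act_add M.l_distr)
    also have "\<dots> = E' \<phi> \<oplus>\<^bsub>M\<^esub> E' \<psi>"
      unfolding E'_def using * by (intro M.finsum_addf) auto
    finally show "E' (\<phi> \<oplus>\<^bsub>P\<^esub> \<psi>) = E' \<phi> \<oplus>\<^bsub>M\<^esub> E' \<psi>" .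
  next
    fix a \<phi> assume *: "a \<in> carrier M" "\<phi> \<in> carrier P"
    have "E' (\<kappa> a \<otimes>\<^bsub>P\<^esub> \<phi>) = (\<Oplus>\<^bsub>M\<^esub>s\<in>{..<r}. a \<otimes>\<^bsub>M\<^esub> (\<Phi> \<phi> (x s) \<otimes>\<^bsub>M\<^esub> y s))"
      unfolding E'_def using * by (intro M.finsum_cong') (auto simp: M.m_assoc)
    also have "\<dots> = a \<otimes>\<^bsub>M\<^esub> E' \<phi>"
      unfolding E'_def using * by (intro M.finsum_rdistr[symmetric]) auto
    finally show "E' (\<kappa> a \<otimes>\<^bsub>P\<^esub> \<phi>) = a \<otimes>\<^bsub>M\<^esub> E' \<phi>" .
    have "E' (\<phi> \<otimes>\<^bsub>P\<^esub> \<kappa> a) = (\<Oplus>\<^bsub>M\<^esub>s\<in>{..<r}. \<Phi> \<phi> (a \<otimes>\<^bsub>M\<^esub> x s) \<otimes>\<^bsub>M\<^esub> y s)"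
      unfolding E'_def using * by (intro M.finsum_cong') auto
    also have "\<dots> = (\<Oplus>\<^bsub>M\<^esub>s\<in>{..<r}. \<Phi> \<phi> (x s) \<otimes>\<^bsub>M\<^esub> (y s \<otimes>\<^bsub>M\<^esub> a))"
    proof (rule casimir[OF M.abelian_group_axioms _ _ _ *(1)])
      show "(\<lambda>b. \<Phi> \<phi> c \<otimes>\<^bsub>M\<^esub> b) \<in> additive_maps M M" if "c \<in> carrier M" for c
        using that * by (intro M.additive_maps_mult) auto
      show "(\<lambda>c. \<Phi> \<phi> c \<otimes>\<^bsub>M\<^esub> b) \<in> additive_maps M M" if "b \<in> carrier M" for b
        using that * by (intro additive_maps_comp[OF act_additive M.additive_maps_mult(2)]) auto
      show "\<Phi> \<phi> (c \<otimes>\<^bsub>M\<^esub> s) \<otimes>\<^bsub>M\<^esub> b = \<Phi> \<phi> c \<otimes>\<^bsub>M\<^esub> (s \<otimes>\<^bsub>M\<^esub> b)"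
        if "c \<in> carrier M" "s \<in> \<iota> ` carrier N" "b \<in> carrier M" for c s b
        using that * by (auto simp: act_right M.m_assoc)
    qed
    finally show "E' (\<phi> \<otimes>\<^bsub>P\<^esub> \<kappa> a) = E' \<phi> \<otimes>\<^bsub>M\<^esub> a"
      using * by (simp add: E'_mult)
  next
    fix \<phi> assume \<phi>: "\<phi> \<in> carrier P"
    have "(\<Oplus>\<^bsub>P\<^esub>s\<in>{..<r}. \<kappa> (E' (\<phi> \<otimes>\<^bsub>P\<^esub> (\<kappa> (x s) \<otimes>\<^bsub>P\<^esub> e))) \<otimes>\<^bsub>P\<^esub> (e \<otimes>\<^bsub>P\<^esub> \<kappa> (y s)))
        = (\<Oplus>\<^bsub>P\<^esub>s\<in>{..<r}. \<phi> \<otimes>\<^bsub>P\<^esub> (\<kappa> (x s) \<otimes>\<^bsub>P\<^esub> e \<otimes>\<^bsub>P\<^esub> \<kappa> (y s)))"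
    proof (rule P.finsum_cong')
      fix s assume s: "s \<in> {..<r}"
      show "\<kappa> (E' (\<phi> \<otimes>\<^bsub>P\<^esub> (\<kappa> (x s) \<otimes>\<^bsub>P\<^esub> e))) \<otimes>\<^bsub>P\<^esub> (e \<otimes>\<^bsub>P\<^esub> \<kappa> (y s))
          = \<phi> \<otimes>\<^bsub>P\<^esub> (\<kappa> (x s) \<otimes>\<^bsub>P\<^esub> e \<otimes>\<^bsub>P\<^esub> \<kappa> (y s))"
        using s \<phi> pull_left[of "\<phi> \<otimes>\<^bsub>P\<^esub> \<kappa> (x s)"] by (simp add: P.m_assoc flip: P.m_assoc[of "\<kappa> (E' _)"])
    qed (use \<phi> in auto)
    also have "\<dots> = \<phi> \<otimes>\<^bsub>P\<^esub> (\<Oplus>\<^bsub>P\<^esub>s\<in>{..<r}. \<kappa> (x s) \<otimes>\<^bsub>P\<^esub> e \<otimes>\<^bsub>P\<^esub> \<kappa> (y s))"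
      using \<phi> by (intro P.finsum_rdistr[symmetric]) auto
    finally show "(\<Oplus>\<^bsub>P\<^esub>s\<in>{..<r}. \<kappa> (E' (\<phi> \<otimes>\<^bsub>P\<^esub> (\<kappa> (x s) \<otimes>\<^bsub>P\<^esub> e))) \<otimes>\<^bsub>P\<^esub> (e \<otimes>\<^bsub>P\<^esub> \<kappa> (y s))) = \<phi>"
      using \<phi> by (simp add: unit)
    have "(\<Oplus>\<^bsub>P\<^esub>s\<in>{..<r}. (\<kappa> (x s) \<otimes>\<^bsub>P\<^esub> e) \<otimes>\<^bsub>P\<^esub> \<kappa> (E' ((e \<otimes>\<^bsub>P\<^esub> \<kappa> (y s)) \<otimes>\<^bsub>P\<^esub> \<phi>)))
        = (\<Oplus>\<^bsub>P\<^esub>s\<in>{..<r}. (\<kappa> (x s) \<otimes>\<^bsub>P\<^esub> e \<otimes>\<^bsub>P\<^esub> \<kappa> (y s)) \<otimes>\<^bsub>P\<^esub> \<phi>)"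
      using \<phi> by (intro P.finsum_cong') (auto simp: P.m_assoc pull_right)
    also have "\<dots> = (\<Oplus>\<^bsub>P\<^esub>s\<in>{..<r}. \<kappa> (x s) \<otimes>\<^bsub>P\<^esub> e \<otimes>\<^bsub>P\<^esub> \<kappa> (y s)) \<otimes>\<^bsub>P\<^esub> \<phi>"
      using \<phi> by (intro P.finsum_ldistr[symmetric]) auto
    finally show "(\<Oplus>\<^bsub>P\<^esub>s\<in>{..<r}. (\<kappa> (x s) \<otimes>\<^bsub>P\<^esub> e) \<otimes>\<^bsub>P\<^esub> \<kappa> (E' ((e \<otimes>\<^bsub>P\<^esub> \<kappa> (y s)) \<otimes>\<^bsub>P\<^esub> \<phi>))) = \<phi>"
      using \<phi> by (simp add: unit)
  qed auto
  then have "frobenius_hom M P \<kappa> E'"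
    unfolding frobenius_hom_def by (intro exI)
  moreover have "jones_projection N M P \<iota> \<kappa> E E' e"
    unfolding jones_projection_def
  proof (intro conjI ballI e E'_e)
    show "e \<otimes>\<^bsub>P\<^esub> \<kappa> (\<iota> n) = \<kappa> (\<iota> n) \<otimes>\<^bsub>P\<^esub> e" if "n \<in> carrier N" for n
      using that by (intro ext) (auto simp: E_left ring_hom_mult[OF hom])
    show "e \<otimes>\<^bsub>P\<^esub> \<kappa> a \<otimes>\<^bsub>P\<^esub> e = \<kappa> (\<iota> (E a)) \<otimes>\<^bsub>P\<^esub> e" if "a \<in> carrier M" for a
      using that by (intro ext) (auto simp: E_right ring_hom_mult[OF hom])
  qed
  ultimately show ?thesis by blast
qed


section \<open>Descent along the Jones tower\<close>

lemma depth_three_iff_pairing: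
  fixes A :: "'a ring"
  assumes "ring_extension C B f" and "frobenius_hom B A g E"
  obtains r x y where "frobenius_system A (g ` carrier B) (\<lambda>a. g (E a)) r x y"
    and "right_depth_three A B C f g \<longleftrightarrow>
      (\<exists>k>0. depth_three_pairing A (g ` carrier B) ((g \<circ> f) ` carrier C) (\<lambda>a. g (E a)) k)"
    and "left_depth_three A B C f g \<longleftrightarrow>
      (\<exists>k>0. depth_three_pairing A (g ` carrier B) ((g \<circ> f) ` carrier C) (\<lambda>a. g (E a)) k)"
proof -
  obtain r x y where "frobenius_data B A g E r x y"
    using assms(2) unfolding frobenius_hom_def by (elim exE) (rule that)
  then interpret frobenius_data B A g E r x y .
  have ext: "ring_extension B A g"
    using N.ring_axioms M.ring_axioms hom by (simp add: ring_extension_def)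
  have v: "g \<circ> f \<in> carrier C \<rightarrow> carrier A"
    using assms(1) hom by (auto simp: ring_extension_def ring_hom_closed)
  show thesis
    by (rule that[OF frobenius_system_axioms])
      (simp_all add: right_depth_three_def left_depth_three_def assms(1) ext
        right_tensor_summand_iff_pairing[OF frobenius_system_axioms v]
        left_tensor_summand_iff_pairing[OF frobenius_system_axioms v])
qed

text \<open>Depth two asks for one exponent that serves both sides; the pairing provides it.\<close>

lemma depth_two_if_pairing:
  fixes A :: "'a ring"
  assumes frobenius: "frobenius_hom C A u E"
    and "0 < k" and pairing: "depth_three_pairing A (u ` carrier C) (u ` carrier C) (\<lambda>a. u (E a)) k"
  shows "depth_two A C u"
proof -
  obtain r x y where "frobenius_data C A u E r x y"
    using frobenius unfolding frobenius_hom_def by (elim exE) (rule that)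
  then interpret frobenius_data C A u E r x y .
  have "u \<in> carrier C \<rightarrow> carrier A"
    by (auto simp: \<iota>_closed)
  then show ?thesis
    using \<open>0 < k\<close> pairing N.ring_axioms M.ring_axioms hom
      right_tensor_summand_iff_pairing[OF frobenius_system_axioms, of u C k]
      left_tensor_summand_iff_pairing[OF frobenius_system_axioms, of u C k]
    unfolding depth_two_def ring_extension_def by (intro conjI exI[of _ k]) simp_all
qed

text \<open>One step down the tower \<open>N \<rightarrow> M \<rightarrow> P \<rightarrow> A\<close>. For \<open>z\<close> in \<open>M\<close>, the Jones projection satisfies
  \<open>E'(e z e) = E(z)\<close>, so the corner of \<open>e\<close> turns a quasibase for \<open>P \<otimes>\<^sub>M A\<close> into one for \<open>M \<otimes>\<^sub>N A\<close>.
  Then \<open>A \<otimes>\<^sub>N A = A \<otimes>\<^sub>M (M \<otimes>\<^sub>N A)\<close> is obtained by composition.\<close>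

lemma quasibase_descent:
  fixes A :: "'a ring"
  assumes E: "frobenius_hom N M \<iota> E" and E': "frobenius_hom M P \<kappa> E'"
    and e: "jones_projection N M P \<iota> \<kappa> E E' e"
    and g': "g' \<in> ring_hom P A" and F: "frobenius_hom M A (g' \<circ> \<kappa>) F"
    and Y: "Y \<subseteq> carrier A"
    and step: "depth_quasibase A ((g' \<circ> \<kappa>) ` carrier M) Y (carrier P) g' (\<lambda>z. g' (\<kappa> (E' z))) k"
    and total: "depth_quasibase A ((g' \<circ> \<kappa>) ` carrier M) Y (carrier A) id (\<lambda>a. g' (\<kappa> (F a))) l"
  shows "depth_quasibase A ((g' \<circ> \<kappa> \<circ> \<iota>) ` carrier N) Y (carrier M) (g' \<circ> \<kappa>) (\<lambda>z. g' (\<kappa> (\<iota> (E z)))) k"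
    and "depth_quasibase A ((g' \<circ> \<kappa> \<circ> \<iota>) ` carrier N) Y (carrier A) id (\<lambda>a. g' (\<kappa> (\<iota> (E (F a))))) (l * k)"
proof -
  obtain r x y where "frobenius_data N M \<iota> E r x y"
    using E unfolding frobenius_hom_def by (elim exE) (rule that)
  then interpret NM: frobenius_data N M \<iota> E r x y .
  obtain r' x' y' where "frobenius_data M P \<kappa> E' r' x' y'"
    using E' unfolding frobenius_hom_def by (elim exE) (rule that)
  then interpret MP: frobenius_data M P \<kappa> E' r' x' y' .
  obtain q u w where "frobenius_data M A (g' \<circ> \<kappa>) F q u w"
    using F unfolding frobenius_hom_def by (elim exE) (rule that)
  then interpret MA: frobenius_data M A "g' \<circ> \<kappa>" F q u w .
  note [simp] = NM.\<iota>_closed MP.\<iota>_closed NM.E_closed MP.E_closed MA.E_closed ring_hom_closed[OF g']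
  have e_closed [simp]: "e \<in> carrier P"
    and e_comm: "\<And>n. n \<in> carrier N \<Longrightarrow> e \<otimes>\<^bsub>P\<^esub> \<kappa> (\<iota> n) = \<kappa> (\<iota> n) \<otimes>\<^bsub>P\<^esub> e"
    and e_corner: "\<And>a. a \<in> carrier M \<Longrightarrow> e \<otimes>\<^bsub>P\<^esub> \<kappa> a \<otimes>\<^bsub>P\<^esub> e = \<kappa> (\<iota> (E a)) \<otimes>\<^bsub>P\<^esub> e"
    and e_one: "E' e = \<one>\<^bsub>M\<^esub>"
    using e by (auto simp: jones_projection_def)
  have base: "(g' \<circ> \<kappa> \<circ> \<iota>) ` carrier N \<subseteq> (g' \<circ> \<kappa>) ` carrier M"
    by auto
  have corner: "\<exists>z\<in>carrier P. g' z = g' e \<otimes>\<^bsub>A\<^esub> (g' \<circ> \<kappa>) a \<otimes>\<^bsub>A\<^esub> g' e \<and> g' (\<kappa> (E' z)) = g' (\<kappa> (\<iota> (E a)))"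
    if a: "a \<in> carrier M" for a
  proof (intro bexI conjI)
    show "g' (e \<otimes>\<^bsub>P\<^esub> \<kappa> a \<otimes>\<^bsub>P\<^esub> e) = g' e \<otimes>\<^bsub>A\<^esub> (g' \<circ> \<kappa>) a \<otimes>\<^bsub>A\<^esub> g' e"
      using a by (simp add: ring_hom_mult[OF g'])
    show "g' (\<kappa> (E' (e \<otimes>\<^bsub>P\<^esub> \<kappa> a \<otimes>\<^bsub>P\<^esub> e))) = g' (\<kappa> (\<iota> (E a)))"
      using a by (simp add: e_corner MP.E_left e_one)
  qed (use a in simp)
  show inner: "depth_quasibase A ((g' \<circ> \<kappa> \<circ> \<iota>) ` carrier N) Y (carrier M) (g' \<circ> \<kappa>)
      (\<lambda>z. g' (\<kappa> (\<iota> (E z)))) k"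
  proof (rule depth_quasibase_corner[OF MA.M.ring_axioms step base _ Y])
    show "g' e \<otimes>\<^bsub>A\<^esub> s = s \<otimes>\<^bsub>A\<^esub> g' e" if "s \<in> (g' \<circ> \<kappa> \<circ> \<iota>) ` carrier N" for s
      using that by (auto simp: e_comm simp flip: ring_hom_mult[OF g'])
  qed (use corner in auto)
  show "depth_quasibase A ((g' \<circ> \<kappa> \<circ> \<iota>) ` carrier N) Y (carrier A) id
      (\<lambda>a. g' (\<kappa> (\<iota> (E (F a))))) (l * k)"
    by (rule depth_quasibase_comp[OF MA.M.ring_axioms total inner base]) auto
qed

text \<open>What is carried down from level \<open>L\<close> to level \<open>k\<close>. The map from level \<open>k\<close> to the top is kept in the
  factored form \<open>g' \<circ> h k\<close>, because the Jones projection of the next step lies in level \<open>k + 1\<close> and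
  acts on the top ring through \<open>g'\<close>.\<close>

definition descended ::
  "(nat \<Rightarrow> 'u ring) \<Rightarrow> (nat \<Rightarrow> 'u \<Rightarrow> 'u) \<Rightarrow> (nat \<Rightarrow> 'u \<Rightarrow> 'u) \<Rightarrow> nat \<Rightarrow> nat \<Rightarrow> bool" where
  "descended R h E L k \<longleftrightarrow> (\<exists>g' F i j. g' \<in> ring_hom (R (Suc k)) (R L) \<and>
     g' \<circ> h k \<circ> tower_map h k = tower_map h L \<and> frobenius_hom (R k) (R L) (g' \<circ> h k) F \<and>
     0 < i \<and> depth_quasibase (R L) ((g' \<circ> h k) ` carrier (R k)) (tower_map h L ` carrier (R 0))
       (carrier (R (Suc k))) g' (\<lambda>z. g' (h k (E k z))) i \<and>
     0 < j \<and> depth_quasibase (R L) ((g' \<circ> h k) ` carrier (R k)) (tower_map h L ` carrier (R 0))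
       (carrier (R L)) id (\<lambda>a. g' (h k (F a))) j)"

lemma descended_step:
  assumes E: "frobenius_hom (R k) (R (Suc k)) (h k) (E k)"
    and E': "frobenius_hom (R (Suc k)) (R (Suc (Suc k))) (h (Suc k)) (E (Suc k))"
    and e: "jones_projection (R k) (R (Suc k)) (R (Suc (Suc k))) (h k) (h (Suc k)) (E k) (E (Suc k)) e"
    and Y: "tower_map h L ` carrier (R 0) \<subseteq> carrier (R L)"
    and descended: "descended R h E L (Suc k)"
  shows "descended R h E L k"
proof -
  obtain g' F i j where g': "g' \<in> ring_hom (R (Suc (Suc k))) (R L)"
    and comp: "g' \<circ> h (Suc k) \<circ> tower_map h (Suc k) = tower_map h L"
    and F: "frobenius_hom (R (Suc k)) (R L) (g' \<circ> h (Suc k)) F" and ij: "0 < i" "0 < j"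
    and step: "depth_quasibase (R L) ((g' \<circ> h (Suc k)) ` carrier (R (Suc k)))
      (tower_map h L ` carrier (R 0)) (carrier (R (Suc (Suc k)))) g' (\<lambda>z. g' (h (Suc k) (E (Suc k) z))) i"
    and total: "depth_quasibase (R L) ((g' \<circ> h (Suc k)) ` carrier (R (Suc k)))
      (tower_map h L ` carrier (R 0)) (carrier (R L)) id (\<lambda>a. g' (h (Suc k) (F a))) j"
    using descended unfolding descended_def by (elim exE conjE) (rule that)
  note new = quasibase_descent[OF E E' e g' F Y step total]
  have hom: "h (Suc k) \<in> ring_hom (R (Suc k)) (R (Suc (Suc k)))"
    using E' unfolding frobenius_hom_def by (elim exE) (rule frobenius_data.hom)
  show ?thesis
    unfolding descended_def
  proof (intro exI conjI)
    show "g' \<circ> h (Suc k) \<in> ring_hom (R (Suc k)) (R L)"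
      using hom g' by (rule ring_hom_trans)
    show "g' \<circ> h (Suc k) \<circ> h k \<circ> tower_map h k = tower_map h L"
      using comp by (simp add: o_assoc)
    show "frobenius_hom (R k) (R L) (g' \<circ> h (Suc k) \<circ> h k) (E k \<circ> F)"
      by (rule frobenius_hom_trans[OF E F])
    show "0 < i" "0 < j * i"
      using ij by simp_all
  qed (use new in \<open>simp_all add: comp_def\<close>)
qed

text \<open>The Frobenius homomorphisms have to be chosen coherently, each one as the multiplication map of the
  basic construction for the previous one, since the Jones projections relate consecutive ones.\<close>

lemma tower_frobenius_homs:
  assumes frobenius: "frobenius_extension N M \<iota>" and tower: "jones_tower L N M \<iota> R h"
  obtains E where "\<And>k. k < L \<Longrightarrow> frobenius_hom (R k) (R (Suc k)) (h k) (E k)"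
    and "\<And>k. Suc k < L \<Longrightarrow> \<exists>e. jones_projection (R k) (R (Suc k)) (R (Suc (Suc k))) (h k) (h (Suc k))
      (E k) (E (Suc k)) e"
proof -
  have R: "R 0 = N" "R (Suc 0) = M" "h 0 = \<iota>"
    using tower by (simp_all add: jones_tower_def)
  define P where "P k E \<longleftrightarrow> (k < L \<longrightarrow> frobenius_hom (R k) (R (Suc k)) (h k) E)" for k E
  define Q where "Q k E E' \<longleftrightarrow> (Suc k < L \<longrightarrow> (\<exists>e. jones_projection (R k) (R (Suc k)) (R (Suc (Suc k)))
    (h k) (h (Suc k)) E E' e))" for k E E'
  have "\<exists>E. \<forall>k. P k (E k) \<and> Q k (E k) (E (Suc k))"
  proof (rule dependent_nat_choice)
    show "\<exists>E. P 0 E"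
      using frobenius R by (simp add: P_def frobenius_extension_iff)
    fix E k assume P: "P k E"
    show "\<exists>E'. P (Suc k) E' \<and> Q k E E'"
    proof (cases "Suc k < L")
      case True
      then obtain r x y where "frobenius_data (R k) (R (Suc k)) (h k) E r x y"
        using P unfolding P_def frobenius_hom_def by auto
      then interpret frobenius_data "R k" "R (Suc k)" "h k" E r x y .
      have ext: "ring_extension (R (Suc k)) (R (Suc (Suc k))) (h (Suc k))"
        using tower True by (simp add: jones_tower_def)
      obtain \<Phi> where \<Phi>: "\<Phi> \<in> ring_iso (R (Suc (Suc k))) (right_End (R k) (R (Suc k)) (h k))"
        and \<Phi>_h: "\<forall>x\<in>carrier (R (Suc k)).
          \<Phi> (h (Suc k) x) = (\<lambda>y\<in>carrier (R (Suc k)). x \<otimes>\<^bsub>R (Suc k)\<^esub> y)"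
        using tower True unfolding jones_tower_def by (auto dest!: spec[of _ k])
      show ?thesis
        using basic_construction[OF ext \<Phi> \<Phi>_h[rule_format]] by (auto simp: P_def Q_def)
    qed (simp add: P_def Q_def)
  qed
  then show thesis
    using that by (auto simp: P_def Q_def)
qed

theorem theorem8p5:
  fixes N M :: "'u ring" and \<iota> :: "'u \<Rightarrow> 'u"
    and R :: "nat \<Rightarrow> 'u ring" and h :: "nat \<Rightarrow> 'u \<Rightarrow> 'u"
    and m n :: nat
  assumes "m > 0" and "n = 2 ^ m + 1"
    and "frobenius_extension N M \<iota>"
    and "jones_tower (n - 1) N M \<iota> R h"
    and "tower_depth R h n"
  shows "depth_two (R (n - 1)) N (tower_map h (n - 1)) \<and>
         frobenius_extension N (R (n - 1)) (tower_map h (n - 1))"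
proof -
  define l where "l = n - 2"
  have n: "n - 1 = Suc l" "n - 2 = l"
    using assms(1,2) by (simp_all add: l_def)
  let ?A = "R (Suc l)" and ?Y = "tower_map h (Suc l) ` carrier (R 0)"
  have R0: "R 0 = N"
    using assms(4) by (simp add: jones_tower_def)
  obtain E where E: "\<And>k. k < Suc l \<Longrightarrow> frobenius_hom (R k) (R (Suc k)) (h k) (E k)"
    and e: "\<And>k. Suc k < Suc l \<Longrightarrow> \<exists>e. jones_projection (R k) (R (Suc k)) (R (Suc (Suc k))) (h k)
      (h (Suc k)) (E k) (E (Suc k)) e"
    by (fact tower_frobenius_homs[OF assms(3) assms(4)[unfolded n]])
  have depth: "right_depth_three ?A (R l) (R 0) (tower_map h l) (h l) \<or>
      left_depth_three ?A (R l) (R 0) (tower_map h l) (h l)"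
    using assms(5) unfolding tower_depth_def n by blast
  then have ext: "ring_extension (R 0) (R l) (tower_map h l)"
    and ext_l: "ring_extension (R l) ?A (h l)"
    by (auto simp: right_depth_three_def left_depth_three_def)
  have Y: "?Y \<subseteq> carrier ?A"
    using ext ext_l by (auto simp: ring_extension_def ring_hom_closed)
  have A: "ring ?A"
    using ext_l by (simp add: ring_extension_def)
  obtain r x y where system: "frobenius_system ?A (h l ` carrier (R l)) (\<lambda>a. h l (E l a)) r x y"
    and right: "right_depth_three ?A (R l) (R 0) (tower_map h l) (h l) \<longleftrightarrow>
      (\<exists>k>0. depth_three_pairing ?A (h l ` carrier (R l)) ((h l \<circ> tower_map h l) ` carrier (R 0))
        (\<lambda>a. h l (E l a)) k)"
    and left: "left_depth_three ?A (R l) (R 0) (tower_map h l) (h l) \<longleftrightarrow>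
      (\<exists>k>0. depth_three_pairing ?A (h l ` carrier (R l)) ((h l \<circ> tower_map h l) ` carrier (R 0))
        (\<lambda>a. h l (E l a)) k)"
    by (fact depth_three_iff_pairing[OF ext E[OF lessI]])
  obtain k where k: "0 < k"
    and pairing: "depth_three_pairing ?A (h l ` carrier (R l)) ?Y (\<lambda>a. h l (E l a)) k"
    using depth right left by auto
  (* at the top level, the two quasibases that are carried down coincide *)
  have top: "depth_quasibase ?A (h l ` carrier (R l)) ?Y (carrier ?A) id (\<lambda>a. h l (E l a)) k"
    by (rule frobenius_system.pairing_imp_quasibase[OF system Y pairing])
  have "descended R h E (Suc l) l"
    unfolding descended_def
  proof (intro exI conjI)
    show "id \<in> ring_hom ?A ?A"
      by (simp add: ring_hom_def)
    show "frobenius_hom (R l) ?A (id \<circ> h l) (E l)"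
      using E[of l] by simp
  qed (use k top in simp_all)
  moreover have "descended R h E (Suc l) i" if i: "descended R h E (Suc l) (Suc i)" "i < l" for i
  proof -
    obtain e' where "jones_projection (R i) (R (Suc i)) (R (Suc (Suc i))) (h i) (h (Suc i)) (E i) (E (Suc i)) e'"
      using e[of i] i(2) by auto
    from descended_step[where E = E, OF E E this Y i(1)] i(2) show ?thesis by simp
  qed
  ultimately have "descended R h E (Suc l) 0"
    using inc_induct[of 0 l "descended R h E (Suc l)"] by simp
  then obtain g' F j where comp: "g' \<circ> h 0 \<circ> tower_map h 0 = tower_map h (Suc l)"
    and F': "frobenius_hom (R 0) ?A (g' \<circ> h 0) F" and j: "0 < j"
    and total': "depth_quasibase ?A ((g' \<circ> h 0) ` carrier (R 0)) ?Y (carrier ?A) id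
      (\<lambda>a. g' (h 0 (F a))) j"
    unfolding descended_def by (elim exE conjE) (rule that)
  define g where "g = g' \<circ> h 0"
  have g: "g = tower_map h (Suc l)"
    using comp unfolding g_def by (simp only: tower_map.simps(1) comp_id)
  have F: "frobenius_hom N ?A g F"
    using F' by (simp only: g_def R0)
  have total: "depth_quasibase ?A (g ` carrier N) ?Y (carrier ?A) id (\<lambda>a. g (F a)) j"
    using total' by (simp add: g_def R0)
  obtain r x y where "frobenius_data N ?A g F r x y"
    using F unfolding frobenius_hom_def by (elim exE) (rule that)
  then interpret bottom: frobenius_data N ?A g F r x y .
  have "depth_three_pairing ?A (g ` carrier N) ?Y (\<lambda>a. g (F a)) j"
    by (rule bottom.quasibase_imp_pairing[OF Y total])
  then have "depth_two ?A N g"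
    using F j by (intro depth_two_if_pairing) (simp_all add: g R0)
  moreover have "frobenius_extension N ?A g"
    using F by (auto simp: frobenius_extension_iff)
  ultimately show ?thesis
    unfolding n g by blast
qed

end
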